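(* Let $0<a<b<1$ and let $H:\mathbb{R}\to[a,b]$ be a (deterministic) function such that for every $t\in\mathbb{R}$ there exist $\gamma>H(t)$, $R_t>0$ and $c_t>0$ such that $|H(s)-H(t)|\le c_t|s-t|^{\gamma}$ for all $s\in\mathbb{R}$ with $|s-t|\le R_t$. Let $B_H(t)=B(t,H(t))$, $t\in\mathbb{R}$, be the Multifractional Brownian Motion with Hurst function $H$. Then almost surely, for every non-empty open interval $I$ of $\mathbb{R}$: (1) there exists $t\in I$ (a rapid point) such that $$0<\limsup_{s\to t}\frac{|B_H(s)-B_H(t)|}{|s-t|^{H(t)}\sqrt{\log|s-t|^{-1}}}<\infty;$$ (2) (Lebesgue-)almost every $t\in I$ (an ordinary point) is such that $$0<\limsup_{s\to t}\frac{|B_H(s)-B_H(t)|}{|s-t|^{H(t)}\sqrt{\log\log|s-t|^{-1}}}<\infty;$$ (3) there exists $t\in I$ (a slow point) such that $$0<\limsup_{s\to t}\frac{|B_H(s)-B_H(t)|}{|s-t|^{H(t)}}<\infty.$$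
   Context: The generator of Multifractional Brownian Motion is the real Gaussian field on $\mathbb{R}\times(0,1)$ defined by $$B(t,\theta)=\int_{\mathbb{R}}\frac{e^{it\xi}-1}{|\xi|^{\theta+\frac12}}\,d\widehat W(\xi),$$ where $d\widehat W$ is the "Fourier transform" of the real-valued white noise measure $dW$, i.e. $\int_{\mathbb{R}} f\,dW=\int_{\mathbb{R}}\widehat f\,d\widehat W$ almost surely for all $f\in L^2(\mathbb{R})$. Throughout, $B$ denotes the continuous version given by the wavelet-type expansion $$B(t,\theta)=\sum_{j\in\mathbb{Z}}\sum_{k\in\mathbb{Z}}2^{-j\theta}\varepsilon_{j,k}\big(\Psi(2^jt-k,\theta)-\Psi(-k,\theta)\big),$$ which converges almost surely uniformly on compact subsets of $\mathbb{R}\times(0,1)$. Here $(\varepsilon_{j,k})_{(j,k)\in\mathbb{Z}^2}$ are i.i.d. $\mathcal N(0,1)$ random variables, $\psi$ is the Lemarié–Meyer mother wavelet (so $\{2^{j/2}\psi(2^j\cdot-k):(j,k)\in\mathbb{Z}^2\}$ is an orthonormal basis of $L^2(\mathbb{R})$, $\psi$ is in the Schwartz class, and $\widehat\psi$ is compactly supported and vanishes in a neighbourhood of $0$), and $$\Psi(t,\theta)=\int_{\mathbb{R}}\frac{e^{it\xi}\widehat\psi(\xi)}{|\xi|^{\theta+\frac12}}\,d\xi .$$ *)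

theory Defs
  imports "HOL-Probability.Probability"
begin

text \<open>Unitary normalisation, so that Plancherel's identity holds without a constant and the
  white noise and its Fourier transform have the same variance.\<close>

definition fourier :: "(real \<Rightarrow> real) \<Rightarrow> real \<Rightarrow> complex" where
  "fourier f \<xi> =
     complex_of_real (1 / sqrt (2 * pi)) * (LINT x|lborel. cis (- (\<xi> * x)) * complex_of_real (f x))"

definition schwartz :: "(real \<Rightarrow> real) \<Rightarrow> bool" where
  "schwartz f \<longleftrightarrow>
     (\<forall>n x. (deriv ^^ n) f differentiable at x) \<and>
     (\<forall>m n. bounded (range (\<lambda>x. x ^ m * (deriv ^^ n) f x)))"

definition wavelet :: "(real \<Rightarrow> real) \<Rightarrow> int \<times> int \<Rightarrow> real \<Rightarrow> real" where
  "wavelet \<psi> = (\<lambda>(j, k) x. 2 powr (of_int j / 2) * \<psi> (2 powr of_int j * x - of_int k))"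

definition square_integrable :: "(real \<Rightarrow> real) \<Rightarrow> bool" where
  "square_integrable f \<longleftrightarrow> f \<in> borel_measurable borel \<and> integrable lborel (\<lambda>x. (f x)\<^sup>2)"

text \<open>Orthonormal bases of real \<open>L\<^sup>2\<close>: orthonormal families whose finite linear combinations
  are dense.\<close>

definition orthonormal_basis_L2 :: "('i \<Rightarrow> real \<Rightarrow> real) \<Rightarrow> bool" where
  "orthonormal_basis_L2 e \<longleftrightarrow>
     (\<forall>i. square_integrable (e i)) \<and>
     (\<forall>i i'. (LINT x|lborel. e i x * e i' x) = (if i = i' then 1 else 0)) \<and>
     (\<forall>f. square_integrable f \<longrightarrow>
        (\<forall>\<delta>>0. \<exists>F c. finite F \<and> (LINT x|lborel. (f x - (\<Sum>i\<in>F. c i * e i x))\<^sup>2) < \<delta>))"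

text \<open>The Lemarie--Meyer construction depends on the choice of a smooth cut-off function. The
  predicate retains the properties of the resulting wavelets and not the choice.\<close>

definition lemarie_meyer :: "(real \<Rightarrow> real) \<Rightarrow> bool" where
  "lemarie_meyer \<psi> \<longleftrightarrow>
     orthonormal_basis_L2 (wavelet \<psi>) \<and>
     schwartz \<psi> \<and>
     compact (closure {\<xi>. fourier \<psi> \<xi> \<noteq> 0}) \<and>
     (\<forall>\<^sub>F \<xi> in nhds 0. fourier \<psi> \<xi> = 0)"

text \<open>The integral is real because \<open>\<psi>\<close> is real-valued, so taking \<open>Re\<close> only changes the type.\<close>

definition Psi :: "(real \<Rightarrow> real) \<Rightarrow> real \<Rightarrow> real \<Rightarrow> real" where
  "Psi \<psi> t \<theta> =
     Re (LINT \<xi>|lborel. cis (t * \<xi>) * fourier \<psi> \<xi> / complex_of_real (\<bar>\<xi>\<bar> powr (\<theta> + 1 / 2)))"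

text \<open>For i.i.d. standard Gaussian \<open>\<epsilon>\<close> and \<open>0 < \<theta> < 1\<close> both sums converge absolutely, almost surely
  locally uniformly in \<open>(t, \<theta>)\<close>; the value \<open>0\<close> that \<open>infsum\<close> assigns to divergent sums is only
  taken on a null set.\<close>

definition mbm_generator ::
  "(real \<Rightarrow> real) \<Rightarrow> (int \<Rightarrow> int \<Rightarrow> 'w \<Rightarrow> real) \<Rightarrow> 'w \<Rightarrow> real \<Rightarrow> real \<Rightarrow> real" where
  "mbm_generator \<psi> \<epsilon> \<omega> t \<theta> =
     (\<Sum>\<^sub>\<infinity>j. \<Sum>\<^sub>\<infinity>k. 2 powr (- (of_int j * \<theta>)) * \<epsilon> j k \<omega> *
        (Psi \<psi> (2 powr of_int j * t - of_int k) \<theta> - Psi \<psi> (- of_int k) \<theta>))"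

definition mbm ::
  "(real \<Rightarrow> real) \<Rightarrow> (int \<Rightarrow> int \<Rightarrow> 'w \<Rightarrow> real) \<Rightarrow> (real \<Rightarrow> real) \<Rightarrow> 'w \<Rightarrow> real \<Rightarrow> real" where
  "mbm \<psi> \<epsilon> H \<omega> t = mbm_generator \<psi> \<epsilon> \<omega> t (H t)"

definition iid_std_normal :: "'w measure \<Rightarrow> (int \<Rightarrow> int \<Rightarrow> 'w \<Rightarrow> real) \<Rightarrow> bool" where
  "iid_std_normal M \<epsilon> \<longleftrightarrow>
     prob_space.indep_vars M (\<lambda>_. borel) (\<lambda>(j, k). \<epsilon> j k) UNIV \<and>
     (\<forall>j k. distributed M lborel (\<epsilon> j k) std_normal_density)"

end

theory Submission
  imports Defs "HOL-Real_Asymp.Real_Asymp"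
begin

text \<open>Write \<open>\<theta> = H t\<close>. By Plancherel, \<open>Psi \<psi> _ \<theta>\<close> is biorthogonal to the function obtained from the same Fourier
  integral with the weight \<open>\<bar>\<xi>\<bar> powr (\<theta> + 1 / 2)\<close>. Both functions decay rapidly, so upper bounds for the
  oscillation at \<open>t\<close> follow from bounds on the coefficients \<open>\<epsilon> j k\<close> near \<open>t\<close>, and lower bounds follow by
  pairing: a small oscillation forces \<open>\<epsilon> j \<lfloor>2 ^ j * t\<rfloor>\<close> to be small for all large \<open>j\<close>. These conditions on
  the coefficients do not involve \<open>\<theta>\<close>, hence one null set serves all exponents, and the
  Hoelder condition on \<open>H\<close> makes \<open>B s (H s) - B s (H t)\<close> negligible, since \<open>B\<close> is Lipschitz in \<open>\<theta>\<close>.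

  It remains to study i.i.d. Gaussian arrays. Almost surely the coefficients \<open>\<epsilon> j \<lfloor>2 ^ j * t\<rfloor>\<close> do not tend to
  \<open>0\<close> for any \<open>t\<close>, by a union bound over dyadic paths. Coefficients of size \<open>sqrt j\<close> occur in every dyadic
  interval, and Baire's theorem yields points that meet infinitely many of them. For fixed \<open>t\<close> the
  coefficients along \<open>t\<close> have exact size \<open>sqrt (ln j)\<close>, and Fubini's theorem passes to almost all \<open>t\<close>.
  Slow points are the ends of an octal tree from which the intervals near large
  coefficients have been removed; it survives with probability close to \<open>1\<close>.\<close>

text \<open>The obstacle is that \<open>H t\<close> is taken at random points: rapid and slow points
  depend on the sample, so estimates at a fixed time and exponent do not suffice. Hence everything
  between coefficients and oscillations is deterministic: \<open>growth\<close> and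
  \<open>local_bound\<close> are properties of one array of numbers. Power weights of either sign
  are harmless because \<open>fourier \<psi>\<close> vanishes near 0 and outside a bounded set; so
  \<open>Psi\<close> and its dual decay alike, uniformly over bounded ranges of exponents. Cubic
  decay is enough: one power pays for the growth of coefficients or increments, and two remain for
  summation. The tree is built with one exponent p = a/2, which lies below all values of
  \<open>H\<close>, so the same slow points serve whatever the exponent there. The threshold 1/4
  makes a coefficient small with probability at most 1/4, less than the 1/2 at which two dyadic
  children per step would compensate. Multiplied by sqrt j or sqrt (ln j), it leaves tails of order
  exp (-j/16) or j^(-1/16), which the number of available coefficients outweighs.\<close>

subsection \<open>Fourier integrals\<close>

text \<open>Positive sign and no normalising factor: \<open>fourier \<psi> \<xi>\<close> is the
  \<open>ft\<close> of \<psi> at -\<xi> divided by sqrt (2 pi), and inversion produces the factor 2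
  pi.\<close>

definition ft :: "(real \<Rightarrow> complex) \<Rightarrow> real \<Rightarrow> complex" where
  "ft g x = (LINT \<xi>|lborel. cis (x * \<xi>) * g \<xi>)"

lemma cis_measurable [measurable]: "cis \<in> borel_measurable borel"
  by (intro borel_measurable_continuous_onI continuous_intros)

lemma integrable_cis_mult:
  fixes g :: "real \<Rightarrow> complex"
  assumes "integrable lborel g"
  shows "integrable lborel (\<lambda>\<xi>. cis (x * \<xi> + c) * g \<xi>)"
proof -
  have [measurable]: "g \<in> borel_measurable borel" using assms by auto
  show ?thesis
    by (rule Bochner_Integration.integrable_bound[OF assms]) (auto simp: norm_mult)
qed

lemma integrable_cis_mult0:
  fixes g :: "real \<Rightarrow> complex"
  assumes "integrable lborel g"
  shows "integrable lborel (\<lambda>\<xi>. cis (x * \<xi>) * g \<xi>)"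
  using integrable_cis_mult[OF assms, of x 0] by simp

lemma norm_ft_le: "norm (ft g x) \<le> (LINT \<xi>|lborel. norm (g \<xi>))"
  unfolding ft_def by (rule order_trans[OF integral_norm_bound]) (simp add: norm_mult)

text \<open>Turns a second-order Taylor estimate into a derivative, so that differentiation under
  the integral reduces to integrating a pointwise remainder.\<close>

lemma has_vector_derivative_quadratic:
  fixes f :: "real \<Rightarrow> 'a::real_normed_vector"
  assumes "\<And>h. norm (f (x + h) - f x - h *\<^sub>R D) \<le> C * h\<^sup>2"
  shows "(f has_vector_derivative D) (at x)"
  unfolding has_vector_derivative_def has_derivative_at
proof (intro conjI bounded_linear_scaleR_left)
  have lim: "(\<lambda>h. \<bar>C\<bar> * \<bar>h\<bar>) \<midarrow>0\<rightarrow> (0::real)"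
    by (auto intro!: tendsto_eq_intros)
  show "(\<lambda>h. norm (f (x + h) - f x - h *\<^sub>R D) / norm h) \<midarrow>0\<rightarrow> 0"
  proof (rule Lim_null_comparison[OF _ lim], intro always_eventually allI)
    fix h :: real
    have "norm (f (x + h) - f x - h *\<^sub>R D) \<le> \<bar>C\<bar> * \<bar>h\<bar> * \<bar>h\<bar>"
      using assms[of h] abs_ge_self[of "C * h\<^sup>2"] by (simp add: power2_eq_square abs_mult mult.assoc)
    then show "norm (norm (f (x + h) - f x - h *\<^sub>R D) / norm h) \<le> \<bar>C\<bar> * \<bar>h\<bar>"
      by (cases "h = 0") (auto simp: divide_le_eq)
  qed
qed

lemma cis_quadratic: "norm (cis u - 1 - \<i> * u) \<le> u\<^sup>2 / 2"
  using iexp_approx1[of u 1] by (simp add: cis_conv_exp fact_numeral algebra_simps power2_eq_square)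

lemma integrable_id_mult:
  fixes g :: "real \<Rightarrow> complex"
  assumes g: "integrable lborel g" and g2: "integrable lborel (\<lambda>\<xi>. of_real (\<xi>\<^sup>2) * g \<xi>)"
  shows "integrable lborel (\<lambda>\<xi>. of_real \<xi> * g \<xi>)"
proof -
  have [measurable]: "g \<in> borel_measurable borel" using g by auto
  have i: "integrable lborel (\<lambda>\<xi>. norm (g \<xi>) + norm (of_real (\<xi>\<^sup>2) * g \<xi>))"
    using g g2 by auto
  show ?thesis
  proof (rule Bochner_Integration.integrable_bound[OF i])
    show "AE x in lborel. norm (complex_of_real x * g x)
      \<le> norm (norm (g x) + norm (complex_of_real (x\<^sup>2) * g x))"
    proof (intro AE_I2)
      fix x :: real
      have "\<bar>x\<bar> \<le> 1 + x\<^sup>2" using zero_le_power2[of "\<bar>x\<bar> - 1"]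
        by (simp add: power2_diff)
      then have "\<bar>x\<bar> * norm (g x) \<le> (1 + x\<^sup>2) * norm (g x)" by (rule mult_right_mono) simp
      then show "norm (complex_of_real x * g x) \<le> norm (norm (g x) + norm (complex_of_real (x\<^sup>2) * g x))"
        by (simp add: norm_mult norm_power algebra_simps)
    qed
  qed auto
qed

text \<open>After \<open>cis (x * \<xi>)\<close> is factored out, the remainder of the integrand is
  the Taylor remainder of \<open>cis (h * \<xi>)\<close>, at most h^2 \<xi>^2 |g| / 2; the second
  moment of g makes it integrable.\<close>

lemma ft_has_vector_derivative:
  fixes g :: "real \<Rightarrow> complex"
  assumes g: "integrable lborel g" and g2: "integrable lborel (\<lambda>\<xi>. of_real (\<xi>\<^sup>2) * g \<xi>)"
  shows "(ft g has_vector_derivative ft (\<lambda>\<xi>. \<i> * of_real \<xi> * g \<xi>) x) (at x)"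
proof (rule has_vector_derivative_quadratic)
  fix h :: real
  have [measurable]: "g \<in> borel_measurable borel" using g by auto
  have g1: "integrable lborel (\<lambda>\<xi>. \<i> * of_real \<xi> * g \<xi>)"
    using integrable_id_mult[OF g g2] by (simp add: mult.assoc)
  have i1: "integrable lborel (\<lambda>\<xi>. cis (y * \<xi>) * g \<xi>)" for y
    using integrable_cis_mult0[OF g] .
  have i2: "integrable lborel (\<lambda>\<xi>. h *\<^sub>R (cis (x * \<xi>) * (\<i> * of_real \<xi> * g \<xi>)))"
    using integrable_cis_mult0[OF g1] by (intro integrable_scaleR_right)
  have eq: "ft g (x + h) - ft g x - h *\<^sub>R ft (\<lambda>\<xi>. \<i> * of_real \<xi> * g \<xi>) x =
     (LINT \<xi>|lborel. cis ((x + h) * \<xi>) * g \<xi> - cis (x * \<xi>) * g \<xi>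
        - h *\<^sub>R (cis (x * \<xi>) * (\<i> * of_real \<xi> * g \<xi>)))"
    unfolding ft_def
    by (subst Bochner_Integration.integral_diff
          [OF Bochner_Integration.integrable_diff[OF i1 i1] i2],
        subst Bochner_Integration.integral_diff[OF i1 i1], subst integral_scaleR_right) simp
  have ptw: "norm (cis ((x + h) * \<xi>) * g \<xi> - cis (x * \<xi>) * g \<xi>
        - h *\<^sub>R (cis (x * \<xi>) * (\<i> * of_real \<xi> * g \<xi>))) \<le> h\<^sup>2 / 2 * norm (of_real (\<xi>\<^sup>2) * g \<xi>)" for \<xi>
  proof -
    have "cis ((x + h) * \<xi>) * g \<xi> - cis (x * \<xi>) * g \<xi> - h *\<^sub>R (cis (x * \<xi>) * (\<i> * of_real \<xi> * g \<xi>))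
      = cis (x * \<xi>) * (cis (h * \<xi>) - 1 - \<i> * of_real (h * \<xi>)) * g \<xi>"
      by (simp add: ring_distribs cis_mult[symmetric] scaleR_conv_of_real mult_ac)
    then have "norm (cis ((x + h) * \<xi>) * g \<xi> - cis (x * \<xi>) * g \<xi>
      - h *\<^sub>R (cis (x * \<xi>) * (\<i> * of_real \<xi> * g \<xi>)))
      = norm (cis (h * \<xi>) - 1 - \<i> * of_real (h * \<xi>)) * norm (g \<xi>)" by (simp add: norm_mult)
    also have "\<dots> \<le> (h * \<xi>)\<^sup>2 / 2 * norm (g \<xi>)"
      by (intro mult_right_mono cis_quadratic) auto
    finally show ?thesis by (simp add: norm_mult norm_power power_mult_distrib)
  qed
  show "norm (ft g (x + h) - ft g x - h *\<^sub>R ft (\<lambda>\<xi>. \<i> * of_real \<xi> * g \<xi>) x)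
     \<le> (LINT \<xi>|lborel. norm (of_real (\<xi>\<^sup>2) * g \<xi>)) / 2 * h\<^sup>2"
  proof -
    have "norm (ft g (x + h) - ft g x - h *\<^sub>R ft (\<lambda>\<xi>. \<i> * of_real \<xi> * g \<xi>) x)
      \<le> (LINT \<xi>|lborel. h\<^sup>2 / 2 * norm (of_real (\<xi>\<^sup>2) * g \<xi>))"
      unfolding eq
      by (rule Bochner_Integration.integral_norm_bound_integral)
         (use ptw g2 i1 i2 in \<open>auto intro!: Bochner_Integration.integrable_diff\<close>)
    then show ?thesis by (simp add: mult.commute)
  qed
qed

text \<open>Substituting \<xi> = s z gives s times the characteristic function of the standard
  normal law at s u.\<close>

lemma ft_gaussian:
  assumes "s > 0"
  shows "(LINT \<xi>|lborel. cis (u * \<xi>) * of_real (std_normal_density (\<xi> / s)))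
    = of_real (s * exp (- (s * u)\<^sup>2 / 2))"
proof -
  have "(LINT \<xi>|lborel. cis (u * \<xi>) * of_real (std_normal_density (\<xi> / s)))
     = \<bar>s\<bar> *\<^sub>R (LINT z|lborel. cis (u * (0 + s * z)) * of_real (std_normal_density ((0 + s * z) / s)))"
    by (rule lborel_integral_real_affine) (use assms in auto)
  also have "(LINT z|lborel. cis (u * (0 + s * z)) * of_real (std_normal_density ((0 + s * z) / s)))
     = char std_normal_distribution (s * u)"
    unfolding char_def using assms
    by (subst integral_density)
       (auto simp: cis_conv_exp scaleR_conv_of_real mult_ac normal_density_nonneg)
  finally show ?thesis
    using assms by (simp add: char_std_normal_distribution scaleR_conv_of_real)
qed

text \<open>Regularise by a Gaussian of width \<open>1/s\<close> and let \<open>s\<close> tend to infinity.\<close>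

lemma fourier_inversion:
  fixes f :: "real \<Rightarrow> complex"
  assumes f: "integrable lborel f" and cont: "continuous_on UNIV f"
    and bd: "\<And>x. norm (f x) \<le> B"
    and hat: "integrable lborel (ft f)"
  shows "ft (\<lambda>\<eta>. ft f (- \<eta>)) x = 2 * pi * f x"
proof -
  have mf [measurable]: "f \<in> borel_measurable borel" using f by auto
  have mh [measurable]: "ft f \<in> borel_measurable borel" using hat by auto
  let ?I = "\<lambda>n. LINT \<eta>|lborel. cis (x * \<eta>) * ft f (- \<eta>)
    * of_real (sqrt (2 * pi) * std_normal_density (\<eta> / real (Suc n)))"
  have hat': "integrable lborel (\<lambda>\<eta>. ft f (- \<eta>))"
    using lborel_integrable_real_affine[OF hat, of "-1" 0] by simp
  have e: "sqrt (2 * pi) * std_normal_density y = exp (- y\<^sup>2 / 2)" for y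
    by (simp add: std_normal_density_def)
  \<comment> \<open>\<open>sqrt (2 * pi) * std_normal_density\<close> is 1 at 0 and at most 1
    everywhere, so the factor tends to 1 as the Gaussian flattens, and \<open>ft f\<close> itself
    dominates.\<close>
  have lim1: "?I \<longlonglongrightarrow> (LINT \<eta>|lborel. cis (x * \<eta>) * ft f (- \<eta>))"
  proof (rule integral_dominated_convergence[where w = "\<lambda>\<eta>. norm (ft f (- \<eta>))"])
    show "AE y in lborel. (\<lambda>n. cis (x * y) * ft f (- y)
      * complex_of_real (sqrt (2 * pi) * std_normal_density (y / real (Suc n)))) \<longlonglongrightarrow> cis (x * y) * ft f (- y)"
    proof (intro AE_I2)
      fix y :: real
      have "(\<lambda>n. y / real (Suc n)) \<longlonglongrightarrow> 0"
        by (intro tendsto_divide_0[OF tendsto_const] filterlim_at_top_imp_at_infinity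
            filterlim_compose[OF filterlim_real_sequentially filterlim_Suc])
      then have "(\<lambda>n. complex_of_real (exp (- (y / real (Suc n))\<^sup>2 / 2))) \<longlonglongrightarrow> of_real (exp (- 0\<^sup>2 / 2))"
        by (intro tendsto_intros) auto
      then have "(\<lambda>n. complex_of_real (exp (- (y / real (Suc n))\<^sup>2 / 2))) \<longlonglongrightarrow> 1" by simp
      from tendsto_mult[OF tendsto_const[of "cis (x * y) * ft f (- y)"] this]
      show "(\<lambda>n. cis (x * y) * ft f (- y) * complex_of_real (sqrt (2 * pi)
        * std_normal_density (y / real (Suc n)))) \<longlonglongrightarrow> cis (x * y) * ft f (- y)"
        unfolding e by simp
    qed
    show "AE y in lborel. norm (cis (x * y) * ft f (- y)
      * complex_of_real (sqrt (2 * pi) * std_normal_density (y / real (Suc n)))) \<le> norm (ft f (- y))" for n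
      unfolding e by (auto simp: norm_mult mult_left_le)
  qed (use hat' in \<open>auto simp: integrable_cis_mult0\<close>)
  \<comment> \<open>Expanding \<open>ft f\<close> and exchanging the integrals turns the
    \<eta>-integral into a Gaussian in y concentrated at x.\<close>
  have swap: "?I n
    = (LINT y|lborel. f y * (of_real (sqrt (2 * pi) *
      (real (Suc n) * exp (- (real (Suc n) * (x - y))\<^sup>2 / 2)))))" for n
  proof -
    let ?s = "real (Suc n)"
    let ?k = "\<lambda>y \<eta>. cis (x * \<eta>) * (cis (- \<eta> * y) * f y)
      * of_real (sqrt (2 * pi) * std_normal_density (\<eta> / ?s))"
    have intd: "integrable lborel (\<lambda>\<eta>. std_normal_density (\<eta> / ?s))"
      using lborel_integrable_real_affine[OF integrable_normal_density[of 1 0, OF zero_less_one], of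
        "1 / ?s" 0] by simp
    have ip: "integrable (lborel \<Otimes>\<^sub>M lborel) (case_prod ?k)"
    proof (rule lborel_pair.Fubini_integrable)
      have "(\<lambda>y. LINT \<eta>|lborel. norm (?k y \<eta>))
        = (\<lambda>y. norm (f y) * (LINT \<eta>|lborel. sqrt (2 * pi) * std_normal_density (\<eta> / ?s)))"
        by (auto simp: norm_mult abs_mult normal_density_nonneg simp flip: integral_mult_right_zero intro!:
          ext)
      then show "integrable lborel (\<lambda>xa. LINT y|lborel. norm (case (xa, y) of (y, \<eta>) \<Rightarrow> ?k y \<eta>))"
        using f by simp
      show "AE xa in lborel. integrable lborel (\<lambda>y. case (xa, y) of (y, \<eta>) \<Rightarrow> ?k y \<eta>)"
      proof (intro AE_I2)
        fix y :: real
        have "integrable lborel (\<lambda>\<eta>. norm (f y) * (sqrt (2 * pi) * std_normal_density (\<eta> / ?s)))"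
          using intd by simp
        then show "integrable lborel (\<lambda>ya. case (y, ya) of (y, \<eta>) \<Rightarrow> ?k y \<eta>)"
          by (rule Bochner_Integration.integrable_bound)
             (auto simp: norm_mult abs_mult normal_density_nonneg)
      qed
    qed measurable
    have "?I n = (LINT \<eta>|lborel. (LINT y|lborel. ?k y \<eta>))"
      by (simp add: ft_def flip: integral_mult_left_zero integral_mult_right_zero)
    also have "\<dots> = (LINT y|lborel. (LINT \<eta>|lborel. ?k y \<eta>))"
      using lborel_pair.Fubini_integral[OF ip] .
    also have "\<dots> = (LINT y|lborel. f y * of_real (sqrt (2 * pi))
      * (LINT \<eta>|lborel. cis ((x - y) * \<eta>) * of_real (std_normal_density (\<eta> / ?s))))"
      by (auto simp: cis_mult left_diff_distrib right_diff_distrib mult_ac simp flip: integral_mult_right_zero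
               intro!: Bochner_Integration.integral_cong)
    also have "\<dots> = (LINT y|lborel. f y * (of_real (sqrt (2 * pi) * (?s * exp (- (?s * (x - y))\<^sup>2 / 2)))))"
    proof -
      have "(LINT \<eta>|lborel. cis ((x - y) * \<eta>) * of_real (std_normal_density (\<eta> / ?s)))
         = complex_of_real (?s * exp (- (?s * (x - y))\<^sup>2 / 2))" for y
        by (rule ft_gaussian) simp
      then show ?thesis by (simp only: of_real_mult mult.assoc)
    qed
    finally show ?thesis .
  qed
  \<comment> \<open>The substitution y = x + z / s removes s from the kernel and leaves a fixed
    density against values of f near x.\<close>
  have swap2: "?I n = (LINT z|lborel. f (x + (1 / real (Suc n)) * z)
    * of_real (2 * pi * std_normal_density z))" for n
  proof -
    let ?s = "real (Suc n)"
    have "?I n = \<bar>1 / ?s\<bar> *\<^sub>R (LINT z|lborel. f (x + (1 / ?s) * z)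
      * (of_real (sqrt (2 * pi) * (?s * exp (- (?s * (x - (x + (1 / ?s) * z)))\<^sup>2 / 2)))))"
      unfolding swap by (rule lborel_integral_real_affine) simp
    also have "\<dots>
      = (LINT z|lborel. \<bar>1 / ?s\<bar> *\<^sub>R
        (f (x + (1 / ?s) * z) * (of_real
          (sqrt (2 * pi) * (?s * exp (- (?s * (x - (x + (1 / ?s) * z)))\<^sup>2 / 2))))))"
      by (rule integral_scaleR_right[symmetric])
    also have "\<dots> = (LINT z|lborel. f (x + (1 / real (Suc n)) * z) * of_real (2 * pi * std_normal_density z))"
    proof (rule Bochner_Integration.integral_cong[OF refl])
      fix z :: real
      have "\<bar>1 / ?s\<bar> * (sqrt (2 * pi) * (?s * exp (- (?s * (x - (x + (1 / ?s) * z)))\<^sup>2 / 2)))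
        = sqrt (2 * pi) * exp (- z\<^sup>2 / 2)"
        by simp
      also have "\<dots> = 2 * pi * std_normal_density z"
        unfolding e[symmetric] by (simp flip: mult.assoc)
      finally have *: "\<bar>1 / ?s\<bar> * (sqrt (2 * pi) * (?s * exp (- (?s * (x - (x + (1 / ?s) * z)))\<^sup>2 / 2)))
        = 2 * pi * std_normal_density z" .
      have "c *\<^sub>R (w * of_real t) = w * of_real (c * t)" for c t :: real and w :: complex
        by (simp add: scaleR_conv_of_real)
      from this[of "\<bar>1 / ?s\<bar>"] show "\<bar>1 / ?s\<bar> *\<^sub>R (f (x + (1 / ?s) * z)
        * (of_real (sqrt (2 * pi) * (?s * exp (- (?s * (x - (x + (1 / ?s) * z)))\<^sup>2 / 2))))) = f
          (x + (1 / real (Suc n)) * z) * of_real (2 * pi * std_normal_density z)"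
        unfolding *[symmetric] .
    qed
    finally show ?thesis .
  qed
  \<comment> \<open>Continuity of f at x gives the pointwise limit, boundedness of f the dominating
    function.\<close>
  have lim2: "?I \<longlonglongrightarrow> (LINT z|lborel. f x * of_real (2 * pi * std_normal_density z))"
    unfolding swap2
  proof (rule integral_dominated_convergence[where w = "\<lambda>z. B * (2 * pi * std_normal_density z)"])
    show "AE z in lborel. (\<lambda>n. f (x + (1 / real (Suc n)) * z)
      * of_real (2 * pi * std_normal_density z)) \<longlonglongrightarrow> f x * of_real (2 * pi * std_normal_density z)"
    proof (intro AE_I2 tendsto_mult tendsto_const)
      fix z :: real
      have "(\<lambda>n. 1 / real (Suc n)) \<longlonglongrightarrow> 0"
        using LIMSEQ_inverse_real_of_nat by (simp add: inverse_eq_divide)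
      then have "(\<lambda>n. x + (1 / real (Suc n)) * z) \<longlonglongrightarrow> x + 0 * z"
        by (intro tendsto_intros)
      then show "(\<lambda>n. f (x + (1 / real (Suc n)) * z)) \<longlonglongrightarrow> f x"
        using continuous_on_tendsto_compose[OF cont, of _ x sequentially] by simp
    qed
    show "AE z in lborel. norm (f (x + (1 / real (Suc n)) * z) * of_real (2 * pi * std_normal_density z))
      \<le> B * (2 * pi * std_normal_density z)" for n
      by (auto simp: norm_mult abs_mult normal_density_nonneg intro!: mult_right_mono bd)
  qed (auto)
  have "(LINT z|lborel. f x * of_real (2 * pi * std_normal_density z)) = f x * of_real (2 * pi)"
    by (simp flip: of_real_mult)
  then show ?thesis
    using LIMSEQ_unique[OF lim1 lim2] by (simp add: ft_def)
qed

lemma integrable_compact_support: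
  fixes g :: "real \<Rightarrow> 'a::euclidean_space"
  assumes "continuous_on UNIV g" "\<And>\<xi>. \<bar>\<xi>\<bar> > R \<Longrightarrow> g \<xi> = 0"
  shows "integrable lborel g"
proof -
  have "integrable lborel (\<lambda>x. indicator {-R..R} x *\<^sub>R g x)"
    using borel_integrable_compact[OF compact_Icc continuous_on_subset[OF assms(1) subset_UNIV]] by simp
  moreover have "(\<lambda>x. indicator {-R..R} x *\<^sub>R g x) = g"
  proof
    fix x show "indicator {-R..R} x *\<^sub>R g x = g x"
      using assms(2)[of x] by (cases "\<bar>x\<bar> > R") (auto simp: indicator_def abs_le_iff)
  qed
  ultimately show ?thesis by simp
qed

lemma integral_deriv_compact_support:
  fixes u :: "real \<Rightarrow> complex"
  assumes u: "\<And>\<xi>. (u has_vector_derivative u' \<xi>) (at \<xi>)" and cont: "continuous_on UNIV u'"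
    and z: "\<And>\<xi>. \<bar>\<xi>\<bar> > R \<Longrightarrow> u \<xi> = 0" "\<And>\<xi>. \<bar>\<xi>\<bar> > R \<Longrightarrow> u' \<xi> = 0"
  shows "(LINT \<xi>|lborel. u' \<xi>) = 0"
proof -
  \<comment> \<open>Widening by 1 places both endpoints where u vanishes, also when R is
    negative.\<close>
  let ?A = "{-(\<bar>R\<bar>+1)..\<bar>R\<bar>+1}"
  have "(LINT x|lborel. indicator ?A x *\<^sub>R u' x) = u (\<bar>R\<bar>+1) - u (-(\<bar>R\<bar>+1))"
    by (rule integral_FTC_atLeastAtMost)
       (auto intro: has_vector_derivative_at_within u continuous_on_subset[OF cont])
  also have "\<dots> = 0" using z(1)[of "\<bar>R\<bar>+1"] z(1)[of "-(\<bar>R\<bar>+1)"] by simp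
  also have "(\<lambda>x. indicator ?A x *\<^sub>R u' x) = u'"
  proof
    fix x show "indicator ?A x *\<^sub>R u' x = u' x"
      using z(2)[of x] by (cases "\<bar>x\<bar> > R") (auto simp: indicator_def abs_le_iff)
  qed
  finally show ?thesis .
qed

lemma cis_has_vector_derivative:
  "((\<lambda>\<xi>. cis (x * \<xi>)) has_vector_derivative (\<i> * of_real x * cis (x * \<xi>))) (at \<xi>)"
proof -
  have "((\<lambda>z. exp (\<i> * of_real x * z)) has_field_derivative (\<i> * of_real x
    * exp (\<i> * of_real x * of_real \<xi>))) (at (of_real \<xi>))"
    by (auto intro!: derivative_eq_intros)
  from has_vector_derivative_real_field[OF this] show ?thesis
    by (simp add: cis_conv_exp mult.assoc)
qed

subsection \<open>Decay of weighted Fourier integrals\<close>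

text \<open>\<open>F i\<close> is the i-th derivative of \<open>F 0\<close>, to be instantiated by
  the Fourier transform of the wavelet. Carrying the whole sequence lets integration by parts shift
  indices instead of forming derivatives.\<close>

locale annulus_function =
  fixes F :: "nat \<Rightarrow> real \<Rightarrow> complex" and r R :: real
  assumes r_pos: "0 < r"
    and F_deriv: "\<And>i \<xi>. (F i has_vector_derivative F (Suc i) \<xi>) (at \<xi>)"
    and F_zero: "\<And>i \<xi>. \<bar>\<xi>\<bar> < r \<or> R < \<bar>\<xi>\<bar> \<Longrightarrow> F i \<xi> = 0"
    and F_bounded: "\<And>i. bounded (range (F i))"
begin

text \<open>\<open>w n\<close> is the n-th derivative of the weight \<open>w 0\<close>.
  Differentiability is asked only away from 0 and size only on the annulus, because powers of
  |\<xi>| are singular at 0, where \<open>F\<close> vanishes.\<close>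

definition weight :: "nat \<Rightarrow> real \<Rightarrow> (nat \<Rightarrow> real \<Rightarrow> real) \<Rightarrow> bool" where
  "weight N K w \<longleftrightarrow> (\<forall>n \<xi>. \<xi> \<noteq> 0 \<longrightarrow> (w n has_real_derivative w (Suc n) \<xi>) (at \<xi>)) \<and>
     (\<forall>n\<le>N. \<forall>\<xi>. r \<le> \<bar>\<xi>\<bar> \<and> \<bar>\<xi>\<bar> \<le> R \<longrightarrow> \<bar>w n \<xi>\<bar> \<le> K)"

text \<open>In the hole of the annulus the product is identically 0, whatever the singularity of the
  weight; elsewhere the product rule applies.\<close>

lemma F_mult_weight_deriv:
  assumes "weight N K w"
  shows "((\<lambda>\<xi>. F i \<xi> * of_real (w m \<xi>)) has_vector_derivative
     F (Suc i) \<xi> * of_real (w m \<xi>) + F i \<xi> * of_real (w (Suc m) \<xi>)) (at \<xi>)"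
proof (cases "\<bar>\<xi>\<bar> < r")
  case True
  then have "F i \<xi> = 0" "F (Suc i) \<xi> = 0" using F_zero by auto
  moreover have "((\<lambda>\<xi>. F i \<xi> * of_real (w m \<xi>)) has_vector_derivative 0) (at \<xi>)"
  proof (rule has_vector_derivative_transform_within_open[where S = "{-r<..<r}"])
    show "((\<lambda>_. 0) has_vector_derivative 0) (at \<xi>)" by simp
    show "open {-r<..<r}" "\<xi> \<in> {-r<..<r}" using True by auto
    show "\<And>x. x \<in> {- r<..<r} \<Longrightarrow> 0 = F i x * complex_of_real (w m x)" using F_zero by (auto simp: abs_less_iff)
  qed
  ultimately show ?thesis by simp
next
  case False
  then have "\<xi> \<noteq> 0" using r_pos by auto
  then have "(w m has_real_derivative w (Suc m) \<xi>) (at \<xi>)" using assms by (auto simp: weight_def)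
  then have "((\<lambda>\<xi>. of_real (w m \<xi>) :: complex) has_vector_derivative of_real (w (Suc m) \<xi>)) (at \<xi>)"
    by (intro has_vector_derivative_of_real) (simp add: has_real_derivative_iff_has_vector_derivative)
  from has_vector_derivative_mult[OF F_deriv this, of i] show ?thesis by (simp add: add.commute)
qed

lemma F_mult_weight_zero: "\<bar>\<xi>\<bar> > R \<Longrightarrow> F i \<xi> * of_real (w m \<xi>) = 0"
  using F_zero by auto

lemma F_mult_weight_cont:
  assumes "weight N K w"
  shows "continuous_on UNIV (\<lambda>\<xi>. F i \<xi> * of_real (w m \<xi>))"
  using F_mult_weight_deriv[OF assms]
  by (auto intro!: continuous_at_imp_continuous_on has_vector_derivative_continuous)

lemma F_mult_weight_integrable:
  assumes "weight N K w"
  shows "integrable lborel (\<lambda>\<xi>. F i \<xi> * of_real (w m \<xi>))"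
  by (rule integrable_compact_support[OF F_mult_weight_cont[OF assms], where R = R]) (rule F_mult_weight_zero)

text \<open>Multiplication by x is a derivative on the Fourier side; compact support removes the
  boundary terms.\<close>

lemma ft_by_parts:
  assumes w: "weight N K w"
  shows "of_real x * ft (\<lambda>\<xi>. F i \<xi> * of_real (w m \<xi>)) x =
    \<i> * (ft (\<lambda>\<xi>. F (Suc i) \<xi> * of_real (w m \<xi>)) x + ft (\<lambda>\<xi>. F i \<xi> * of_real (w (Suc m) \<xi>)) x)"
proof -
  let ?g = "\<lambda>\<xi>. F i \<xi> * of_real (w m \<xi>)"
  let ?g1 = "\<lambda>\<xi>. F (Suc i) \<xi> * of_real (w m \<xi>)" and ?g2 = "\<lambda>\<xi>. F i \<xi> * of_real (w (Suc m) \<xi>)"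
  let ?u' = "\<lambda>\<xi>. cis (x * \<xi>) * (?g1 \<xi> + ?g2 \<xi>) + (\<i> * of_real x * cis (x * \<xi>)) * ?g \<xi>"
  have "(LINT \<xi>|lborel. ?u' \<xi>) = 0"
  proof (rule integral_deriv_compact_support[where R = R])
    show "((\<lambda>\<xi>. cis (x * \<xi>) * ?g \<xi>) has_vector_derivative ?u' \<xi>) (at \<xi>)" for \<xi>
      by (rule has_vector_derivative_mult[OF cis_has_vector_derivative F_mult_weight_deriv[OF w]])
    show "continuous_on UNIV ?u'"
      by (intro continuous_intros F_mult_weight_cont[OF w])
  qed (auto simp: F_zero)
  moreover have "(LINT \<xi>|lborel. ?u' \<xi>) = (ft ?g1 x + ft ?g2 x) + \<i> * of_real x * ft ?g x"
  proof -
    have "?u' = (\<lambda>\<xi>. (cis (x * \<xi>) * ?g1 \<xi> + cis (x * \<xi>) * ?g2 \<xi>) + (\<i> * of_real x) * (cis (x * \<xi>) * ?g \<xi>))"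
      by (auto simp: algebra_simps)
    then show ?thesis
      unfolding ft_def
      by (simp add: integrable_cis_mult0[OF F_mult_weight_integrable[OF w]] del: mult.assoc)
  qed
  ultimately have "\<i> * of_real x * ft ?g x = - (ft ?g1 x + ft ?g2 x)"
    by (metis add.commute eq_neg_iff_add_eq_0)
  moreover have "z = \<i> * S" if "\<i> * z = - S" for z S
    using that by (simp add: complex_eq_iff)
  ultimately show ?thesis by (metis mult.assoc)
qed

lemma F_bound: "\<exists>C>0. \<forall>i\<le>N. \<forall>\<xi>. norm (F i \<xi>) \<le> C"
proof (induction N)
  case 0
  show ?case using F_bounded[of 0] by (auto simp: bounded_pos)
next
  case (Suc N)
  then obtain C where "C > 0" "\<forall>i\<le>N. \<forall>\<xi>. norm (F i \<xi>) \<le> C" by auto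
  moreover obtain D where "D > 0" "\<forall>\<xi>. norm (F (Suc N) \<xi>) \<le> D"
    using F_bounded[of "Suc N"] by (auto simp: bounded_pos)
  ultimately show ?case
    by (intro exI[of _ "max C D"]) (auto simp: le_Suc_eq le_max_iff_disj)
qed

text \<open>One integration by parts per power of x. Each splits one integral into two, whence 2^n,
  and raises one of the orders i and m, whence the conditions on i + n and m + n.\<close>

lemma ft_weight_decay_aux:
  assumes w: "weight N K w" and C: "\<forall>i\<le>N. \<forall>\<xi>. norm (F i \<xi>) \<le> C" and "K \<ge> 0" "C \<ge> 0"
  shows "i + n \<le> N \<Longrightarrow> m + n \<le> N \<Longrightarrow>
    \<bar>x\<bar> ^ n * norm (ft (\<lambda>\<xi>. F i \<xi> * of_real (w m \<xi>)) x) \<le> 2 ^ n * (2 * \<bar>R\<bar> * (C * K))"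
proof (induction n arbitrary: i m)
  case 0
  have "norm (ft (\<lambda>\<xi>. F i \<xi> * of_real (w m \<xi>)) x) \<le> (LINT \<xi>|lborel. norm (F i \<xi> * of_real (w m \<xi>)))"
    by (rule norm_ft_le)
  also have "\<dots> \<le> (LINT \<xi>|lborel. indicator {-\<bar>R\<bar>..\<bar>R\<bar>} \<xi> *\<^sub>R (C * K))"
  proof (rule integral_mono)
    show "integrable lborel (\<lambda>\<xi>. norm (F i \<xi> * of_real (w m \<xi>)))"
      using F_mult_weight_integrable[OF w] by auto
    show "integrable lborel (\<lambda>\<xi>. indicator {-\<bar>R\<bar>..\<bar>R\<bar>} \<xi> *\<^sub>R (C * K))"
      by (rule borel_integrable_compact) auto
    fix \<xi>
    show "norm (F i \<xi> * of_real (w m \<xi>)) \<le> indicator {-\<bar>R\<bar>..\<bar>R\<bar>} \<xi> *\<^sub>R (C * K)"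
    proof (cases "r \<le> \<bar>\<xi>\<bar> \<and> \<bar>\<xi>\<bar> \<le> R")
      case True
      then have "norm (F i \<xi>) * \<bar>w m \<xi>\<bar> \<le> C * K"
        using w C 0 \<open>C \<ge> 0\<close> by (intro mult_mono) (auto simp: weight_def)
      moreover have "\<xi> \<in> {-\<bar>R\<bar>..\<bar>R\<bar>}" using True by (auto simp: abs_le_iff)
      ultimately show ?thesis by (simp add: norm_mult)
    next
      case False
      then have "F i \<xi> = 0" using F_zero by (meson not_le)
      then show ?thesis using assms by simp
    qed
  qed
  also have "\<dots> = 2 * \<bar>R\<bar> * (C * K)" by simp
  finally show ?case by simp
next
  case (Suc n)
  have "\<bar>x\<bar> ^ Suc n * norm (ft (\<lambda>\<xi>. F i \<xi> * of_real (w m \<xi>)) x)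
     = \<bar>x\<bar> ^ n * norm (of_real x * ft (\<lambda>\<xi>. F i \<xi> * of_real (w m \<xi>)) x)"
    by (simp add: norm_mult)
  also have "\<dots> \<le> \<bar>x\<bar> ^ n * (norm (ft (\<lambda>\<xi>. F (Suc i) \<xi> * of_real (w m \<xi>)) x)
    + norm (ft (\<lambda>\<xi>. F i \<xi> * of_real (w (Suc m) \<xi>)) x))"
    unfolding ft_by_parts[OF w] by (intro mult_left_mono) (auto simp: norm_mult intro: norm_triangle_ineq)
  also have "\<dots> \<le> 2 ^ n * (2 * \<bar>R\<bar> * (C * K)) + 2 ^ n * (2 * \<bar>R\<bar> * (C * K))"
    unfolding distrib_left by (intro add_mono Suc.IH) (use Suc.prems in auto)
  also have "\<dots> = 2 ^ Suc n * (2 * \<bar>R\<bar> * (C * K))" by simp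
  finally show ?case .
qed

text \<open>The bound is linear in K so that it also applies to differences of weights with a small
  K, which yields Lipschitz dependence on the exponent.\<close>

lemma ft_weight_decay:
  "\<exists>C>0. \<forall>w K x. K \<ge> 0 \<and> weight 3 K w \<longrightarrow> norm (ft (\<lambda>\<xi>. F 0 \<xi> * of_real (w 0 \<xi>)) x) \<le> C * K / (1 + \<bar>x\<bar>) ^ 3"
proof -
  obtain D where D: "D > 0" "\<forall>i\<le>3. \<forall>\<xi>. norm (F i \<xi>) \<le> D" using F_bound by blast
  show ?thesis
  \<comment> \<open>27 = (1 + 2)^3: expand (1 + |x|)^3 and use the bound with factor 2^n for the
    n-th power. The 1 in |R| + 1 keeps the constant positive.\<close>
  proof (intro exI[of _ "27 * (2 * (\<bar>R\<bar> + 1) * D)"] conjI allI impI)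
    show "27 * (2 * (\<bar>R\<bar> + 1) * D) > 0" using D by auto
    fix w K x assume a: "K \<ge> 0 \<and> weight 3 K w"
    let ?t = "norm (ft (\<lambda>\<xi>. F 0 \<xi> * of_real (w 0 \<xi>)) x)"
    let ?B = "2 * (\<bar>R\<bar> + 1) * D * K"
    have b: "\<bar>x\<bar> ^ n * ?t \<le> 2 ^ n * ?B" if "n \<le> 3" for n
    proof -
      have "\<bar>x\<bar> ^ n * ?t \<le> 2 ^ n * (2 * \<bar>R\<bar> * (D * K))"
        using ft_weight_decay_aux[of 3 K w D 0 n 0 x] a D that by simp
      also have "\<dots> \<le> 2 ^ n * (2 * (\<bar>R\<bar> + 1) * (D * K))"
        by (intro mult_left_mono mult_right_mono) (use a D in auto)
      finally show ?thesis by (simp add: mult.assoc)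
    qed
    have "(1 + \<bar>x\<bar>) ^ 3 * ?t = \<bar>x\<bar>^0 * ?t + 3 * (\<bar>x\<bar>^1 * ?t) + 3 * (\<bar>x\<bar>^2 * ?t) + \<bar>x\<bar>^3 * ?t"
      by (simp add: power3_eq_cube power2_eq_square algebra_simps)
    also have "\<dots> \<le> 2^0 * ?B + 3 * (2^1 * ?B) + 3 * (2^2 * ?B) + 2^3 * ?B"
      by (intro add_mono mult_left_mono b) auto
    also have "\<dots> = 27 * (2 * (\<bar>R\<bar> + 1) * D) * K" by simp
    finally show "?t \<le> 27 * (2 * (\<bar>R\<bar> + 1) * D) * K / (1 + \<bar>x\<bar>) ^ 3"
      by (simp add: pos_le_divide_eq mult.commute)
  qed
qed

end

text \<open>The common decay rate of all kernels. The cube leaves an inverse square, summable over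
  the integers, after one power has been spent on growth.\<close>

definition decay :: "real \<Rightarrow> real" where "decay x = 1 / (1 + \<bar>x\<bar>) ^ 3"

lemma decay_pos: "0 < decay x" and decay_nonneg: "0 \<le> decay x"
  by (simp_all add: decay_def add_pos_nonneg)

lemma decay_shift:
  fixes x y :: real
  assumes "\<bar>x - y\<bar> \<le> 1"
  shows "decay y \<le> 8 * decay x"
proof -
  have "1 + \<bar>x\<bar> \<le> 2 * (1 + \<bar>y\<bar>)" using assms by (smt (verit))
  then have "(1 + \<bar>x\<bar>) ^ 3 \<le> (2 * (1 + \<bar>y\<bar>)) ^ 3" by (rule power_mono) auto
  then have "(1 + \<bar>x\<bar>) ^ 3 \<le> 8 * (1 + \<bar>y\<bar>) ^ 3" by (simp only: power_mult_distrib) simp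
  then show ?thesis by (simp add: decay_def field_simps add_pos_nonneg)
qed

text \<open>For |x - y| \<le> 1 the mean value inequality applies on the segment, where
  \<open>decay\<close> varies by a factor at most 8; for larger distances the triangle inequality
  suffices.\<close>

lemma decay_increment:
  fixes f :: "real \<Rightarrow> complex"
  assumes d: "\<And>x. (f has_vector_derivative f' x) (at x)"
    and b: "\<And>x. norm (f x) \<le> A * decay x" "\<And>x. norm (f' x) \<le> A * decay x" and A: "A \<ge> 0"
  shows "norm (f x - f y) \<le> 8 * A * min 1 \<bar>x - y\<bar> * (decay x + decay y)"
proof (cases "\<bar>x - y\<bar> \<le> 1")
  case True
  have "norm (f x - f y) \<le> (A * (8 * decay x)) * norm (x - y)"
  proof (rule differentiable_bound)
    show "convex (closed_segment x y)" by simp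
    fix z assume z: "z \<in> closed_segment x y"
    show "(f has_derivative (\<lambda>h. h *\<^sub>R f' z)) (at z within closed_segment x y)"
      using d[of z] by (auto simp: has_vector_derivative_def intro: has_derivative_at_withinI)
    have "\<bar>x - z\<bar> \<le> 1"
      using z True by (auto simp: closed_segment_eq_real_ivl split: if_splits)
    then have "norm (f' z) \<le> A * (8 * decay x)"
      using b(2)[of z] decay_shift[of x z] A by (meson mult_left_mono order_trans)
    then show "onorm (\<lambda>h. h *\<^sub>R f' z) \<le> A * (8 * decay x)"
      by (intro onorm_le) (simp add: mult.commute mult_left_mono)
  qed auto
  also have "\<dots> = 8 * A * \<bar>x - y\<bar> * decay x" by simp
  also have "\<dots> \<le> 8 * A * min 1 \<bar>x - y\<bar> * (decay x + decay y)"
    using True A decay_nonneg by (intro mult_mono mult_left_mono) auto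
  finally show ?thesis .
next
  case False
  have "norm (f x - f y) \<le> A * decay x + A * decay y"
    using norm_triangle_ineq4[of "f x" "f y"] b(1)[of x] b(1)[of y] by linarith
  also have "\<dots> \<le> 8 * (A * decay x + A * decay y)" using A decay_nonneg by auto
  finally show ?thesis using False by (simp add: algebra_simps)
qed

text \<open>Off 0, the n-th derivative of sgn \<xi>^e |\<xi>|^s, with a falling factorial in front.
  The odd case e = 1 is needed because \<xi> |\<xi>|^s = sgn \<xi> |\<xi>|^(s + 1).\<close>

definition pw :: "real \<Rightarrow> nat \<Rightarrow> nat \<Rightarrow> real \<Rightarrow> real" where
  "pw s e n \<xi> = (\<Prod>i<n. s - real i) * sgn \<xi> ^ (n + e) * \<bar>\<xi>\<bar> powr (s - real n)"

lemma pw_deriv: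
  assumes "\<xi> \<noteq> 0"
  shows "(pw s e n has_real_derivative pw s e (Suc n) \<xi>) (at \<xi>)"
proof (cases "\<xi> > 0")
  case True
  have "((\<lambda>\<xi>. (\<Prod>i<n. s - real i) * \<xi> powr (s - real n)) has_real_derivative pw s e (Suc n) \<xi>) (at \<xi>)"
    using True by (auto intro!: derivative_eq_intros simp: pw_def algebra_simps)
  then show ?thesis
    by (rule has_field_derivative_transform_within_open[where S = "{0<..}"]) (use True in \<open>auto simp: pw_def\<close>)
next
  case False
  then have neg: "\<xi> < 0" using assms by auto
  have "((\<lambda>\<xi>. (\<Prod>i<n. s - real i) * (-1) ^ (n + e)
    * (- \<xi>) powr (s - real n)) has_real_derivative pw s e (Suc n) \<xi>) (at \<xi>)"
    using neg by (auto intro!: derivative_eq_intros simp: pw_def algebra_simps)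
  then show ?thesis
    by (rule has_field_derivative_transform_within_open[where S = "{..<0}"]) (use neg in \<open>auto simp: pw_def\<close>)
qed

section \<open>Bounds for power weights, uniform in the exponent\<close>

lemma abs_exp_diff_le:
  fixes x y :: real
  assumes "x \<le> L" "y \<le> L"
  shows "\<bar>exp x - exp y\<bar> \<le> exp L * \<bar>x - y\<bar>"
proof -
  have *: "exp x - exp y \<le> exp L * \<bar>x - y\<bar>" if "x \<le> L" for x y
  proof (cases "y \<le> x")
    case True
    have "exp x * (1 + (y - x)) \<le> exp x * exp (y - x)" by (intro mult_left_mono exp_ge_add_one_self) auto
    also have "\<dots> = exp y" by (simp flip: exp_add)
    finally have "exp x - exp y \<le> exp x * (x - y)" by (simp add: algebra_simps)
    also have "\<dots> \<le> exp L * (x - y)" using that True by (intro mult_right_mono) auto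
    finally show ?thesis using True by simp
  next
    case False
    then have "exp x - exp y \<le> 0" by simp
    also have "0 \<le> exp L * \<bar>x - y\<bar>" by simp
    finally show ?thesis .
  qed
  show ?thesis using *[of x y] *[of y x] assms by (auto simp: abs_le_iff abs_minus_commute)
qed

text \<open>Size and Lipschitz constant are proved together because the inductive step multiplies by
  (s - n) / u, and the difference of two such products needs both. The range 3 contains the
  exponents \<plusminus>(\<theta> + 1/2), with room for the shift by 1 caused by
  differentiation.\<close>

lemma pw_bound_aux:
  assumes "0 < r"
  shows "\<exists>K>0. \<forall>s s' u. \<bar>s\<bar> \<le> 3 \<and> \<bar>s'\<bar> \<le> 3 \<and> r \<le> u \<and> u \<le> R \<longrightarrow>
    \<bar>(\<Prod>i<n. s - real i) * u powr (s - real n)\<bar> \<le> K \<and>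
    \<bar>(\<Prod>i<n. s - real i) * u powr (s - real n) - (\<Prod>i<n. s' - real i) * u powr (s' - real n)\<bar> \<le> K * \<bar>s - s'\<bar>"
proof (induction n)
  case 0
  \<comment> \<open>L bounds |ln u| for u between r and R; the summand 1 gives L \<ge> 1.\<close>
  define L where "L = 1 + \<bar>ln r\<bar> + \<bar>ln R\<bar>"
  show ?case
  proof (intro exI[of _ "exp (3 * L) * L"] conjI allI impI)
    show "0 < exp (3 * L) * L" by (simp add: L_def add_pos_nonneg)
    fix s s' u :: real assume a: "\<bar>s\<bar> \<le> 3 \<and> \<bar>s'\<bar> \<le> 3 \<and> r \<le> u \<and> u \<le> R"
    have u: "0 < u" using a assms by auto
    have "ln r \<le> ln u" "ln u \<le> ln R" using a assms u by (auto intro!: ln_mono)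
    then have l: "\<bar>ln u\<bar> \<le> L" by (auto simp: L_def)
    have e: "t * ln u \<le> 3 * L" if "\<bar>t\<bar> \<le> 3" for t
      using mult_mono[OF that l] by (simp add: abs_mult[symmetric] abs_le_iff)
    have L1: "1 \<le> L" by (simp add: L_def)
    have "exp (s * ln u) \<le> exp (3 * L) * 1" using e a by auto
    also have "\<dots> \<le> exp (3 * L) * L" using L1 by (intro mult_left_mono) auto
    finally show "\<bar>(\<Prod>i<0. s - real i) * u powr (s - real 0)\<bar> \<le> exp (3 * L) * L"
      using u by (simp add: powr_def)
    have "\<bar>exp (s * ln u) - exp (s' * ln u)\<bar> \<le> exp (3 * L) * \<bar>s * ln u - s' * ln u\<bar>"
      using e a by (intro abs_exp_diff_le) auto
    also have "\<dots> = exp (3 * L) * (\<bar>ln u\<bar> * \<bar>s - s'\<bar>)" by (simp add: left_diff_distrib[symmetric] abs_mult)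
    also have "\<dots> \<le> exp (3 * L) * (L * \<bar>s - s'\<bar>)" using l by (intro mult_left_mono mult_right_mono) auto
    finally show "\<bar>(\<Prod>i<0. s - real i) * u powr (s - real 0) - (\<Prod>i<0. s' - real i) * u powr (s' - real 0)\<bar>
      \<le> exp (3 * L) * L * \<bar>s - s'\<bar>"
      using u by (simp add: powr_def)
  qed
next
  case (Suc n)
  let ?q = "\<lambda>n s u. (\<Prod>i<n. s - real i) * u powr (s - real n)"
  from Suc obtain K where K: "K > 0" and
    K1: "\<And>s (s'::real) u. \<bar>s\<bar> \<le> 3 \<and> \<bar>s'\<bar> \<le> 3 \<and> r \<le> u \<and> u \<le> R \<Longrightarrow> \<bar>?q n s u\<bar> \<le> K" and
    K2: "\<And>s s' u. \<bar>s\<bar> \<le> 3 \<and> \<bar>s'\<bar> \<le> 3 \<and> r \<le> u \<and> u \<le> R \<Longrightarrow> \<bar>?q n s u - ?q n s' u\<bar> \<le> K * \<bar>s - s'\<bar>"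
    by blast
  have q: "?q (Suc n) s u = ?q n s u * (s - n) / u" if "u > 0" for s u :: real
  proof -
    have "u powr (s - real (Suc n)) = u powr (s - n) / u"
      using that powr_mult_base[of u "s - real (Suc n)"] by (simp add: field_simps)
    then show ?thesis by (simp add: mult_ac)
  qed
  show ?case
  \<comment> \<open>The product rule gives |s - n| \<le> 3 + n from one factor and 1 from the
    other.\<close>
  proof (intro exI[of _ "K * (4 + n) / r"] conjI allI impI)
    show "0 < K * (4 + n) / r" using K assms by auto
    fix s s' u :: real assume a: "\<bar>s\<bar> \<le> 3 \<and> \<bar>s'\<bar> \<le> 3 \<and> r \<le> u \<and> u \<le> R"
    have u: "0 < u" using a assms by auto
    have "\<bar>?q n s u * (s - n)\<bar> \<le> K * (4 + n)"
      unfolding abs_mult[of _ "s - real n"] by (intro mult_mono K1[of s s]) (use a K in auto)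
    then have "\<bar>?q n s u * (s - n)\<bar> / u \<le> K * (4 + n) / r"
      using a assms K by (intro frac_le) auto
    then show "\<bar>?q (Suc n) s u\<bar> \<le> K * (4 + n) / r"
      using u unfolding q[OF u] by simp
    have "\<bar>?q n s u * (s - n) - ?q n s' u * (s' - n)\<bar>
      = \<bar>(?q n s u - ?q n s' u) * (s - n) + ?q n s' u * (s - s')\<bar>"
      by (simp add: algebra_simps)
    also have "\<dots> \<le> \<bar>(?q n s u - ?q n s' u) * (s - n)\<bar> + \<bar>?q n s' u * (s - s')\<bar>" by (rule abs_triangle_ineq)
    also have "\<dots> \<le> (K * \<bar>s - s'\<bar>) * (3 + n) + K * \<bar>s - s'\<bar>"
      unfolding abs_mult[of _ "s - real n"] abs_mult[of _ "s - s'"]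
        by (intro add_mono mult_mono K2 K1[of s' s']) (use a K in auto)
    also have "\<dots> = K * (4 + n) * \<bar>s - s'\<bar>" by (simp add: algebra_simps)
    finally have "\<bar>?q n s u * (s - n) - ?q n s' u * (s' - n)\<bar> / u \<le> K * (4 + n) * \<bar>s - s'\<bar> / r"
      using a assms K by (intro frac_le) auto
    then show "\<bar>?q (Suc n) s u - ?q (Suc n) s' u\<bar> \<le> K * (4 + n) / r * \<bar>s - s'\<bar>"
      using u unfolding q[OF u] by (simp add: diff_divide_distrib[symmetric])
  qed
qed

lemma pw_bound:
  assumes "0 < r"
  shows "\<exists>K>0. \<forall>n\<le>N. \<forall>s s' e \<xi>. \<bar>s\<bar> \<le> 3 \<and> \<bar>s'\<bar> \<le> 3 \<and> r \<le> \<bar>\<xi>\<bar> \<and> \<bar>\<xi>\<bar> \<le> R \<longrightarrow>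
    \<bar>pw s e n \<xi>\<bar> \<le> K \<and> \<bar>pw s e n \<xi> - pw s' e n \<xi>\<bar> \<le> K * \<bar>s - s'\<bar>"
proof -
  have one: "\<exists>K>0. \<forall>s s' e \<xi>. \<bar>s\<bar> \<le> 3 \<and> \<bar>s'\<bar> \<le> 3 \<and> r \<le> \<bar>\<xi>\<bar> \<and> \<bar>\<xi>\<bar> \<le> R \<longrightarrow>
    \<bar>pw s e n \<xi>\<bar> \<le> K \<and> \<bar>pw s e n \<xi> - pw s' e n \<xi>\<bar> \<le> K * \<bar>s - s'\<bar>" for n
  proof -
    obtain K where K: "K > 0" "\<And>s s' u. \<bar>s\<bar> \<le> 3 \<and> \<bar>s'\<bar> \<le> 3 \<and> r \<le> u \<and> u \<le> R \<Longrightarrow>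
      \<bar>(\<Prod>i<n. s - real i) * u powr (s - real n)\<bar> \<le> K \<and>
      \<bar>(\<Prod>i<n. s - real i) * u powr (s - real n) - (\<Prod>i<n. s' - real i) * u powr (s' - real n)\<bar> \<le> K * \<bar>s - s'\<bar>"
      using pw_bound_aux[OF assms] by blast
    have f: "pw s e n \<xi> = sgn \<xi> ^ (n + e) * ((\<Prod>i<n. s - real i) * \<bar>\<xi>\<bar> powr (s - real n))" for s e \<xi>
      by (simp add: pw_def)
    have g: "\<bar>sgn \<xi> ^ (n + e)\<bar> \<le> (1::real)" for \<xi> :: real and e by (auto simp: power_abs sgn_if power_0_left)
    have h: "\<bar>sgn \<xi> ^ (n + e) * z\<bar> \<le> \<bar>z\<bar>" for \<xi> z :: real and e
      unfolding abs_mult using g by (intro mult_left_le_one_le) auto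
    show ?thesis
      unfolding f right_diff_distrib[symmetric]
      by (intro exI[of _ K]) (use K order_trans[OF h] in \<open>simp, blast\<close>)
  qed
  show ?thesis
  proof (induction N)
    case 0 then show ?case using one[of 0] by simp
  next
    case (Suc N)
    then obtain K where K: "K > 0" "\<And>n s s' e \<xi>. n \<le> N \<Longrightarrow> \<bar>s\<bar> \<le> 3 \<and> \<bar>s'\<bar> \<le> 3 \<and> r \<le> \<bar>\<xi>\<bar> \<and> \<bar>\<xi>\<bar> \<le> R \<Longrightarrow>
      \<bar>pw s e n \<xi>\<bar> \<le> K \<and> \<bar>pw s e n \<xi> - pw s' e n \<xi>\<bar> \<le> K * \<bar>s - s'\<bar>" by blast
    obtain D where D: "D > 0" "\<And>s s' e \<xi>. \<bar>s\<bar> \<le> 3 \<and> \<bar>s'\<bar> \<le> 3 \<and> r \<le> \<bar>\<xi>\<bar> \<and> \<bar>\<xi>\<bar> \<le> R \<Longrightarrow>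
      \<bar>pw s e (Suc N) \<xi>\<bar> \<le> D \<and> \<bar>pw s e (Suc N) \<xi> - pw s' e (Suc N) \<xi>\<bar> \<le> D * \<bar>s - s'\<bar>" using one[of "Suc
        N"] by blast
    show ?case
    proof (intro exI[of _ "K + D"] conjI allI impI)
      show "0 < K + D" using K D by auto
      fix n e and s s' \<xi> :: real assume n: "n \<le> Suc N" and a: "\<bar>s\<bar> \<le> 3 \<and> \<bar>s'\<bar> \<le> 3 \<and> r \<le> \<bar>\<xi>\<bar> \<and> \<bar>\<xi>\<bar> \<le> R"
      have m: "K * \<bar>s - s'\<bar> \<le> (K + D) * \<bar>s - s'\<bar>" "D * \<bar>s - s'\<bar> \<le> (K + D) * \<bar>s - s'\<bar>"
        using K D by (auto intro!: mult_right_mono)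
      show "\<bar>pw s e n \<xi>\<bar> \<le> K + D" "\<bar>pw s e n \<xi> - pw s' e n \<xi>\<bar> \<le> (K + D) * \<bar>s - s'\<bar>"
        using K(1) D(1) K(2)[OF _ a, of n e] D(2)[OF a, of e] n m
        by (cases "n = Suc N"; fastforce)+
    qed
  qed
qed

context annulus_function
begin

text \<open>With \<open>F\<close> the derivatives of the Fourier transform of the wavelet, s =
  -(\<theta> + 1/2) and e = 0 give \<open>Psi\<close>, s = \<theta> + 1/2 gives its dual, and e = 1
  occurs in their derivatives.\<close>

definition T :: "real \<Rightarrow> nat \<Rightarrow> real \<Rightarrow> complex" where
  "T s e = ft (\<lambda>\<xi>. F 0 \<xi> * of_real (pw s e 0 \<xi>))"

lemma weight_pw:
  "\<exists>K>0. \<forall>s s' e. \<bar>s\<bar> \<le> 3 \<and> \<bar>s'\<bar> \<le> 3 \<longrightarrow> weight 3 K (pw s e) \<and>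
     weight 3 (K * \<bar>s - s'\<bar>) (\<lambda>n \<xi>. pw s e n \<xi> - pw s' e n \<xi>)"
proof -
  obtain K where K: "K > 0" "\<And>n s s' e \<xi>. n \<le> 3 \<Longrightarrow> \<bar>s\<bar> \<le> 3 \<and> \<bar>s'\<bar> \<le> 3 \<and> r \<le> \<bar>\<xi>\<bar> \<and> \<bar>\<xi>\<bar> \<le> R \<Longrightarrow>
    \<bar>pw s e n \<xi>\<bar> \<le> K \<and> \<bar>pw s e n \<xi> - pw s' e n \<xi>\<bar> \<le> K * \<bar>s - s'\<bar>"
    using pw_bound[OF r_pos, of 3 R] by blast
  show ?thesis
    unfolding weight_def
    by (intro exI[of _ K]) (use K in \<open>auto intro!: pw_deriv DERIV_diff\<close>)
qed

text \<open>Covers every real s by compactness of the annulus, for the qualitative facts that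
  require no uniform constant.\<close>

lemma weight_pw_ex: "\<exists>K. weight 3 K (pw s e)"
proof -
  have "\<exists>B. \<forall>n\<le>3. \<forall>\<xi>. r \<le> \<bar>\<xi>\<bar> \<and> \<bar>\<xi>\<bar> \<le> R \<longrightarrow> \<bar>pw s e n \<xi>\<bar> \<le> B"
  proof -
    have "\<exists>B. \<forall>\<xi>. r \<le> \<bar>\<xi>\<bar> \<and> \<bar>\<xi>\<bar> \<le> R \<longrightarrow> \<bar>pw s e n \<xi>\<bar> \<le> B" for n
    proof -
      have "compact ({r..R} \<union> {-R..-r})" by (intro compact_Un compact_Icc)
      moreover have "continuous_on ({r..R} \<union> {-R..-r}) (pw s e n)"
        using pw_deriv[of _ s e n] r_pos
        by (intro continuous_at_imp_continuous_on ballI) (metis DERIV_isCont Un_iff atLeastAtMost_iff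
          less_le_not_le neg_less_0_iff_less order_trans)
      ultimately have "bounded (pw s e n ` ({r..R} \<union> {-R..-r}))"
        by (intro compact_imp_bounded compact_continuous_image)
      then obtain B where "\<forall>\<xi>\<in>{r..R} \<union> {-R..-r}. \<bar>pw s e n \<xi>\<bar> \<le> B"
        by (auto simp: bounded_iff)
      then show ?thesis by (intro exI[of _ B]) (auto simp: abs_if split: if_splits)
    qed
    then obtain B where B: "\<And>n \<xi>. r \<le> \<bar>\<xi>\<bar> \<and> \<bar>\<xi>\<bar> \<le> R \<Longrightarrow> \<bar>pw s e n \<xi>\<bar> \<le> B n" by metis
    show ?thesis
      by (intro exI[of _ "Max (B ` {..3})"]) (auto intro: order_trans[OF B] Max_ge)
  qed
  then show ?thesis by (auto simp: weight_def pw_deriv)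
qed

text \<open>\<open>T\<close> is linear in the weight, so the decay estimate for the difference of
  two power weights bounds the difference of the transforms.\<close>

lemma T_bounds:
  "\<exists>C>0. \<forall>s s' e x. \<bar>s\<bar> \<le> 3 \<and> \<bar>s'\<bar> \<le> 3 \<longrightarrow>
     norm (T s e x) \<le> C * decay x \<and> norm (T s e x - T s' e x) \<le> C * \<bar>s - s'\<bar> * decay x"
proof -
  obtain K where K: "K > 0" "\<And>s s' e. \<bar>s\<bar> \<le> 3 \<and> \<bar>s'\<bar> \<le> 3 \<Longrightarrow> weight 3 K (pw s e) \<and>
     weight 3 (K * \<bar>s - s'\<bar>) (\<lambda>n \<xi>. pw s e n \<xi> - pw s' e n \<xi>)"
    using weight_pw by blast
  obtain C where C: "C > 0" "\<And>w K x. K \<ge> 0 \<Longrightarrow> weight 3 K w \<Longrightarrow>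
      norm (ft (\<lambda>\<xi>. F 0 \<xi> * of_real (w 0 \<xi>)) x) \<le> C * K / (1 + \<bar>x\<bar>) ^ 3"
    using ft_weight_decay by blast
  show ?thesis
  proof (intro exI[of _ "C * K"] conjI allI impI)
    show "C * K > 0" using C K by auto
    fix s s' :: real and e x assume a: "\<bar>s\<bar> \<le> 3 \<and> \<bar>s'\<bar> \<le> (3::real)"
    show "norm (T s e x) \<le> C * K * decay x"
      using C(2)[of K "pw s e" x] K a by (auto simp: T_def decay_def)
    have "T s e x - T s' e x = ft (\<lambda>\<xi>. F 0 \<xi> * of_real (pw s e 0 \<xi> - pw s' e 0 \<xi>)) x"
      unfolding T_def ft_def
      by (subst Bochner_Integration.integral_diff[symmetric])
         (use K(2)[of s s' e] K(2)[of s' s' e] a in \<open>auto simp: right_diff_distrib intro!: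
           integrable_cis_mult0 F_mult_weight_integrable\<close>)
    then show "norm (T s e x - T s' e x) \<le> C * K * \<bar>s - s'\<bar> * decay x"
      using C(2)[of "K * \<bar>s - s'\<bar>" "\<lambda>n \<xi>. pw s e n \<xi> - pw s' e n \<xi>" x] K a
        by (auto simp: decay_def mult.assoc)
  qed
qed

lemma T_integrand:
  "continuous_on UNIV (\<lambda>\<xi>. F 0 \<xi> * of_real (pw s e 0 \<xi>))"
  "integrable lborel (\<lambda>\<xi>. F 0 \<xi> * of_real (pw s e 0 \<xi>))"
  using weight_pw_ex[of s e] F_mult_weight_cont F_mult_weight_integrable by auto

lemma F_at_0: "F i 0 = 0" using F_zero r_pos by simp

text \<open>Differentiation brings down \<i> \<xi>, which turns the even weight of exponent s into
  the odd one of exponent s + 1.\<close>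

lemma T_deriv: "(T s 0 has_vector_derivative \<i> * T (s + 1) 1 x) (at x)"
proof -
  let ?g = "\<lambda>\<xi>. F 0 \<xi> * of_real (pw s 0 0 \<xi>)"
  have "(ft ?g has_vector_derivative ft (\<lambda>\<xi>. \<i> * of_real \<xi> * ?g \<xi>) x) (at x)"
  proof (rule ft_has_vector_derivative[OF T_integrand(2)])
    show "integrable lborel (\<lambda>\<xi>. of_real (\<xi>\<^sup>2) * ?g \<xi>)"
      by (rule integrable_compact_support[where R = R])
         (auto intro!: continuous_intros T_integrand simp: F_zero)
  qed
  moreover have "(\<lambda>\<xi>. \<i> * of_real \<xi> * ?g \<xi>) = (\<lambda>\<xi>. \<i> * (F 0 \<xi> * of_real (pw (s + 1) 1 0 \<xi>)))"
  proof
    fix \<xi> show "\<i> * of_real \<xi> * ?g \<xi> = \<i> * (F 0 \<xi> * of_real (pw (s + 1) 1 0 \<xi>))"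
    proof (cases "\<xi> = 0")
      case False
      then have "pw (s + 1) 1 0 \<xi> = \<xi> * pw s 0 0 \<xi>"
        by (simp add: pw_def powr_add sgn_mult_abs mult.assoc[symmetric]) (simp add: mult.commute
          sgn_mult_abs mult.assoc)?
      then show ?thesis by simp
    qed (simp add: F_at_0)
  qed
  ultimately show ?thesis
    by (simp add: T_def ft_def mult.left_commute[of _ \<i>])
qed

text \<open>\<open>decay_increment\<close> is applied to \<open>T s 0\<close> and to the difference
  of two such functions. Their derivatives have exponent s + 1, hence the range 2 instead of
  3.\<close>

lemma T_increments:
  "\<exists>C>0. \<forall>s s' x y. \<bar>s\<bar> \<le> 2 \<and> \<bar>s'\<bar> \<le> 2 \<longrightarrow>
     norm (T s 0 x - T s 0 y) \<le> C * min 1 \<bar>x - y\<bar> * (decay x + decay y) \<and>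
     norm ((T s 0 x - T s 0 y) - (T s' 0 x - T s' 0 y)) \<le> C * \<bar>s - s'\<bar> * min 1 \<bar>x - y\<bar> * (decay x + decay y)"
proof -
  obtain C where C: "C > 0" "\<And>s s' e x. \<bar>s\<bar> \<le> 3 \<and> \<bar>s'\<bar> \<le> 3 \<Longrightarrow>
     norm (T s e x) \<le> C * decay x \<and> norm (T s e x - T s' e x) \<le> C * \<bar>s - s'\<bar> * decay x"
    using T_bounds by blast
  show ?thesis
  proof (intro exI[of _ "8 * C"] conjI allI impI)
    show "8 * C > 0" using C by simp
    fix s s' x y :: real assume a: "\<bar>s\<bar> \<le> 2 \<and> \<bar>s'\<bar> \<le> (2::real)"
    show "norm (T s 0 x - T s 0 y) \<le> 8 * C * min 1 \<bar>x - y\<bar> * (decay x + decay y)"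
      by (rule decay_increment[OF T_deriv]) (use C(2)[of s s] C(2)[of "s+1" "s+1"] a C(1) in \<open>auto simp:
        norm_mult\<close>)
    have "norm ((T s 0 x - T s' 0 x) - (T s 0 y - T s' 0 y))
      \<le> 8 * (C * \<bar>s - s'\<bar>) * min 1 \<bar>x - y\<bar> * (decay x + decay y)"
    proof (rule decay_increment)
      show "((\<lambda>x. T s 0 x - T s' 0 x) has_vector_derivative (\<i> * T (s + 1) 1 x - \<i>
        * T (s' + 1) 1 x)) (at x)" for x
        by (intro has_vector_derivative_diff T_deriv)
      show "norm (\<i> * T (s + 1) 1 x - \<i> * T (s' + 1) 1 x) \<le> C * \<bar>s - s'\<bar> * decay x" for x
        unfolding right_diff_distrib[symmetric] norm_mult
          using C(2)[of "s+1" "s'+1" 1 x] a by (simp add: abs_le_iff)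
    qed (use C(2)[of s s' 0] a C(1) in auto)
    then show "norm ((T s 0 x - T s 0 y) - (T s' 0 x - T s' 0 y))
      \<le> 8 * C * \<bar>s - s'\<bar> * min 1 \<bar>x - y\<bar> * (decay x + decay y)"
      by (simp add: algebra_simps)
  qed
qed

end

section \<open>Schwartz functions and the pairing of Fourier integrals\<close>

lemma schwartz_moment_integrable:
  assumes "schwartz \<psi>"
  shows "integrable lborel (\<lambda>x. x ^ m * \<psi> x)" "continuous_on UNIV \<psi>" "bounded (range \<psi>)"
proof -
  have b: "bounded (range (\<lambda>x. x ^ m * \<psi> x))" for m
    using assms unfolding schwartz_def by (metis (no_types, lifting) ext funpow_0)
  have "\<psi> differentiable at x" for x
    using assms unfolding schwartz_def by (metis funpow_0)
  then show c: "continuous_on UNIV \<psi>"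
    by (intro continuous_at_imp_continuous_on ballI differentiable_imp_continuous_within)
  show "bounded (range \<psi>)" using b[of 0] by simp
  \<comment> \<open>Bounds on the moments of orders m and m + 2 together dominate the integrand by a
    multiple of 1 / (1 + x^2).\<close>
  obtain B1 where B1: "\<And>x. \<bar>x ^ m * \<psi> x\<bar> \<le> B1" using b[of m] by (auto simp: bounded_iff)
  obtain B2 where B2: "\<And>x. \<bar>x ^ (m + 2) * \<psi> x\<bar> \<le> B2" using b[of "m + 2"] by (auto simp: bounded_iff)
  have i: "integrable lborel (\<lambda>x::real. inverse (1 + x\<^sup>2))"
    using integrable_inverse_1_plus_square by (simp add: set_integrable_def einterval_eq)
  have i2: "integrable lborel (\<lambda>x::real. (B1 + B2) * inverse (1 + x\<^sup>2))"
    using i by simp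
  show "integrable lborel (\<lambda>x. x ^ m * \<psi> x)"
  proof (rule Bochner_Integration.integrable_bound[OF i2])
    show "(\<lambda>x. x ^ m * \<psi> x) \<in> borel_measurable lborel"
      using borel_measurable_continuous_onI[OF c] by measurable
    show "AE x in lborel. norm (x ^ m * \<psi> x) \<le> norm ((B1 + B2) * inverse (1 + x\<^sup>2))"
    proof (intro AE_I2)
      fix x :: real
      have "\<bar>x ^ (m + 2) * \<psi> x\<bar> = x\<^sup>2 * \<bar>x ^ m * \<psi> x\<bar>"
        unfolding power_add by (simp add: abs_mult)
      then have "(1 + x\<^sup>2) * \<bar>x ^ m * \<psi> x\<bar> = \<bar>x ^ m * \<psi> x\<bar> + \<bar>x ^ (m + 2) * \<psi> x\<bar>"
        by (simp only: distrib_right mult_1_left)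
      also have "\<dots> \<le> B1 + B2" by (intro add_mono B1 B2)
      finally have "\<bar>x ^ m * \<psi> x\<bar> \<le> (B1 + B2) / (1 + x\<^sup>2)"
        by (subst pos_le_divide_eq) (auto simp: mult.commute add_pos_nonneg)
      also have "\<dots> \<le> \<bar>(B1 + B2) * inverse (1 + x\<^sup>2)\<bar>" by (simp add: divide_inverse)
      finally show "norm (x ^ m * \<psi> x) \<le> norm ((B1 + B2) * inverse (1 + x\<^sup>2))" by simp
    qed
  qed
qed

lemma ft_uminus: "ft g (- x) = ft (\<lambda>\<eta>. g (- \<eta>)) x"
  unfolding ft_def
  using lborel_integral_real_affine[of "-1" "\<lambda>\<eta>. cis (- x * \<eta>) * g \<eta>" 0] by simp

lemma ft_cmult: "ft (\<lambda>\<eta>. c * g \<eta>) x = c * ft g x"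
  unfolding ft_def by (subst integral_mult_right_zero[symmetric]) (simp add: mult_ac)

text \<open>Plancherel's identity for two dilated and translated functions: expand
  \<open>ft G\<close> and exchange the integrals; the inner one is \<open>ft g\<close> at the
  frequency a \<xi> / b, with a phase.\<close>

lemma ft_pairing:
  fixes G g :: "real \<Rightarrow> complex"
  assumes G: "integrable lborel G" and g: "integrable lborel g" and b: "b > 0"
  shows "(LINT s|lborel. ft G (a * s - c) * g (b * s - d)) =
    of_real (1 / b) * (LINT \<xi>|lborel. cis (- c * \<xi> + a * \<xi> * d / b) * G \<xi> * ft g (a * \<xi> / b))"
proof -
  have mG [measurable]: "G \<in> borel_measurable borel" and mg [measurable]: "g \<in> borel_measurable borel"
    using G g by auto
  let ?k = "\<lambda>s \<xi>. cis ((a * s - c) * \<xi>) * G \<xi> * g (b * s - d)"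
  have gb: "integrable lborel (\<lambda>s. g (b * s - d))"
    using lborel_integrable_real_affine[OF g, of b "- d"] b by simp
  have ip: "integrable (lborel \<Otimes>\<^sub>M lborel) (case_prod ?k)"
  proof (rule lborel_pair.Fubini_integrable)
    have "(\<lambda>s. LINT \<xi>|lborel. norm (?k s \<xi>)) = (\<lambda>s. (LINT \<xi>|lborel. norm (G \<xi>)) * norm (g (b * s - d)))"
      by (auto simp: norm_mult intro!: ext)
    then show "integrable lborel (\<lambda>x. LINT y|lborel. norm (case (x, y) of (s, \<xi>) \<Rightarrow> ?k s \<xi>))"
      using gb by simp
    show "AE x in lborel. integrable lborel (\<lambda>y. case (x, y) of (s, \<xi>) \<Rightarrow> ?k s \<xi>)"
      using integrable_cis_mult0[OF G] by auto
  qed measurable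
  have "(LINT s|lborel. ft G (a * s - c) * g (b * s - d)) = (LINT s|lborel. (LINT \<xi>|lborel. ?k s \<xi>))"
    by (simp add: ft_def)
  also have "\<dots> = (LINT \<xi>|lborel. (LINT s|lborel. ?k s \<xi>))"
    using lborel_pair.Fubini_integral[OF ip] by simp
  also have "\<dots> = (LINT \<xi>|lborel. of_real (1 / b) * (cis (- c * \<xi> + a * \<xi> * d / b) * G \<xi> * ft g (a * \<xi> / b)))"
  proof (rule Bochner_Integration.integral_cong[OF refl])
    fix \<xi>
    have "(LINT s|lborel. ?k s \<xi>) = \<bar>1 / b\<bar> *\<^sub>R (LINT y|lborel. ?k (d / b + (1 / b) * y) \<xi>)"
      by (rule lborel_integral_real_affine) (use b in simp)
    also have "(\<lambda>y. ?k (d / b + (1 / b) * y) \<xi>)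
      = (\<lambda>y. (cis (- c * \<xi> + a * \<xi> * d / b) * G \<xi>) * (cis ((a * \<xi> / b) * y) * g y))"
    proof
      fix y
      have "cis ((a * (d / b + (1 / b) * y) - c) * \<xi>) = cis (- c * \<xi> + a * \<xi> * d / b) * cis ((a * \<xi> / b) * y)"
        unfolding cis_mult by (rule arg_cong[of _ _ cis]) (use b in \<open>simp add: field_simps\<close>)
      moreover have "b * (d / b + (1 / b) * y) - d = y" using b by (simp add: field_simps)
      ultimately show "?k (d / b + (1 / b) * y) \<xi>
        = (cis (- c * \<xi> + a * \<xi> * d / b) * G \<xi>) * (cis ((a * \<xi> / b) * y) * g y)"
        by (simp only: mult_ac)
    qed
    finally show "(LINT s|lborel. ?k s \<xi>)
      = of_real (1 / b) * (cis (- c * \<xi> + a * \<xi> * d / b) * G \<xi> * ft g (a * \<xi> / b))"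
      using b by (simp add: ft_def scaleR_conv_of_real)
  qed
  also have "\<dots> = of_real (1 / b) * (LINT \<xi>|lborel. cis (- c * \<xi> + a * \<xi> * d / b) * G \<xi> * ft g (a * \<xi> / b))"
    by (rule integral_mult_right_zero)
  finally show ?thesis .
qed

lemma decay_integrable: "integrable lborel decay" "integrable lborel (\<lambda>x. \<bar>x\<bar> * decay x)"
proof -
  have i: "integrable lborel (\<lambda>x::real. inverse (1 + x\<^sup>2))"
    using integrable_inverse_1_plus_square by (simp add: set_integrable_def einterval_eq)
  have [measurable]: "decay \<in> borel_measurable borel" unfolding decay_def by measurable
  have le: "(1 + \<bar>x\<bar>) * decay x \<le> inverse (1 + x\<^sup>2)" for x
  proof -
    have "(1 + \<bar>x\<bar>) * decay x = 1 / (1 + \<bar>x\<bar>)\<^sup>2"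
      by (simp add: decay_def power3_eq_cube power2_eq_square add_pos_nonneg)
    also have "\<dots> \<le> 1 / (1 + x\<^sup>2)"
      by (intro divide_left_mono) (auto simp: power2_sum add_pos_nonneg)
    finally show ?thesis by (simp add: inverse_eq_divide)
  qed
  show "integrable lborel decay"
  proof (rule Bochner_Integration.integrable_bound[OF i])
    show "AE x in lborel. norm (decay x) \<le> norm (inverse (1 + x\<^sup>2))"
    proof (intro AE_I2)
      fix x :: real
      have "decay x \<le> (1 + \<bar>x\<bar>) * decay x" using decay_nonneg[of x] by (simp add: distrib_right)
      then show "norm (decay x) \<le> norm (inverse (1 + x\<^sup>2))"
        using le[of x] decay_nonneg[of x] abs_ge_self[of "inverse (1 + x\<^sup>2)"] by simp
    qed
  qed simp
  show "integrable lborel (\<lambda>x. \<bar>x\<bar> * decay x)"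
  proof (rule Bochner_Integration.integrable_bound[OF i])
    show "AE x in lborel. norm (\<bar>x\<bar> * decay x) \<le> norm (inverse (1 + x\<^sup>2))"
    proof (intro AE_I2)
      fix x :: real
      have "\<bar>x\<bar> * decay x \<le> (1 + \<bar>x\<bar>) * decay x" using decay_nonneg[of x] by (simp add: distrib_right)
      then show "norm (\<bar>x\<bar> * decay x) \<le> norm (inverse (1 + x\<^sup>2))"
        using le[of x] decay_nonneg[of x] abs_ge_self[of "inverse (1 + x\<^sup>2)"] by (simp add: abs_mult)
    qed
  qed simp
qed

subsection \<open>The dual wavelets\<close>

locale lemarie_meyer_wavelet =
  fixes \<psi> :: "real \<Rightarrow> real"
  assumes lm: "lemarie_meyer \<psi>"
begin

text \<open>The i-th derivative of \<open>fourier \<psi>\<close>: each differentiation brings down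
  -\<i> x under the integral.\<close>

definition D :: "nat \<Rightarrow> real \<Rightarrow> complex" where
  "D i \<xi> = of_real (1 / sqrt (2 * pi)) * ft (\<lambda>x. (- \<i> * of_real x) ^ i * of_real (\<psi> x)) (- \<xi>)"

lemma schwartz: "schwartz \<psi>" using lm by (simp add: lemarie_meyer_def)

lemma moment_integrable: "integrable lborel (\<lambda>x. (- \<i> * of_real x) ^ i * complex_of_real (\<psi> x))"
proof -
  have "integrable lborel (\<lambda>x. (- \<i>) ^ i * complex_of_real (x ^ i * \<psi> x))"
    using schwartz_moment_integrable(1)[OF schwartz, of i]
      by (intro integrable_mult_right) (rule integrable_of_real)
  then show ?thesis by (simp only: power_mult_distrib of_real_mult of_real_power mult.assoc)
qed

lemma D_0: "D 0 = fourier \<psi>"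
  by (auto simp: D_def fourier_def ft_def fun_eq_iff)

lemma D_deriv: "(D i has_vector_derivative D (Suc i) \<xi>) (at \<xi>)"
proof -
  let ?g = "\<lambda>x. (- \<i> * of_real x) ^ i * complex_of_real (\<psi> x)"
  have i2: "integrable lborel (\<lambda>x. of_real (x\<^sup>2) * ?g x)"
  proof -
    have "(\<lambda>x. of_real (x\<^sup>2) * ?g x) = (\<lambda>x. - ((- \<i> * of_real x) ^ (i + 2) * complex_of_real (\<psi> x)))"
      by (auto simp: power_add power2_eq_square mult_ac)
    then show ?thesis using moment_integrable[of "i + 2"] by simp
  qed
  have "((\<lambda>\<xi>. ft ?g (- \<xi>)) has_vector_derivative (-1) *\<^sub>R ft (\<lambda>x. \<i> * of_real x * ?g x) (- \<xi>)) (at \<xi>)"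
  proof -
    have "(uminus has_vector_derivative (-1::real)) (at \<xi>)" by (auto intro!: derivative_eq_intros)
    from vector_diff_chain_at[OF this ft_has_vector_derivative[OF moment_integrable i2]]
    show ?thesis unfolding o_def .
  qed
  moreover have "(-1) *\<^sub>R ft (\<lambda>x. \<i> * of_real x * ?g x) (- \<xi>)
    = ft (\<lambda>x. (- \<i> * of_real x) ^ Suc i * of_real (\<psi> x)) (- \<xi>)"
    unfolding ft_def by (simp flip: Bochner_Integration.integral_minus) (simp add: mult_ac)
  ultimately have "((\<lambda>\<xi>. ft ?g (- \<xi>)) has_vector_derivative ft (\<lambda>x. (- \<i> * of_real x) ^ Suc i
    * of_real (\<psi> x)) (- \<xi>)) (at \<xi>)"
    by simp
  from has_vector_derivative_mult_right[OF this, of "of_real (1 / sqrt (2 * pi))"]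
  show ?thesis unfolding D_def[abs_def] .
qed

lemma D_bounded: "bounded (range (D i))"
proof -
  have "norm (D i \<xi>) \<le> 1 / sqrt (2 * pi)
    * (LINT x|lborel. norm ((- \<i> * of_real x) ^ i * complex_of_real (\<psi> x)))" for \<xi>
    unfolding D_def norm_mult[of "complex_of_real (1 / sqrt (2 * pi))"] norm_of_real
    by (intro mult_mono norm_ft_le) auto
  then show ?thesis by (auto simp: bounded_iff)
qed

text \<open>Passes the vanishing of \<open>fourier \<psi>\<close> on open sets to all derivatives,
  which gives one annulus for the whole sequence.\<close>

lemma D_zero_open:
  assumes "open U" "\<And>\<xi>. \<xi> \<in> U \<Longrightarrow> D 0 \<xi> = 0" "\<xi> \<in> U"
  shows "D i \<xi> = 0"
  using assms(3)
proof (induction i arbitrary: \<xi>)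
  case (Suc i)
  have "(D i has_vector_derivative 0) (at \<xi>)"
    by (rule has_vector_derivative_transform_within_open[OF has_vector_derivative_const[of 0] assms(1)
      Suc.prems])
       (simp add: Suc.IH)
  then show ?case using D_deriv vector_derivative_unique_at by blast
qed (rule assms(2))

lemma annulus_ex: "\<exists>r R. annulus_function D r R"
proof -
  have "\<forall>\<^sub>F \<xi> in nhds 0. D 0 \<xi> = 0" using lm by (simp add: lemarie_meyer_def D_0)
  then obtain r where r: "r > 0" "\<And>\<xi>. dist \<xi> 0 < r \<Longrightarrow> D 0 \<xi> = 0"
    by (auto simp: eventually_nhds_metric)
  have "bounded {\<xi>. D 0 \<xi> \<noteq> 0}"
    using lm compact_imp_bounded bounded_closure bounded_subset[OF _ closure_subset]
    by (auto simp: lemarie_meyer_def D_0)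
  then obtain R where R: "\<And>\<xi>. D 0 \<xi> \<noteq> 0 \<Longrightarrow> \<bar>\<xi>\<bar> \<le> R" by (auto simp: bounded_iff)
  show ?thesis
  proof (intro exI annulus_function.intro)
    fix i \<xi> assume "\<bar>\<xi>\<bar> < r \<or> R < \<bar>\<xi>\<bar>"
    moreover have "open {\<xi>::real. \<bar>\<xi>\<bar> < r \<or> R < \<bar>\<xi>\<bar>}"
      by (intro open_Collect_disj open_Collect_less continuous_intros)
    moreover have "D 0 \<xi> = 0" if "\<xi> \<in> {\<xi>::real. \<bar>\<xi>\<bar> < r \<or> R < \<bar>\<xi>\<bar>}" for \<xi> using that r R by fastforce
    ultimately show "D i \<xi> = 0" using D_zero_open by blast
  qed (use r D_deriv D_bounded in auto)
qed

definition "supp_r = (SOME r. \<exists>R. annulus_function D r R)"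
definition "supp_R = (SOME R. annulus_function D supp_r R)"

sublocale annulus_function D supp_r supp_R
  unfolding supp_R_def supp_r_def using someI_ex[OF someI_ex[OF annulus_ex]] .

lemma D0_cnj: "cnj (D 0 \<xi>) = D 0 (- \<xi>)"
proof -
  have "cnj (LINT x|lborel. cis (- (\<xi> * x)) * complex_of_real (\<psi> x))
    = (LINT x|lborel. cnj (cis (- (\<xi> * x)) * complex_of_real (\<psi> x)))"
    by (rule Bochner_Integration.integral_cnj[symmetric])
  then show ?thesis by (simp add: D_0 fourier_def cis_cnj del: Bochner_Integration.integral_cnj)
qed

text \<open>Real values of \<psi> make \<open>D 0\<close> Hermitian, and the weight with e = 0 is
  even; conjugation followed by \<xi> \<mapsto> -\<xi> therefore fixes the integral.\<close>

lemma T_real: "Im (T s 0 x) = 0"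
proof -
  have "cnj (T s 0 x) = (LINT \<xi>|lborel. cis (- x * \<xi>) * (D 0 (- \<xi>) * of_real (pw s 0 0 \<xi>)))"
  proof -
    have "cnj (T s 0 x) = (LINT \<xi>|lborel. cnj (cis (x * \<xi>) * (D 0 \<xi> * of_real (pw s 0 0 \<xi>))))"
      unfolding T_def ft_def by (rule Bochner_Integration.integral_cnj[symmetric])
    then show ?thesis by (simp add: cis_cnj D0_cnj del: Bochner_Integration.integral_cnj)
  qed
  also have "\<dots> = T s 0 x"
    unfolding T_def ft_def
    using lborel_integral_real_affine[of "-1" "\<lambda>\<xi>. cis (- x * \<xi>) * (D 0 (- \<xi>) * of_real (pw s 0 0 \<xi>))" 0]
    by (simp add: pw_def)
  finally show ?thesis by (simp add: complex_eq_iff)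
qed

lemma T_of_real: "T s 0 x = of_real (Re (T s 0 x))"
  by (simp add: complex_eq_iff T_real)

lemma Psi_eq: "Psi \<psi> x \<theta> = Re (T (- (\<theta> + 1 / 2)) 0 x)"
  by (simp add: Psi_def T_def ft_def pw_def D_0 powr_minus_divide divide_simps mult.assoc)

lemma T_cont: "continuous_on UNIV (T s 0)"
  using T_deriv by (auto intro!: continuous_at_imp_continuous_on has_vector_derivative_continuous)

lemma T_integrable:
  assumes "\<bar>s\<bar> \<le> 3"
  shows "integrable lborel (T s 0)"
proof -
  obtain C where C: "\<And>x. norm (T s 0 x) \<le> C * decay x" using T_bounds assms by blast
  have i: "integrable lborel (\<lambda>x. C * decay x)" using decay_integrable by simp
  show ?thesis
    by (rule Bochner_Integration.integrable_bound[OF i])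
       (use C borel_measurable_continuous_onI[OF T_cont] in \<open>auto intro: order_trans[OF _ abs_ge_self]\<close>)
qed

text \<open>\<open>T s 0\<close> is an integrable Fourier integral of a continuous, compactly
  supported function, so inversion recovers that function.\<close>

lemma ft_T:
  assumes "\<bar>s\<bar> \<le> 3"
  shows "ft (T s 0) x = 2 * pi * (D 0 (- x) * of_real (pw s 0 0 (- x)))"
proof -
  let ?f = "\<lambda>\<xi>. D 0 \<xi> * of_real (pw s 0 0 \<xi>)"
  have "bounded (range ?f)"
  proof -
    have "compact (?f ` {-supp_R..supp_R})"
      by (intro compact_continuous_image continuous_on_subset[OF T_integrand(1)]) auto
    then have "bounded (insert 0 (?f ` {-supp_R..supp_R}))" by (simp add: compact_imp_bounded)
    moreover have "range ?f \<subseteq> insert 0 (?f ` {-supp_R..supp_R})"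
    proof (intro image_subsetI)
      fix \<xi> :: real
      show "?f \<xi> \<in> insert 0 (?f ` {-supp_R..supp_R})"
      proof (cases "\<bar>\<xi>\<bar> \<le> supp_R")
        case True
        then have "\<xi> \<in> {-supp_R..supp_R}" by (auto simp: abs_le_iff)
        then show ?thesis by blast
      next
        case False
        then have "D 0 \<xi> = 0" using F_zero[of \<xi> 0] by simp
        then show ?thesis by simp
      qed
    qed
    ultimately show ?thesis by (rule bounded_subset)
  qed
  then obtain B where B: "\<And>x. norm (?f x) \<le> B" unfolding bounded_iff by blast
  have i: "integrable lborel (ft ?f)" using T_integrable[OF assms] unfolding T_def .
  have "ft (\<lambda>\<eta>. ft ?f (- \<eta>)) (- x) = 2 * pi * ?f (- x)"
    by (rule fourier_inversion[OF T_integrand(2) T_integrand(1) B i])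
  moreover have "ft (\<lambda>\<eta>. ft ?f (- \<eta>)) (- x) = ft (T s 0) x"
    unfolding ft_uminus[of "\<lambda>\<eta>. ft ?f (- \<eta>)"] minus_minus T_def ..
  ultimately show ?thesis by simp
qed

lemma ft_D0: "ft (D 0) x = of_real (sqrt (2 * pi) * \<psi> x)"
proof -
  let ?f = "\<lambda>x. complex_of_real (\<psi> x)"
  have e: "ft ?f x = of_real (sqrt (2 * pi)) * D 0 (- x)" for x by (simp add: D_def)
  obtain B where B: "\<And>x. norm (?f x) \<le> B"
    using schwartz_moment_integrable(3)[OF schwartz] by (auto simp: bounded_iff)
  have D: "integrable lborel (D 0)"
    by (rule integrable_compact_support[where R = supp_R])
       (use D_deriv F_zero in \<open>auto intro!: continuous_at_imp_continuous_on has_vector_derivative_continuous\<close>)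
  have i: "integrable lborel (ft ?f)"
    unfolding e using lborel_integrable_real_affine[OF D, of "-1" 0] by simp
  have "ft (\<lambda>\<eta>. ft ?f (- \<eta>)) x = 2 * pi * ?f x"
    by (rule fourier_inversion[where B = B])
       (use i B moment_integrable[of 0] schwartz_moment_integrable(2)[OF schwartz] in \<open>auto intro!:
         continuous_intros\<close>)
  moreover have "ft (\<lambda>\<eta>. ft ?f (- \<eta>)) x = of_real (sqrt (2 * pi)) * ft (D 0) x"
    unfolding e minus_minus by (rule ft_cmult)
  ultimately have "of_real (sqrt (2 * pi)) * ft (D 0) x
    = of_real (sqrt (2 * pi)) * of_real (sqrt (2 * pi) * \<psi> x)"
    by (simp flip: of_real_mult mult.assoc del: real_sqrt_mult)
  then show ?thesis by (subst (asm) mult_cancel_left) auto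
qed

definition dual :: "real \<Rightarrow> real \<Rightarrow> real" where
  "dual \<theta> x = Re (T (\<theta> + 1 / 2) 0 x)"

text \<open>The Fourier transform of the dual vanishes at frequency 0 because \<open>D 0\<close>
  does. This cancellation later removes the values subtracted at t.\<close>

lemma dual_integral:
  assumes "0 \<le> \<theta>" "\<theta> \<le> 1"
  shows "(LINT x|lborel. dual \<theta> x) = 0"
proof -
  have "of_real (LINT x|lborel. dual \<theta> x) = ft (T (\<theta> + 1 / 2) 0) 0"
    unfolding dual_def integral_complex_of_real[symmetric] T_of_real[symmetric] by (simp add: ft_def)
  also have "\<dots> = 0" using assms by (subst ft_T) (auto simp: F_at_0)
  finally show ?thesis by simp
qed

text \<open>The weights of \<open>Psi\<close> and \<open>dual\<close> multiply to \<open>1\<close>, so Plancherel's identity reduces the pairing to the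
  orthonormality of the wavelets.\<close>

lemma dual_pairing:
  assumes \<theta>: "0 \<le> \<theta>" "\<theta> \<le> 1"
  shows "(LINT s|lborel. Psi \<psi> (2 powr of_int j' * s - of_int k') \<theta>
    * dual \<theta> (2 powr of_int j * s - of_int k)) =
    (if j' = j \<and> k' = k then 2 * pi / 2 powr of_int j else 0)"
proof -
  let ?a = "2 powr real_of_int j'" and ?b = "2 powr real_of_int j"
  let ?\<sigma> = "\<theta> + 1 / 2"
  \<comment> \<open>This frequency integral occurs both in the pairing of the weighted functions and
    in that of the plain wavelets; comparing the two avoids evaluating it.\<close>
  let ?I = "LINT \<xi>|lborel. cis (- of_int k' * \<xi> + ?a * \<xi> * of_int k / ?b) * D 0 \<xi> * D 0 (- (?a * \<xi> / ?b))"
  have D: "integrable lborel (D 0)"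
    by (rule integrable_compact_support[where R = supp_R])
       (use D_deriv F_zero in \<open>auto intro!: continuous_at_imp_continuous_on has_vector_derivative_continuous\<close>)
  have 1: "(LINT s|lborel. T (- ?\<sigma>) 0 (?a * s - of_int k') * T ?\<sigma> 0 (?b * s - of_int k))
    = of_real (1 / ?b) * (of_real (2 * pi * (?a / ?b) powr ?\<sigma>) * ?I)"
  proof -
    have "(LINT s|lborel. T (- ?\<sigma>) 0 (?a * s - of_int k') * T ?\<sigma> 0 (?b * s - of_int k)) =
      of_real (1 / ?b) * (LINT \<xi>|lborel. cis (- of_int k' * \<xi> + ?a * \<xi> * of_int k / ?b) *
        (D 0 \<xi> * of_real (pw (- ?\<sigma>) 0 0 \<xi>)) * ft (T ?\<sigma> 0) (?a * \<xi> / ?b))"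
      unfolding T_def[of "- ?\<sigma>"]
      by (rule ft_pairing[OF T_integrand(2) T_integrable]) (use \<theta> in auto)
    also have "(\<lambda>\<xi>. cis (- of_int k' * \<xi> + ?a * \<xi> * of_int k / ?b) * (D 0 \<xi> * of_real (pw (- ?\<sigma>) 0 0 \<xi>))
      * ft (T ?\<sigma> 0) (?a * \<xi> / ?b))
       = (\<lambda>\<xi>. of_real (2 * pi * (?a / ?b) powr ?\<sigma>) *
         (cis (- of_int k' * \<xi> + ?a * \<xi> * of_int k / ?b) * D 0 \<xi> * D 0 (- (?a * \<xi> / ?b))))"
    proof
      fix \<xi>
      show "cis (- of_int k' * \<xi> + ?a * \<xi> * of_int k / ?b) * (D 0 \<xi> * of_real (pw (- ?\<sigma>) 0 0 \<xi>))
        * ft (T ?\<sigma> 0) (?a * \<xi> / ?b)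
       = of_real (2 * pi * (?a / ?b) powr ?\<sigma>) * (cis (- of_int k' * \<xi> + ?a * \<xi> * of_int k / ?b) * D 0 \<xi> * D
         0 (- (?a * \<xi> / ?b)))"
      proof (cases "\<xi> = 0")
        case False
        have "pw (- ?\<sigma>) 0 0 \<xi> * pw ?\<sigma> 0 0 (- (?a * \<xi> / ?b)) = \<bar>\<xi>\<bar> powr (- ?\<sigma>) * (?a / ?b * \<bar>\<xi>\<bar>) powr ?\<sigma>"
          by (simp add: pw_def abs_mult)
        also have "\<dots> = (?a / ?b) powr ?\<sigma> * (\<bar>\<xi>\<bar> powr (- ?\<sigma>) * \<bar>\<xi>\<bar> powr ?\<sigma>)"
          by (subst powr_mult) auto
        also have "\<bar>\<xi>\<bar> powr (- ?\<sigma>) * \<bar>\<xi>\<bar> powr ?\<sigma> = 1"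
          using False by (subst powr_add[symmetric]) simp
        finally have "pw (- ?\<sigma>) 0 0 \<xi> * pw ?\<sigma> 0 0 (- (?a * \<xi> / ?b)) = (?a / ?b) powr ?\<sigma>" by simp
        then have *: "of_real (pw (- ?\<sigma>) 0 0 \<xi>) * of_real (pw ?\<sigma> 0 0 (- (?a * \<xi> / ?b)))
          = complex_of_real ((?a / ?b) powr ?\<sigma>)"
          by (metis of_real_mult)
        have ftT: "ft (T ?\<sigma> 0) (?a * \<xi> / ?b)
          = 2 * pi * (D 0 (- (?a * \<xi> / ?b)) * of_real (pw ?\<sigma> 0 0 (- (?a * \<xi> / ?b))))"
          using \<theta> by (intro ft_T) auto
        show ?thesis
          unfolding ftT of_real_mult *[symmetric] by (simp only: mult_ac)
      qed (simp add: F_at_0)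
    qed
    finally show ?thesis by (simp only: integral_mult_right_zero)
  qed
  have 2: "(LINT s|lborel. ft (D 0) (?a * s - of_int k') * of_real (\<psi> (?b * s - of_int k)))
    = of_real (1 / ?b) * (of_real (sqrt (2 * pi)) * ?I)"
  proof -
    have e: "ft (\<lambda>x. complex_of_real (\<psi> x)) x = of_real (sqrt (2 * pi)) * D 0 (- x)" for x
      by (simp add: D_def)
    have i: "integrable lborel (\<lambda>x. complex_of_real (\<psi> x))" using moment_integrable[of 0] by simp
    show ?thesis
      by (subst ft_pairing[OF D i]) (auto simp: e mult_ac simp flip: integral_mult_right_zero)
  qed
  let ?O = "LINT s|lborel. \<psi> (?a * s - of_int k') * \<psi> (?b * s - of_int k)"
  have "of_real (sqrt (2 * pi)) * of_real ?O
    = (LINT s|lborel. ft (D 0) (?a * s - of_int k') * of_real (\<psi> (?b * s - of_int k)))"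
  proof -
    have "(LINT s|lborel. ft (D 0) (?a * s - of_int k') * of_real (\<psi> (?b * s - of_int k))) =
      (LINT s|lborel. complex_of_real (sqrt (2 * pi) * (\<psi> (?a * s - of_int k') * \<psi> (?b * s - of_int k))))"
      by (simp only: ft_D0 of_real_mult mult.assoc)
    also have "\<dots> = complex_of_real (LINT s|lborel. sqrt (2 * pi)
      * (\<psi> (?a * s - of_int k') * \<psi> (?b * s - of_int k)))"
      by (rule integral_complex_of_real)
    also have "(LINT s|lborel. sqrt (2 * pi) * (\<psi> (?a * s - of_int k') * \<psi> (?b * s - of_int k)))
      = sqrt (2 * pi) * ?O"
      by (rule integral_mult_right_zero)
    finally show ?thesis by (simp only: of_real_mult)
  qed
  then have "of_real (sqrt (2 * pi)) * of_real ?O = of_real (sqrt (2 * pi)) * (of_real (1 / ?b) * ?I)"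
    unfolding 2 by (simp only: mult_ac)
  then have 3: "of_real ?O = of_real (1 / ?b) * ?I"
    by (subst (asm) mult_cancel_left) simp
  have "complex_of_real (LINT s|lborel. Psi \<psi> (?a * s - of_int k') \<theta> * dual \<theta> (?b * s - of_int k)) =
    (LINT s|lborel. T (- ?\<sigma>) 0 (?a * s - of_int k') * T ?\<sigma> 0 (?b * s - of_int k))"
    unfolding Psi_eq dual_def integral_complex_of_real[symmetric] of_real_mult T_of_real[symmetric] ..
  also have "\<dots> = of_real (2 * pi * (?a / ?b) powr ?\<sigma> * ?O)"
    unfolding 1 of_real_mult 3 by (simp only: mult_ac)
  finally have 4: "(LINT s|lborel. Psi \<psi> (?a * s - of_int k') \<theta> * dual \<theta> (?b * s - of_int k))
    = 2 * pi * (?a / ?b) powr ?\<sigma> * ?O"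
    by (simp only: of_real_eq_iff)
  have "(LINT x|lborel. wavelet \<psi> (j', k') x * wavelet \<psi> (j, k) x) = (if (j', k') = (j, k) then 1 else 0)"
    using lm by (auto simp: lemarie_meyer_def orthonormal_basis_L2_def)
  moreover have "(LINT x|lborel. wavelet \<psi> (j', k') x * wavelet \<psi> (j, k) x)
    = 2 powr (of_int j' / 2) * 2 powr (of_int j / 2) * ?O"
    unfolding integral_mult_right_zero[symmetric] by (simp add: wavelet_def mult_ac)
  ultimately have 5: "2 powr (of_int j' / 2) * 2 powr (of_int j / 2) * ?O
    = (if (j', k') = (j, k) then 1 else 0)" by simp
  \<comment> \<open>The leftover factor (2^j' / 2^j)^(\<theta> + 1/2) does no harm: orthogonality
    kills all pairs of different scales, and at equal scales it is 1.\<close>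
  show ?thesis
  proof (cases "(j', k') = (j, k)")
    case True
    then have "2 powr of_int j * ?O = 1" using 5 by (simp flip: powr_add)
    then show ?thesis unfolding 4 using True by (simp add: field_simps)
  next
    case False
    then have "?O = 0" using 5 by auto
    then show ?thesis unfolding 4 using False by auto
  qed
qed

lemma dual_decay:
  assumes "0 \<le> \<theta>" "\<theta> \<le> 1"
  shows "\<exists>C>0. \<forall>x. \<bar>dual \<theta> x\<bar> \<le> C * decay x"
proof -
  obtain C where C: "C > 0" "\<And>x. norm (T (\<theta> + 1 / 2) 0 x) \<le> C * decay x"
  proof -
    obtain C where C: "C > 0" "\<And>s (s'::real) e x. \<bar>s\<bar> \<le> 3 \<and> \<bar>s'\<bar> \<le> 3 \<Longrightarrow> norm (T s e x) \<le> C * decay x"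
      using T_bounds by metis
    show ?thesis using that[of C] C(1) C(2)[of "\<theta> + 1 / 2" 0] assms by auto
  qed
  show ?thesis
    by (intro exI[of _ C]) (use C abs_Re_le_cmod in \<open>auto simp: dual_def intro: order_trans\<close>)
qed

lemma dual_measurable: "dual \<theta> \<in> borel_measurable borel"
  unfolding dual_def by (intro borel_measurable_continuous_onI continuous_intros T_cont)

lemma Psi_increments:
  "\<exists>C>0. \<forall>\<theta> \<theta>' x y. 0 \<le> \<theta> \<and> \<theta> \<le> 1 \<and> 0 \<le> \<theta>' \<and> \<theta>' \<le> 1 \<longrightarrow>
     \<bar>Psi \<psi> x \<theta> - Psi \<psi> y \<theta>\<bar> \<le> C * min 1 \<bar>x - y\<bar> * (decay x + decay y) \<and>
     \<bar>(Psi \<psi> x \<theta> - Psi \<psi> y \<theta>) - (Psi \<psi> x \<theta>' - Psi \<psi> y \<theta>')\<bar> \<le> C * \<bar>\<theta> - \<theta>'\<bar> * min 1 \<bar>x - y\<bar> * (decay x + decay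
       y)"
proof -
  obtain C where C: "C > 0" "\<And>s s' x y. \<bar>s\<bar> \<le> 2 \<and> \<bar>s'\<bar> \<le> 2 \<Longrightarrow>
     norm (T s 0 x - T s 0 y) \<le> C * min 1 \<bar>x - y\<bar> * (decay x + decay y) \<and>
     norm ((T s 0 x - T s 0 y) - (T s' 0 x - T s' 0 y)) \<le> C * \<bar>s - s'\<bar> * min 1 \<bar>x - y\<bar> * (decay x + decay y)"
    using T_increments by blast
  show ?thesis
  proof (intro exI[of _ C] conjI allI impI C(1))
    fix \<theta> \<theta>' x y :: real assume a: "0 \<le> \<theta> \<and> \<theta> \<le> 1 \<and> 0 \<le> \<theta>' \<and> \<theta>' \<le> 1"
    let ?s = "- (\<theta> + 1 / 2)" and ?s' = "- (\<theta>' + 1 / 2)"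
    have b: "norm (T ?s 0 x - T ?s 0 y) \<le> C * min 1 \<bar>x - y\<bar> * (decay x + decay y)"
     "norm ((T ?s 0 x - T ?s 0 y) - (T ?s' 0 x - T ?s' 0 y))
       \<le> C * \<bar>?s - ?s'\<bar> * min 1 \<bar>x - y\<bar> * (decay x + decay y)"
      using C(2)[of ?s ?s' x y] a by auto
    show "\<bar>Psi \<psi> x \<theta> - Psi \<psi> y \<theta>\<bar> \<le> C * min 1 \<bar>x - y\<bar> * (decay x + decay y)"
      using order_trans[OF abs_Re_le_cmod b(1)] by (simp add: Psi_eq)
    have "\<bar>?s - ?s'\<bar> = \<bar>\<theta> - \<theta>'\<bar>" by simp
    then show "\<bar>(Psi \<psi> x \<theta> - Psi \<psi> y \<theta>) - (Psi \<psi> x \<theta>' - Psi \<psi> y \<theta>')\<bar>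
      \<le> C * \<bar>\<theta> - \<theta>'\<bar> * min 1 \<bar>x - y\<bar> * (decay x + decay y)"
      using order_trans[OF abs_Re_le_cmod b(2)] unfolding Psi_eq by simp
  qed
qed

lemma Psi_measurable: "(\<lambda>x. Psi \<psi> x \<theta>) \<in> borel_measurable borel"
  unfolding Psi_eq by (intro borel_measurable_continuous_onI continuous_intros T_cont)

end

subsection \<open>Bounds for the increments of the field\<close>

lemma summable_on_int:
  fixes f :: "int \<Rightarrow> real"
  assumes "summable (\<lambda>n. f (int n))" "summable (\<lambda>n. f (- int n))" "\<And>i. f i \<ge> 0"
  shows "f summable_on UNIV"
proof -
  have 1: "f summable_on (range int)"
    unfolding summable_on_reindex[OF inj_of_nat]
    by (rule norm_summable_imp_summable_on) (use assms in \<open>simp add: o_def\<close>)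
  have 2: "f summable_on (range (\<lambda>n. - int n))"
    by (subst summable_on_reindex) (use assms in \<open>auto simp: inj_def o_def intro!:
      norm_summable_imp_summable_on\<close>)
  have "range int \<union> range (\<lambda>n. - int n) = UNIV"
    by (auto simp: image_def) (metis int_cases2)
  then show ?thesis using summable_on_union[OF 1 2] by simp
qed

text \<open>Two formal derivatives of the geometric series have the coefficients (n + 1) (n + 2),
  which dominate (1 + n)^2.\<close>

lemma summable_square_geometric:
  fixes q :: real
  assumes "0 \<le> q" "q < 1"
  shows "summable (\<lambda>n. (1 + real n)\<^sup>2 * q ^ n)"
proof -
  have d: "summable (\<lambda>n. diffs (\<lambda>_. 1) n * x ^ n)" if "norm x < 1" for x :: real
    by (rule termdiff_converges[OF that]) (auto intro: summable_geometric)
  have "summable (\<lambda>n. diffs (diffs (\<lambda>_. 1)) n * q ^ n)"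
    by (rule termdiff_converges[where K = 1]) (use assms d in auto)
  then show ?thesis
    by (rule summable_comparison_test[rotated])
       (use assms in \<open>auto simp: diffs_def power2_eq_square intro!: exI[of _ 0] mult_right_mono\<close>)
qed

lemma summable_on_inverse_square_int: "(\<lambda>k::int. 1 / (1 + \<bar>real_of_int k\<bar>)\<^sup>2) summable_on UNIV"
proof (rule summable_on_int)
  have "summable (\<lambda>n. 1 / (1 + real n)\<^sup>2)"
    using inverse_squares_sums by (auto simp: sums_iff inverse_eq_divide add.commute)
  then show "summable (\<lambda>n. 1 / (1 + \<bar>real_of_int (int n)\<bar>)\<^sup>2)" "summable (\<lambda>n. 1 / (1
    + \<bar>real_of_int (- int n)\<bar>)\<^sup>2)"
    by simp_all
qed auto

lemma double_summable_bound:
  fixes f :: "'a \<times> 'b \<Rightarrow> real"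
  assumes nonneg: "\<And>i j. f (i, j) \<ge> 0"
    and inner: "\<And>i. (\<lambda>j. f (i, j)) summable_on UNIV" "\<And>i. infsum (\<lambda>j. f (i, j)) UNIV \<le> g i"
    and outer: "g summable_on UNIV"
  shows "f summable_on UNIV" "infsum f UNIV \<le> infsum g UNIV"
proof -
  have s: "(\<lambda>i. infsum (\<lambda>j. f (i, j)) UNIV) summable_on UNIV"
    by (rule summable_on_comparison_test[OF outer]) (auto intro: inner infsum_nonneg nonneg)
  have "f summable_on (Sigma UNIV (\<lambda>_. UNIV))"
    by (rule summable_on_SigmaI[OF _ s]) (auto intro!: has_sum_infsum inner nonneg)
  then show f: "f summable_on UNIV" by simp
  have "infsum f UNIV = infsum (\<lambda>i. infsum (\<lambda>j. f (i, j)) UNIV) UNIV"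
    using infsum_Sigma_banach[of f UNIV "\<lambda>_. UNIV"] f by simp
  also have "\<dots> \<le> infsum g UNIV"
    by (rule infsum_mono[OF s outer inner(2)])
  finally show "infsum f UNIV \<le> infsum g UNIV" .
qed

text \<open>1 + |k - y| \<le> (1 + |x - k|) (1 + |x - y|). As p \<le> 1, the first factor costs one
  power of the decay; inverse squares remain, summed around \<lfloor>x\<rfloor>.\<close>

lemma decay_lattice_sum:
  "\<exists>C>0. \<forall>x y p. 0 \<le> p \<and> p \<le> 1 \<longrightarrow>
     (\<lambda>k. (1 + \<bar>real_of_int k - y\<bar>) powr p * decay (x - real_of_int k)) summable_on UNIV \<and>
     infsum (\<lambda>k. (1 + \<bar>real_of_int k - y\<bar>) powr p * decay (x - real_of_int k)) UNIV \<le> C * (1 + \<bar>x -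
       y\<bar>) powr p"
proof -
  let ?z = "\<lambda>k::int. 1 / (1 + \<bar>real_of_int k\<bar>)\<^sup>2"
  define Z where "Z = infsum ?z UNIV"
  have Z: "Z \<ge> 0" unfolding Z_def by (intro infsum_nonneg) auto
  show ?thesis
  proof (intro exI[of _ "4 * Z + 1"] conjI allI impI)
    show "0 < 4 * Z + 1" using Z by simp
    fix x y p :: real assume p: "0 \<le> p \<and> p \<le> 1"
    define m where "m = \<lfloor>x\<rfloor>"
    let ?f = "\<lambda>k. (1 + \<bar>real_of_int k - y\<bar>) powr p * decay (x - real_of_int k)"
    let ?g = "\<lambda>k. 4 * (1 + \<bar>x - y\<bar>) powr p * ?z (k - m)"
    have le: "?f k \<le> ?g k" for k
    proof -
      let ?u = "1 + \<bar>x - real_of_int k\<bar>"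
      have "1 + \<bar>real_of_int k - y\<bar> \<le> ?u * (1 + \<bar>x - y\<bar>)"
        by (simp add: algebra_simps) (smt (verit) mult_nonneg_nonneg)
      then have "(1 + \<bar>real_of_int k - y\<bar>) powr p \<le> (?u * (1 + \<bar>x - y\<bar>)) powr p"
        by (intro powr_mono2) (use p in auto)
      also have "\<dots> = ?u powr p * (1 + \<bar>x - y\<bar>) powr p" by (rule powr_mult)
      also have "\<dots> \<le> ?u powr 1 * (1 + \<bar>x - y\<bar>) powr p"
        by (intro mult_right_mono powr_mono) (use p in auto)
      finally have "?f k \<le> ?u * (1 + \<bar>x - y\<bar>) powr p * decay (x - real_of_int k)"
        by (intro mult_right_mono decay_nonneg) (simp add: add_pos_nonneg)
      also have "\<dots> = (1 + \<bar>x - y\<bar>) powr p * (1 / ?u\<^sup>2)"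
        by (simp add: decay_def power3_eq_cube power2_eq_square add_pos_nonneg)
      also have "\<dots> \<le> (1 + \<bar>x - y\<bar>) powr p * (4 * ?z (k - m))"
      proof (rule mult_left_mono)
        have "1 + \<bar>real_of_int (k - m)\<bar> \<le> 2 * ?u" using floor_correct[of x] unfolding m_def of_int_diff
          by (smt (verit) of_int_1 of_int_add)
        then have "(1 + \<bar>real_of_int (k - m)\<bar>)\<^sup>2 \<le> (2 * ?u)\<^sup>2" by (rule power_mono) auto
        then have "(1 + \<bar>real_of_int (k - m)\<bar>)\<^sup>2 \<le> 4 * ?u\<^sup>2" by (simp only: power_mult_distrib) simp
        then show "1 / ?u\<^sup>2 \<le> 4 * ?z (k - m)" by (simp add: field_simps add_pos_nonneg)
      qed simp
      finally show ?thesis by (simp add: mult_ac)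
    qed
    have bij: "bij_betw (\<lambda>k. k - m) UNIV UNIV"
      by (rule bij_betwI[where g = "\<lambda>k. k + m"]) auto
    have zs: "(\<lambda>k. ?z (k - m)) summable_on UNIV"
      using summable_on_reindex_bij_betw[OF bij, of ?z] summable_on_inverse_square_int by simp
    have zi: "infsum (\<lambda>k. ?z (k - m)) UNIV = Z"
      using infsum_reindex_bij_betw[OF bij, of ?z] by (simp add: Z_def)
    have gs: "?g summable_on UNIV" by (intro summable_on_cmult_right zs)
    show fs: "?f summable_on UNIV"
      by (rule summable_on_comparison_test[OF gs le]) (simp add: decay_nonneg)
    have "infsum ?f UNIV \<le> infsum ?g UNIV" by (rule infsum_mono[OF fs gs le])
    also have "\<dots> = 4 * (1 + \<bar>x - y\<bar>) powr p * Z"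
      unfolding zi[symmetric] by (rule infsum_cmult_right')
    also have "\<dots> = 4 * Z * (1 + \<bar>x - y\<bar>) powr p" by simp
    also have "\<dots> \<le> (4 * Z + 1) * (1 + \<bar>x - y\<bar>) powr p" by (intro mult_right_mono) auto
    finally show "infsum ?f UNIV \<le> (4 * Z + 1) * (1 + \<bar>x - y\<bar>) powr p" .
  qed
qed

definition dyadic :: "int \<Rightarrow> real" where "dyadic j = 2 powr real_of_int j"

lemma dyadic_pos [simp]: "0 < dyadic j" "0 \<le> dyadic j" "dyadic j \<noteq> 0"
  by (simp_all add: dyadic_def)

lemma dyadic_add: "dyadic (i + j) = dyadic i * dyadic j"
  by (simp add: dyadic_def powr_add)

lemma dyadic_powr: "dyadic j powr x = 2 powr (real_of_int j * x)"
  by (simp add: dyadic_def powr_powr)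

text \<open>For \<open>p < \<theta>\<close> the decay of \<open>Psi\<close> absorbs the growth away from \<open>t\<close>, and the last clause makes the
  level \<open>J\<close> with \<open>2 ^ J * \<bar>s - t\<bar>\<close> of order \<open>1\<close> dominate the increment between \<open>s\<close> and \<open>t\<close>.\<close>

definition local_bound :: "(int \<Rightarrow> int \<Rightarrow> real) \<Rightarrow> real \<Rightarrow> real \<Rightarrow> (int \<Rightarrow> real) \<Rightarrow> bool" where
  "local_bound e t p E \<longleftrightarrow>
     (\<forall>j k. \<bar>e j k\<bar> \<le> E j * (1 + \<bar>real_of_int k - dyadic j * t\<bar>) powr p) \<and> (\<forall>j. 0 \<le> E j) \<and>
     (\<forall>J\<ge>0. \<forall>i. E (J + i) \<le> E J * (1 + \<bar>real_of_int i\<bar>)\<^sup>2)"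

text \<open>Dominates, up to a constant, the terms of the series for an increment between t and s:
  smoothness gains 2^j |s - t| at coarse levels, and decay alone gives the value 1 at fine
  ones.\<close>

definition majorant :: "(int \<Rightarrow> int \<Rightarrow> real) \<Rightarrow> real \<Rightarrow> real \<Rightarrow> real \<Rightarrow> int \<times> int \<Rightarrow> real" where
  "majorant e \<theta> s t = (\<lambda>(j, k). dyadic j powr (- \<theta>) * \<bar>e j k\<bar> * min 1 \<bar>dyadic j * s - dyadic j * t\<bar> *
      (decay (dyadic j * s - real_of_int k) + decay (dyadic j * t - real_of_int k)))"

lemma majorant_nonneg: "0 \<le> majorant e \<theta> s t jk"
  by (auto simp: majorant_def decay_nonneg add_nonneg_nonneg split: prod.splits)

text \<open>To be used with d = 2^j |s - t|: coarse levels (d \<le> 1) contribute d, fine ones the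
  growth d^p of the coefficients between t and s.\<close>

lemma min_powr_le:
  fixes d p :: real
  assumes "0 \<le> d" "0 \<le> p" "p \<le> 1"
  shows "min 1 d * ((1 + d) powr p + 1) \<le> 4 * min d (d powr p)"
proof (cases "d \<le> 1")
  case True
  have "(1 + d) powr p \<le> (1 + d) powr 1" using assms by (intro powr_mono) auto
  then have "(1 + d) powr p + 1 \<le> 4" using True assms by simp
  moreover have "d \<le> d powr p" using True assms powr_mono'[of p 1 d] by (cases "d = 0") auto
  ultimately show ?thesis using True assms mult_left_mono[of "(1 + d) powr p + 1" 4 d] by simp
next
  case False
  have "(1 + d) powr p \<le> (2 * d) powr p" using assms False by (intro powr_mono2) auto
  also have "\<dots> = 2 powr p * d powr p" using assms by (simp add: powr_mult)
  also have "\<dots> \<le> 2 powr 1 * d powr p" using assms by (intro mult_right_mono powr_mono) auto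
  finally have 1: "(1 + d) powr p \<le> 2 * d powr p" by simp
  have 2: "1 \<le> d powr p" using False assms by (simp add: ge_one_powr_ge_zero)
  have 3: "d powr p \<le> d" using False assms powr_mono[of p 1 d] by simp
  show ?thesis using 1 2 3 False by simp
qed

text \<open>Fine levels sum because p < \<theta>, coarse ones because \<theta> < 1. The quadratic
  factor is the loss that \<open>local_bound\<close> allows when the reference level
  changes.\<close>

lemma level_weights_summable:
  fixes p \<theta> :: real
  assumes "0 \<le> p" "p < \<theta>" "\<theta> < 1"
  shows "(\<lambda>i. (1 + \<bar>real_of_int i\<bar>)\<^sup>2
    * (dyadic i powr (- \<theta>) * min (dyadic i) (dyadic i powr p))) summable_on UNIV"
proof -
  have pw: "q powr real n = q ^ n" if "q > 0" for q :: real and n using that by (rule powr_realpow)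
  show ?thesis
  proof (rule summable_on_int)
    have "summable (\<lambda>n. (1 + real n)\<^sup>2 * (2 powr (p - \<theta>)) ^ n)"
      by (rule summable_square_geometric) (use assms powr_less_mono[of "p - \<theta>" 0 2] in auto)
    moreover have "dyadic (int n) powr (- \<theta>) * min (dyadic (int n)) (dyadic (int n) powr p)
      \<le> (2 powr (p - \<theta>)) ^ n" for n
    proof -
      have "dyadic (int n) powr (- \<theta>) * min (dyadic (int n)) (dyadic (int n) powr p)
        \<le> dyadic (int n) powr (- \<theta>) * dyadic (int n) powr p"
        by (intro mult_left_mono) auto
      also have "\<dots> = (2 powr (p - \<theta>)) powr n"
        by (simp add: dyadic_def powr_powr algebra_simps flip: powr_add)
      finally show ?thesis by (simp add: pw)
    qed
    ultimately show "summable (\<lambda>n. (1 + \<bar>real_of_int (int n)\<bar>)\<^sup>2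
      * (dyadic (int n) powr (- \<theta>) * min (dyadic (int n)) (dyadic (int n) powr p)))"
      by (elim summable_comparison_test[rotated]) (auto intro!: exI[of _ 0] mult_left_mono)
    have "summable (\<lambda>n. (1 + real n)\<^sup>2 * (2 powr (\<theta> - 1)) ^ n)"
      by (rule summable_square_geometric) (use assms powr_less_mono[of "\<theta> - 1" 0 2] in auto)
    moreover have "dyadic (- int n) powr (- \<theta>) * min (dyadic (- int n)) (dyadic (- int n) powr p)
      \<le> (2 powr (\<theta> - 1)) ^ n" for n
    proof -
      have "dyadic (- int n) powr (- \<theta>) * min (dyadic (- int n)) (dyadic (- int n) powr p)
        \<le> dyadic (- int n) powr (- \<theta>) * dyadic (- int n) powr 1"
        by (intro mult_left_mono) auto
      also have "\<dots> = (2 powr (\<theta> - 1)) powr n"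
        by (simp add: dyadic_def powr_powr algebra_simps flip: powr_add)
      finally show ?thesis by (simp add: pw)
    qed
    ultimately show "summable (\<lambda>n. (1 + \<bar>real_of_int (- int n)\<bar>)\<^sup>2
      * (dyadic (- int n) powr (- \<theta>) * min (dyadic (- int n)) (dyadic (- int n) powr p)))"
      by (elim summable_comparison_test[rotated]) (auto intro!: exI[of _ 0] mult_left_mono)
  qed auto
qed

lemma majorant_sum:
  assumes p: "0 \<le> p" "p < \<theta>" "\<theta> < 1"
  shows "\<exists>C>0. \<forall>e E s t. local_bound e t p E \<longrightarrow> majorant e \<theta> s t summable_on UNIV \<and>
     infsum (majorant e \<theta> s t) UNIV \<le> C * E 0 * max 1 \<bar>s - t\<bar> \<and>
     (\<forall>J\<ge>0. dyadic J * \<bar>s - t\<bar> \<le> 1 \<longrightarrow> infsum (majorant e \<theta> s t) UNIV \<le> C * E J * dyadic J powr (- \<theta>))"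
proof -
  obtain C where C: "C > 0" "\<And>x y p. 0 \<le> p \<and> p \<le> 1 \<Longrightarrow>
     (\<lambda>k. (1 + \<bar>real_of_int k - y\<bar>) powr p * decay (x - real_of_int k)) summable_on UNIV"
     "\<And>x y p. 0 \<le> p \<and> p \<le> 1 \<Longrightarrow>
     infsum (\<lambda>k. (1 + \<bar>real_of_int k - y\<bar>) powr p * decay (x - real_of_int k)) UNIV \<le> C * (1 + \<bar>x -
       y\<bar>) powr p"
    using decay_lattice_sum by blast
  have p1: "0 \<le> p \<and> p \<le> 1" using p by auto
  let ?w = "\<lambda>i. (1 + \<bar>real_of_int i\<bar>)\<^sup>2 * (dyadic i powr (- \<theta>) * min (dyadic i) (dyadic i powr p))"
  define W where "W = infsum ?w UNIV"
  have w: "?w summable_on UNIV" by (rule level_weights_summable[OF p])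
  have W: "W \<ge> 0" unfolding W_def by (intro infsum_nonneg) auto
  \<comment> \<open>The slack m serves both conclusions: J = 0 with m =
    \<open>max 1 \<bar>s - t\<bar>\<close> for arbitrary s, and m = 1 at a level adapted to
    s.\<close>
  have main: "majorant e \<theta> s t summable_on UNIV
    \<and> infsum (majorant e \<theta> s t) UNIV \<le> 4 * C * (W + 1) * m * E J * dyadic J powr (- \<theta>)"
    if lb: "local_bound e t p E" and J: "J \<ge> 0" and m: "m \<ge> 1" "dyadic J * \<bar>s - t\<bar> \<le> m" for e E s t J m
  proof -
    let ?d = "\<lambda>j. \<bar>dyadic j * s - dyadic j * t\<bar>"
    have d: "?d j = dyadic j * \<bar>s - t\<bar>" for j by (simp add: abs_mult flip: right_diff_distrib)
    let ?g = "\<lambda>j. 4 * C * m * E J * dyadic J powr (- \<theta>) * ?w (j - J)"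
    have E: "E j \<ge> 0" for j using lb by (simp add: local_bound_def)
    let ?A = "\<lambda>j k. (1 + \<bar>real_of_int k - dyadic j * t\<bar>) powr p * decay (dyadic j * s - real_of_int k) +
       (1 + \<bar>real_of_int k - dyadic j * t\<bar>) powr p * decay (dyadic j * t - real_of_int k)"
    let ?c = "\<lambda>j. dyadic j powr (- \<theta>) * E j * min 1 (?d j)"
    have le: "majorant e \<theta> s t (j, k) \<le> ?c j * ?A j k" for j k
    proof -
      have "\<bar>e j k\<bar> \<le> E j * (1 + \<bar>real_of_int k - dyadic j * t\<bar>) powr p" using lb
        by (simp add: local_bound_def)
      then have "majorant e \<theta> s t (j, k) \<le> dyadic j powr (- \<theta>)
        * (E j * (1 + \<bar>real_of_int k - dyadic j * t\<bar>) powr p) * min 1 (?d j) *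
        (decay (dyadic j * s - real_of_int k) + decay (dyadic j * t - real_of_int k))"
        unfolding majorant_def prod.case
        by (intro mult_right_mono mult_left_mono) (auto simp: decay_nonneg add_nonneg_nonneg)
      then show ?thesis by (simp add: algebra_simps)
    qed
    have A: "(\<lambda>k. ?A j k) summable_on UNIV" for j by (intro summable_on_add C(2) p1)
    have cA: "(\<lambda>k. ?c j * ?A j k) summable_on UNIV" for j by (intro summable_on_cmult_right A)
    have c: "?c j \<ge> 0" for j using E by auto
    have s1: "(\<lambda>k. majorant e \<theta> s t (j, k)) summable_on UNIV" for j
      by (rule summable_on_comparison_test[OF cA[of j] le majorant_nonneg])
    have s2: "infsum (\<lambda>k. majorant e \<theta> s t (j, k)) UNIV \<le> ?g j" for j
    proof -
      have "infsum (\<lambda>k. majorant e \<theta> s t (j, k)) UNIV \<le> infsum (\<lambda>k. ?c j * ?A j k) UNIV"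
        by (rule infsum_mono[OF s1 cA le])
      also have "\<dots> = ?c j * infsum (\<lambda>k. ?A j k) UNIV" by (rule infsum_cmult_right')
      also have "\<dots> \<le> ?c j * (C * (1 + ?d j) powr p + C * (1 + \<bar>dyadic j * t - dyadic j * t\<bar>) powr p)"
      proof (rule mult_left_mono[OF _ c])
        show "infsum (\<lambda>k. ?A j k) UNIV
          \<le> C * (1 + ?d j) powr p + C * (1 + \<bar>dyadic j * t - dyadic j * t\<bar>) powr p"
          by (subst infsum_add) (intro C(2) p1 add_mono C(3))+
      qed
      also have "?c j * (C * (1 + ?d j) powr p + C * (1 + \<bar>dyadic j * t - dyadic j * t\<bar>) powr p)
        = C * (dyadic j powr (- \<theta>) * E j) * (min 1 (?d j) * ((1 + ?d j) powr p + 1))"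
        by (simp add: algebra_simps)
      also have "\<dots> \<le> C * (dyadic j powr (- \<theta>) * E j) * (4 * min (?d j) (?d j powr p))"
        using C E p1 by (intro mult_left_mono min_powr_le) auto
      also have "\<dots> \<le> C * (dyadic j powr (- \<theta>) * E j)
        * (4 * (m * min (dyadic (j - J)) (dyadic (j - J) powr p)))"
      proof (intro mult_left_mono)
        have dd: "?d j \<le> dyadic (j - J) * m"
        proof -
          have "?d j = dyadic (j - J) * (dyadic J * \<bar>s - t\<bar>)" unfolding d using dyadic_add[of "j - J" J]
            by simp
          then show ?thesis using m by (simp add: mult_left_mono)
        qed
        have "?d j powr p \<le> (dyadic (j - J) * m) powr p" using dd p1 by (intro powr_mono2) auto
        also have "\<dots> = dyadic (j - J) powr p * m powr p" by (rule powr_mult)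
        also have "\<dots> \<le> dyadic (j - J) powr p * m powr 1" using p1 m by (intro mult_left_mono powr_mono) auto
        finally have "?d j powr p \<le> m * dyadic (j - J) powr p" using m by (simp add: mult.commute)
        then have "min (?d j) (?d j powr p) \<le> min (m * dyadic (j - J)) (m * dyadic (j - J) powr p)"
          using dd by (intro min.mono) (simp_all add: mult.commute)
        then show "min (?d j) (?d j powr p) \<le> m * min (dyadic (j - J)) (dyadic (j - J) powr p)"
          using m by (simp add: min_mult_distrib_left)
      qed (use C E in auto)
      also have "C * (dyadic j powr (- \<theta>) * E j) * (4 * (m * min (dyadic (j - J)) (dyadic (j - J) powr p)))
          \<le> C * (dyadic j powr (- \<theta>) * (E J * (1 + \<bar>real_of_int (j - J)\<bar>)\<^sup>2)) * (4 *
            (m * min (dyadic (j - J)) (dyadic (j - J) powr p)))"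
      proof -
        have "\<forall>i. E (J + i) \<le> E J * (1 + \<bar>real_of_int i\<bar>)\<^sup>2" using lb J unfolding local_bound_def by blast
        from spec[OF this, of "j - J"] have "E j \<le> E J * (1 + \<bar>real_of_int (j - J)\<bar>)\<^sup>2" by simp
        then show ?thesis using C m by (intro mult_right_mono mult_left_mono) auto
      qed
      \<comment> \<open>Recentring the levels at J extracts
        \<open>dyadic J powr (- \<theta>)\<close> and leaves weights that depend on j - J
        only.\<close>
      also have "dyadic j powr (- \<theta>) = dyadic J powr (- \<theta>) * dyadic (j - J) powr (- \<theta>)"
        using dyadic_add[of J "j - J"] by (simp add: powr_mult)
      finally show ?thesis by (simp add: mult_ac)
    qed
    have bij: "bij_betw (\<lambda>k. k - J) UNIV UNIV"
      by (rule bij_betwI[where g = "\<lambda>k. k + J"]) auto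
    have ws: "(\<lambda>j. ?w (j - J)) summable_on UNIV"
      using summable_on_reindex_bij_betw[OF bij, of ?w] w by simp
    have wi: "infsum (\<lambda>j. ?w (j - J)) UNIV = W"
      using infsum_reindex_bij_betw[OF bij, of ?w] by (simp only: W_def)
    have g: "?g summable_on UNIV" by (intro summable_on_cmult_right ws)
    have "infsum ?g UNIV = 4 * C * m * E J * dyadic J powr (- \<theta>) * W"
      unfolding wi[symmetric] by (rule infsum_cmult_right')
    also have "\<dots> \<le> 4 * C * m * E J * dyadic J powr (- \<theta>) * (W + 1)"
      using C m E by (intro mult_left_mono) auto
    also have "\<dots> = 4 * C * (W + 1) * m * E J * dyadic J powr (- \<theta>)" by (simp only: mult_ac)
    finally have "infsum ?g UNIV \<le> 4 * C * (W + 1) * m * E J * dyadic J powr (- \<theta>)" .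
    then show ?thesis
      using double_summable_bound[of "majorant e \<theta> s t" ?g, OF majorant_nonneg s1 s2 g] by linarith
  qed
  show ?thesis
  proof (intro exI[of _ "4 * C * (W + 1)"] conjI allI impI)
    show "0 < 4 * C * (W + 1)" using C W by auto
    fix e E s t assume lb: "local_bound e t p E"
    have "dyadic 0 = 1" by (simp add: dyadic_def)
    then show "majorant e \<theta> s t summable_on UNIV"
      "infsum (majorant e \<theta> s t) UNIV \<le> 4 * C * (W + 1) * E 0 * max 1 \<bar>s - t\<bar>"
      using main[OF lb, of 0 "max 1 \<bar>s - t\<bar>" s] by (auto simp: mult_ac)
    fix J :: int assume "J \<ge> 0" "dyadic J * \<bar>s - t\<bar> \<le> 1"
    then show "infsum (majorant e \<theta> s t) UNIV \<le> 4 * C * (W + 1) * E J * dyadic J powr (- \<theta>)"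
      using main[OF lb, of J 1 s] by simp
  qed
qed

text \<open>The inverse square of this weight is summable over all pairs, so the square root of its
  logarithm is an almost sure growth rate for normal variables indexed by pairs. The shift by 2
  keeps the logarithm positive.\<close>

definition log_weight :: "int \<Rightarrow> int \<Rightarrow> real" where
  "log_weight j l = (2 + \<bar>real_of_int j\<bar>) * (2 + \<bar>real_of_int l\<bar>)"

definition growth :: "(int \<Rightarrow> int \<Rightarrow> real) \<Rightarrow> bool" where
  "growth e \<longleftrightarrow> (\<exists>C. \<forall>j k. \<bar>e j k\<bar> \<le> C * sqrt (ln (log_weight j k)))"

lemma infsum_diff:
  fixes f g :: "'a \<Rightarrow> real"
  assumes "f summable_on A" "g summable_on A"
  shows "infsum (\<lambda>x. f x - g x) A = infsum f A - infsum g A"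
proof -
  have "(\<lambda>x. - g x) summable_on A" using assms by (simp add: summable_on_uminus)
  from infsum_add[OF assms(1) this] show ?thesis by (simp add: infsum_uminus)
qed

text \<open>|k| \<le> 2^j |t| + |k - 2^j t|, so the logarithm of the weight grows linearly in |j|
  and only logarithmically in the distance from 2^j t, which a power absorbs.\<close>

lemma growth_local_bound:
  assumes e: "growth e" and p: "0 < p" "p \<le> 1"
  shows "\<exists>C>0. local_bound e t p (\<lambda>j. C * sqrt (1 + \<bar>real_of_int j\<bar>))"
proof -
  obtain C0 where C0: "\<And>j k. \<bar>e j k\<bar> \<le> C0 * sqrt (ln ((2 + \<bar>real_of_int j\<bar>) * (2 + \<bar>real_of_int k\<bar>)))"
    using e by (auto simp: growth_def log_weight_def)
  \<comment> \<open>1 / (2 p) comes from ln x \<le> x^q / q with q = 2 p; the later square root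
    halves the exponent.\<close>
  define K where "K = 3 + \<bar>t\<bar> + 1 / (2 * p)"
  have K: "K > 0" using p by (simp add: K_def add_pos_nonneg)
  define C where "C = (\<bar>C0\<bar> + 1) * sqrt K"
  have ln_le: "ln ((2 + \<bar>real_of_int j\<bar>) * (2 + \<bar>real_of_int k\<bar>)) \<le>
      K * (1 + \<bar>real_of_int j\<bar>) * (1 + \<bar>real_of_int k - dyadic j * t\<bar>) powr (2 * p)" for j k
  proof -
    let ?l = "\<bar>real_of_int k - dyadic j * t\<bar>" and ?j = "\<bar>real_of_int j\<bar>"
    have dj: "dyadic j \<le> 2 powr ?j" "1 \<le> 2 powr ?j"
      by (auto simp: dyadic_def ge_one_powr_ge_zero)
    have "2 + \<bar>real_of_int k\<bar> \<le> 2 + dyadic j * \<bar>t\<bar> + ?l"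
      using abs_triangle_ineq[of "real_of_int k - dyadic j * t" "dyadic j * t"] by (simp add: abs_mult)
    also have "\<dots> \<le> 2 powr ?j * 2 + 2 powr ?j * \<bar>t\<bar> + 2 powr ?j * ?l"
      using dj by (intro add_mono mult_right_mono) (auto simp: mult_le_cancel_right1)
    also have "\<dots> = 2 powr ?j * (2 + \<bar>t\<bar> + ?l)" by (simp add: algebra_simps)
    also have "\<dots> \<le> 2 powr ?j * ((2 + \<bar>t\<bar>) * (1 + ?l))"
      by (intro mult_left_mono) (auto simp: algebra_simps mult_nonneg_nonneg)
    finally have le: "2 + \<bar>real_of_int k\<bar> \<le> 2 powr ?j * ((2 + \<bar>t\<bar>) * (1 + ?l))" .
    have "ln ((2 + ?j) * (2 + \<bar>real_of_int k\<bar>)) = ln (2 + ?j) + ln (2 + \<bar>real_of_int k\<bar>)"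
      by (rule ln_mult_pos) auto
    also have "ln (2 + \<bar>real_of_int k\<bar>) \<le> ln (2 powr ?j * ((2 + \<bar>t\<bar>) * (1 + ?l)))"
      using le by (intro ln_mono) auto
    also have "\<dots> = ?j * ln 2 + (ln (2 + \<bar>t\<bar>) + ln (1 + ?l))"
      by (simp add: ln_mult_pos ln_powr add_pos_nonneg)
    also have "ln (2 + ?j) + (?j * ln 2 + (ln (2 + \<bar>t\<bar>) + ln (1 + ?l))) \<le>
      (1 + ?j) + (?j * 1 + ((1 + \<bar>t\<bar>) + (1 + ?l) powr (2 * p) / (2 * p)))"
    proof (intro add_mono mult_left_mono)
      show "ln (2 + ?j) \<le> 1 + ?j" using ln_le_minus_one[of "2 + ?j"] by simp
      show "ln (2 + \<bar>t\<bar>) \<le> 1 + \<bar>t\<bar>" using ln_le_minus_one[of "2 + \<bar>t\<bar>"] by simp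
      show "ln 2 \<le> (1::real)" using ln_le_minus_one[of "2::real"] by simp
      show "ln (1 + ?l) \<le> (1 + ?l) powr (2 * p) / (2 * p)" using p by (intro ln_powr_bound) auto
    qed auto
    also have "\<dots> \<le> K * (1 + ?j) * (1 + ?l) powr (2 * p)"
    proof -
      have P: "1 \<le> (1 + ?l) powr (2 * p)" using p by (intro ge_one_powr_ge_zero) auto
      have "(1 + ?j) + (?j * 1 + ((1 + \<bar>t\<bar>) + (1 + ?l) powr (2 * p) / (2 * p)))
        \<le> (3 + \<bar>t\<bar>) * (1 + ?j) * 1 + (1 / (2 * p)) * 1 * (1 + ?l) powr (2 * p)"
        by (simp add: algebra_simps)
      also have "\<dots> \<le> (3 + \<bar>t\<bar>) * (1 + ?j) * (1 + ?l) powr (2 * p) + (1 / (2 * p)) * (1 + ?j)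
        * (1 + ?l) powr (2 * p)"
        using P p by (intro add_mono mult_right_mono mult_left_mono) auto
      also have "\<dots> = K * (1 + ?j) * (1 + ?l) powr (2 * p)" by (simp add: K_def algebra_simps)
      finally show ?thesis .
    qed
    finally show ?thesis by linarith
  qed
  have b: "\<bar>e j k\<bar> \<le> C * sqrt (1 + \<bar>real_of_int j\<bar>) * (1 + \<bar>real_of_int k - dyadic j * t\<bar>) powr p" for j k
  proof -
    have "\<bar>e j k\<bar> \<le> (\<bar>C0\<bar> + 1) * sqrt (ln ((2 + \<bar>real_of_int j\<bar>) * (2 + \<bar>real_of_int k\<bar>)))"
    proof (rule order_trans[OF C0], rule mult_right_mono)
      have "1 \<le> (2 + \<bar>real_of_int j\<bar>) * (2 + \<bar>real_of_int k\<bar>)" by (simp add: algebra_simps add_nonneg_nonneg)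
      then show "0 \<le> sqrt (ln ((2 + \<bar>real_of_int j\<bar>) * (2 + \<bar>real_of_int k\<bar>)))" by simp
    qed simp
    also have "\<dots> \<le> (\<bar>C0\<bar> + 1)
      * sqrt (K * (1 + \<bar>real_of_int j\<bar>) * (1 + \<bar>real_of_int k - dyadic j * t\<bar>) powr (2 * p))"
      by (intro mult_left_mono real_sqrt_le_mono ln_le) auto
    also have "\<dots> = C * sqrt (1 + \<bar>real_of_int j\<bar>) * (1 + \<bar>real_of_int k - dyadic j * t\<bar>) powr p"
    proof -
      have "sqrt ((1 + \<bar>real_of_int k - dyadic j * t\<bar>) powr (2 * p))
        = (1 + \<bar>real_of_int k - dyadic j * t\<bar>) powr p"
        by (subst powr_half_sqrt[symmetric]) (auto simp: powr_powr)
      then show ?thesis by (simp add: C_def real_sqrt_mult)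
    qed
    finally show ?thesis .
  qed
  have Cpos: "C > 0" using K by (simp add: C_def add_nonneg_pos)
  have prof: "C * sqrt (1 + \<bar>real_of_int (J + i)\<bar>)
    \<le> C * sqrt (1 + \<bar>real_of_int J\<bar>) * (1 + \<bar>real_of_int i\<bar>)\<^sup>2" for i J
  proof -
    \<comment> \<open>The fourth power is there for its square root, the (1 + |i|)^2 of
      \<open>local_bound\<close>.\<close>
    have "sqrt (1 + \<bar>real_of_int (J + i)\<bar>) \<le> sqrt ((1 + \<bar>real_of_int J\<bar>) * (1 + \<bar>real_of_int i\<bar>)^4)"
    proof (intro real_sqrt_le_mono)
      have "1 + \<bar>real_of_int (J + i)\<bar> \<le> (1 + \<bar>real_of_int J\<bar>) * (1 + \<bar>real_of_int i\<bar>)"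
        by (simp add: algebra_simps) (smt (verit) mult_nonneg_nonneg)
      also have "\<dots> \<le> (1 + \<bar>real_of_int J\<bar>) * (1 + \<bar>real_of_int i\<bar>)^4"
        by (intro mult_left_mono self_le_power) auto
      finally show "1 + \<bar>real_of_int (J + i)\<bar> \<le> (1 + \<bar>real_of_int J\<bar>) * (1 + \<bar>real_of_int i\<bar>)^4" .
    qed
    also have "\<dots> = sqrt (1 + \<bar>real_of_int J\<bar>) * (1 + \<bar>real_of_int i\<bar>)\<^sup>2"
      by (simp add: real_sqrt_mult real_sqrt_power[symmetric]) (metis abs_ge_zero abs_power2
        add_nonneg_nonneg power2_eq_square power_even_eq real_sqrt_abs zero_le_one numeral_Bit0 mult_2)
    finally show ?thesis using Cpos by (simp add: mult.assoc)
  qed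
  show ?thesis
    unfolding local_bound_def
  proof (intro exI[of _ C] conjI allI impI Cpos b prof)
    show "0 \<le> C * sqrt (1 + \<bar>real_of_int j\<bar>)" for j using Cpos by auto
  qed
qed

section \<open>The wavelet series as a function of the coefficient array\<close>

context lemarie_meyer_wavelet
begin

definition incr :: "(int \<Rightarrow> int \<Rightarrow> real) \<Rightarrow> real \<Rightarrow> real \<Rightarrow> real \<Rightarrow> int \<times> int \<Rightarrow> real" where
  "incr e \<theta> s t = (\<lambda>(j, k). dyadic j powr (- \<theta>) * e j k *
     (Psi \<psi> (dyadic j * s - real_of_int k) \<theta> - Psi \<psi> (dyadic j * t - real_of_int k) \<theta>))"

text \<open>The field with the sample frozen: a one-point sample space turns
  \<open>mbm_generator\<close> into a deterministic function of the array e, so the analysis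
  contains no probability.\<close>

definition gen :: "(int \<Rightarrow> int \<Rightarrow> real) \<Rightarrow> real \<Rightarrow> real \<Rightarrow> real" where
  "gen e t \<theta> = mbm_generator \<psi> (\<lambda>j k _. e j k) () t \<theta>"

lemma gen_eq: "mbm_generator \<psi> \<epsilon> \<omega> t \<theta> = gen (\<lambda>j k. \<epsilon> j k \<omega>) t \<theta>"
  by (simp add: gen_def mbm_generator_def)

lemma gen_incr: "gen e t \<theta> = (\<Sum>\<^sub>\<infinity>j. \<Sum>\<^sub>\<infinity>k. incr e \<theta> t 0 (j, k))"
  by (simp add: gen_def mbm_generator_def incr_def dyadic_def powr_powr)

lemma incr_bound:
  "\<exists>K>0. \<forall>\<theta> e s t jk. 0 \<le> \<theta> \<and> \<theta> \<le> 1 \<longrightarrow> \<bar>incr e \<theta> s t jk\<bar> \<le> K * majorant e \<theta> s t jk"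
proof -
  obtain K where K: "K > 0" "\<And>\<theta> x y. 0 \<le> \<theta> \<and> \<theta> \<le> 1 \<and> 0 \<le> \<theta> \<and> \<theta> \<le> 1 \<Longrightarrow>
     \<bar>Psi \<psi> x \<theta> - Psi \<psi> y \<theta>\<bar> \<le> K * min 1 \<bar>x - y\<bar> * (decay x + decay y)"
    using Psi_increments by blast
  show ?thesis
  proof (intro exI[of _ K] conjI K(1) allI impI)
    fix \<theta> :: real and e s t and jk :: "int \<times> int" assume \<theta>: "0 \<le> \<theta> \<and> \<theta> \<le> 1"
    obtain j k where jk: "jk = (j, k)" by (cases jk)
    let ?x = "dyadic j * s - real_of_int k" and ?y = "dyadic j * t - real_of_int k"
    have "\<bar>incr e \<theta> s t jk\<bar> = dyadic j powr (- \<theta>) * \<bar>e j k\<bar> * \<bar>Psi \<psi> ?x \<theta> - Psi \<psi> ?y \<theta>\<bar>"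
      by (simp add: incr_def jk abs_mult)
    also have "\<dots> \<le> dyadic j powr (- \<theta>) * \<bar>e j k\<bar> * (K * min 1 \<bar>?x - ?y\<bar> * (decay ?x + decay ?y))"
      using \<theta> by (intro mult_left_mono K(2)) auto
    also have "\<dots> = K * majorant e \<theta> s t jk" by (simp add: majorant_def jk mult_ac)
    finally show "\<bar>incr e \<theta> s t jk\<bar> \<le> K * majorant e \<theta> s t jk" .
  qed
qed

lemma incr_summable:
  assumes "majorant e \<theta> s t summable_on UNIV" "0 \<le> \<theta>" "\<theta> \<le> 1"
  shows "incr e \<theta> s t summable_on UNIV"
proof -
  obtain K where "\<And>jk. \<bar>incr e \<theta> s t jk\<bar> \<le> K * majorant e \<theta> s t jk" using incr_bound assms by blast
  then have "(\<lambda>jk. norm (incr e \<theta> s t jk)) summable_on UNIV"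
    using Infinite_Sum.abs_summable_on_comparison_test'[OF summable_on_cmult_right[OF assms(1)], of
      "incr e \<theta> s t" K] by simp
  then show ?thesis by (rule Infinite_Sum.abs_summable_summable)
qed

text \<open>Absolute summability over pairs merges the iterated sums of the definition into one
  unordered sum.\<close>

lemma gen_infsum:
  assumes "growth e" "0 < \<theta>" "\<theta> < 1"
  shows "incr e \<theta> t 0 summable_on UNIV" "gen e t \<theta> = infsum (incr e \<theta> t 0) UNIV"
proof -
  obtain E where "local_bound e 0 (\<theta> / 2) E"
    using growth_local_bound[OF assms(1), of "\<theta> / 2" 0] assms by auto
  then show s: "incr e \<theta> t 0 summable_on UNIV"
    using majorant_sum[of "\<theta> / 2" \<theta>] assms by (intro incr_summable) auto
  show "gen e t \<theta> = infsum (incr e \<theta> t 0) UNIV"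
    unfolding gen_incr using infsum_Sigma_banach[of "incr e \<theta> t 0" UNIV "\<lambda>_. UNIV"] s by simp
qed

lemma gen_diff:
  assumes "growth e" "0 < \<theta>" "\<theta> < 1"
  shows "gen e s \<theta> - gen e t \<theta> = infsum (incr e \<theta> s t) UNIV"
proof -
  have "gen e s \<theta> - gen e t \<theta> = infsum (\<lambda>jk. incr e \<theta> s 0 jk - incr e \<theta> t 0 jk) UNIV"
    unfolding gen_infsum(2)[OF assms] by (rule infsum_diff[symmetric]) (intro gen_infsum(1) assms)+
  also have "(\<lambda>jk. incr e \<theta> s 0 jk - incr e \<theta> t 0 jk) = incr e \<theta> s t"
    by (auto simp: incr_def fun_eq_iff algebra_simps)
  finally show ?thesis .
qed

lemma gen_increment_bound:
  assumes e: "growth e" and \<theta>: "0 \<le> p" "p < \<theta>" "\<theta> < 1" and lb: "local_bound e t p E"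
  shows "\<exists>C>0. (\<forall>s. \<bar>gen e s \<theta> - gen e t \<theta>\<bar> \<le> C * E 0 * max 1 \<bar>s - t\<bar>) \<and>
     (\<forall>s. \<forall>J\<ge>0. dyadic J * \<bar>s - t\<bar> \<le> 1 \<longrightarrow> \<bar>gen e s \<theta> - gen e t \<theta>\<bar> \<le> C * E J * dyadic J powr (- \<theta>))"
proof -
  obtain C where C: "C > 0" "\<And>s. majorant e \<theta> s t summable_on UNIV"
     "\<And>s. infsum (majorant e \<theta> s t) UNIV \<le> C * E 0 * max 1 \<bar>s - t\<bar>"
     "\<And>s J. J\<ge>0 \<Longrightarrow> dyadic J * \<bar>s - t\<bar> \<le> 1 \<Longrightarrow> infsum (majorant e \<theta> s t) UNIV \<le> C * E J * dyadic J powr (- \<theta>)"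
    using majorant_sum[OF \<theta>] lb by blast
  obtain K where K: "K > 0" "\<And>s jk. \<bar>incr e \<theta> s t jk\<bar> \<le> K * majorant e \<theta> s t jk"
    using incr_bound \<theta> by (metis less_le order_trans)
  have le: "\<bar>gen e s \<theta> - gen e t \<theta>\<bar> \<le> K * infsum (majorant e \<theta> s t) UNIV" for s
  proof -
    have Ks: "(\<lambda>jk. K * majorant e \<theta> s t jk) summable_on UNIV" by (intro summable_on_cmult_right C)
    have a: "(\<lambda>jk. norm (incr e \<theta> s t jk)) summable_on UNIV"
      using Infinite_Sum.abs_summable_on_comparison_test'[OF Ks, of "incr e \<theta> s t"] K by simp
    have "\<bar>gen e s \<theta> - gen e t \<theta>\<bar> = norm (infsum (incr e \<theta> s t) UNIV)"
      using gen_diff[OF e] \<theta> by simp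
    also have "\<dots> \<le> infsum (\<lambda>jk. norm (incr e \<theta> s t jk)) UNIV" by (rule Infinite_Sum.norm_infsum_bound[OF a])
    also have "\<dots> \<le> infsum (\<lambda>jk. K * majorant e \<theta> s t jk) UNIV"
      using infsum_mono[OF a Ks] K by simp
    also have "\<dots> = K * infsum (majorant e \<theta> s t) UNIV" by (rule infsum_cmult_right')
    finally show ?thesis .
  qed
  show ?thesis
  proof (intro exI[of _ "K * C"] conjI allI impI)
    show "K * C > 0" using K C by auto
    show "\<bar>gen e s \<theta> - gen e t \<theta>\<bar> \<le> K * C * E 0 * max 1 \<bar>s - t\<bar>" for s
      using order_trans[OF le mult_left_mono[OF C(3)]] K by (simp add: mult_ac)
    show "\<bar>gen e s \<theta> - gen e t \<theta>\<bar> \<le> K * C * E J * dyadic J powr (- \<theta>)" if "J \<ge> 0" "dyadic J * \<bar>s - t\<bar> \<le> 1"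
      for s J
      using order_trans[OF le mult_left_mono[OF C(4)[OF that]]] K by (simp add: mult_ac)
  qed
qed

end

section \<open>Lipschitz dependence on the exponent\<close>

lemma dyadic_powr_Lipschitz:
  assumes "a \<le> \<theta>" "\<theta> \<le> b" "a \<le> \<theta>'" "\<theta>' \<le> b"
  shows "\<bar>dyadic j powr (- \<theta>) - dyadic j powr (- \<theta>')\<bar> \<le>
     (dyadic j powr (- a) + dyadic j powr (- b)) * (\<bar>real_of_int j\<bar> * \<bar>\<theta> - \<theta>'\<bar>)"
    "dyadic j powr (- \<theta>) \<le> dyadic j powr (- a) + dyadic j powr (- b)"
proof -
  let ?x = "real_of_int j * ln 2"
  \<comment> \<open>The exponent -u j ln 2 is linear in u, so its maximum over [a, b] is at an
    endpoint; the sum of the two endpoint exponentials covers both signs of j.\<close>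
  define L where "L = max (- a * ?x) (- b * ?x)"
  have P: "dyadic j powr (- u) = exp (- u * ?x)" for u
    unfolding dyadic_powr by (simp add: powr_def algebra_simps)
  have le: "- u * ?x \<le> L" if "a \<le> u" "u \<le> b" for u
  proof (cases "?x \<ge> 0")
    case True
    then have "a * ?x \<le> u * ?x" using that by (intro mult_right_mono) auto
    then show ?thesis by (simp add: L_def)
  next
    case False
    then have "b * ?x \<le> u * ?x" using that by (intro mult_right_mono_neg) auto
    then show ?thesis by (simp add: L_def)
  qed
  have eL: "exp L \<le> dyadic j powr (- a) + dyadic j powr (- b)"
    unfolding P L_def by (simp add: max_def)
  show "dyadic j powr (- \<theta>) \<le> dyadic j powr (- a) + dyadic j powr (- b)"
    using le[OF assms(1,2)] eL P[of \<theta>] by (smt (verit) exp_le_cancel_iff)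
  have "\<bar>exp (- \<theta> * ?x) - exp (- \<theta>' * ?x)\<bar> \<le> exp L * \<bar>- \<theta> * ?x - - \<theta>' * ?x\<bar>"
    by (intro abs_exp_diff_le le assms)
  also have "\<bar>- \<theta> * ?x - - \<theta>' * ?x\<bar> = \<bar>\<theta> - \<theta>'\<bar> * (\<bar>real_of_int j\<bar> * ln 2)"
  proof -
    have "- \<theta> * ?x - - \<theta>' * ?x = - ((\<theta> - \<theta>') * (real_of_int j * ln 2))" by (simp add: algebra_simps)
    then show ?thesis by (simp only: abs_minus_cancel abs_mult) simp
  qed
  also have "exp L * (\<bar>\<theta> - \<theta>'\<bar> * (\<bar>real_of_int j\<bar> * ln 2))
    \<le> (dyadic j powr (- a) + dyadic j powr (- b)) * (\<bar>\<theta> - \<theta>'\<bar> * (\<bar>real_of_int j\<bar> * 1))"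
    using eL ln_le_minus_one[of "2::real"] by (intro mult_mono) auto
  finally show "\<bar>dyadic j powr (- \<theta>) - dyadic j powr (- \<theta>')\<bar> \<le>
     (dyadic j powr (- a) + dyadic j powr (- b)) * (\<bar>real_of_int j\<bar> * \<bar>\<theta> - \<theta>'\<bar>)"
    unfolding P by (simp add: mult_ac)
qed

context lemarie_meyer_wavelet
begin

text \<open>Varying \<theta> in 2^(-j \<theta>) costs a factor |j|. It is moved into the
  coefficients: the array e' still satisfies a local bound around 0, and its majorants at the
  exponents a and b dominate the difference.\<close>

lemma gen_Lipschitz:
  assumes e: "growth e" and ab: "0 < a" "a \<le> b" "b < 1"
  shows "\<exists>C>0. \<forall>s \<theta> \<theta>'. a \<le> \<theta> \<and> \<theta> \<le> b \<and> a \<le> \<theta>' \<and> \<theta>' \<le> b \<longrightarrow>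
     \<bar>gen e s \<theta> - gen e s \<theta>'\<bar> \<le> C * max 1 \<bar>s\<bar> * \<bar>\<theta> - \<theta>'\<bar>"
proof -
  obtain K where K: "K > 0" "\<And>\<theta> \<theta>' x y. 0 \<le> \<theta> \<and> \<theta> \<le> 1 \<and> 0 \<le> \<theta>' \<and> \<theta>' \<le> 1 \<Longrightarrow>
     \<bar>Psi \<psi> x \<theta> - Psi \<psi> y \<theta>\<bar> \<le> K * min 1 \<bar>x - y\<bar> * (decay x + decay y) \<and>
     \<bar>(Psi \<psi> x \<theta> - Psi \<psi> y \<theta>) - (Psi \<psi> x \<theta>' - Psi \<psi> y \<theta>')\<bar> \<le> K * \<bar>\<theta> - \<theta>'\<bar> * min 1 \<bar>x - y\<bar> * (decay x + decay
       y)"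
    using Psi_increments by blast
  define p where "p = a / 2"
  have p: "0 \<le> p" "p < a" "0 < p" "p \<le> 1" using ab by (auto simp: p_def)
  obtain D where D: "D > 0" "local_bound e 0 p (\<lambda>j. D * sqrt (1 + \<bar>real_of_int j\<bar>))"
    using growth_local_bound[OF e p(3,4)] by blast
  define e' where "e' j k = (1 + \<bar>real_of_int j\<bar>) * e j k" for j k
  \<comment> \<open>The power 3/2 of 1 + |j| stays below the power 2 that \<open>local_bound\<close>
    allows.\<close>
  define E' where "E' j = (1 + \<bar>real_of_int j\<bar>) * (D * sqrt (1 + \<bar>real_of_int j\<bar>))" for j :: int
  have lb: "local_bound e' 0 p E'"
    unfolding local_bound_def
  proof (intro conjI allI impI)
    fix j k
    show "\<bar>e' j k\<bar> \<le> E' j * (1 + \<bar>real_of_int k - dyadic j * 0\<bar>) powr p"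
      using D(2) unfolding local_bound_def e'_def E'_def abs_mult mult.assoc
      by (intro mult_mono) (auto simp: mult.assoc)
    show "0 \<le> E' j" using D by (auto simp: E'_def)
  next
    fix J i :: int
    have "(1 + \<bar>real_of_int (J + i)\<bar>) \<le> (1 + \<bar>real_of_int J\<bar>) * (1 + \<bar>real_of_int i\<bar>)"
      by (simp add: algebra_simps) (smt (verit) mult_nonneg_nonneg)
    then have "(1 + \<bar>real_of_int (J + i)\<bar>) * sqrt (1 + \<bar>real_of_int (J + i)\<bar>) \<le>
       ((1 + \<bar>real_of_int J\<bar>) * (1 + \<bar>real_of_int i\<bar>)) * sqrt ((1 + \<bar>real_of_int J\<bar>) * (1 + \<bar>real_of_int i\<bar>))"
      by (intro mult_mono real_sqrt_le_mono) auto
    also have "\<dots> = (1 + \<bar>real_of_int J\<bar>) * sqrt (1 + \<bar>real_of_int J\<bar>)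
      * ((1 + \<bar>real_of_int i\<bar>) * sqrt (1 + \<bar>real_of_int i\<bar>))"
      by (simp add: real_sqrt_mult)
    also have "\<dots> \<le> (1 + \<bar>real_of_int J\<bar>) * sqrt (1 + \<bar>real_of_int J\<bar>)
      * ((1 + \<bar>real_of_int i\<bar>) * (1 + \<bar>real_of_int i\<bar>))"
      by (intro mult_left_mono) (auto intro!: real_le_lsqrt simp: power2_eq_square algebra_simps)
    finally show "E' (J + i) \<le> E' J * (1 + \<bar>real_of_int i\<bar>)\<^sup>2"
      using D(1) by (simp add: E'_def power2_eq_square mult_ac)
  qed
  obtain Ca where Ca: "Ca > 0" "\<And>s. majorant e' a s 0 summable_on UNIV"
     "\<And>s. infsum (majorant e' a s 0) UNIV \<le> Ca * E' 0 * max 1 \<bar>s - 0\<bar>"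
    using majorant_sum[of p a] lb p ab by fastforce
  obtain Cb where Cb: "Cb > 0" "\<And>s. majorant e' b s 0 summable_on UNIV"
     "\<And>s. infsum (majorant e' b s 0) UNIV \<le> Cb * E' 0 * max 1 \<bar>s - 0\<bar>"
    using majorant_sum[of p b] lb p ab by fastforce
  have main: "\<bar>gen e s \<theta> - gen e s \<theta>'\<bar> \<le> K * ((Ca + Cb) * E' 0) * max 1 \<bar>s\<bar> * \<bar>\<theta> - \<theta>'\<bar>"
    if t: "a \<le> \<theta>" "\<theta> \<le> b" "a \<le> \<theta>'" "\<theta>' \<le> b" for s \<theta> \<theta>'
  proof -
    let ?f = "\<lambda>jk. incr e \<theta> s 0 jk - incr e \<theta>' s 0 jk"
    let ?g = "\<lambda>jk. K * \<bar>\<theta> - \<theta>'\<bar> * (majorant e' a s 0 jk + majorant e' b s 0 jk)"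
    have le: "\<bar>?f (j, k)\<bar> \<le> ?g (j, k)" for j k
    proof -
      define x where "x = dyadic j * s - real_of_int k"
      define y where "y = dyadic j * 0 - real_of_int k"
      let ?u = "\<lambda>\<theta>. dyadic j powr (- \<theta>)" and ?P = "\<lambda>\<theta>. Psi \<psi> x \<theta> - Psi \<psi> y \<theta>"
      let ?M = "min 1 \<bar>x - y\<bar> * (decay x + decay y)"
      have M: "0 \<le> ?M" using decay_nonneg by (auto intro!: mult_nonneg_nonneg add_nonneg_nonneg)
      have k1: "\<bar>?P \<theta> - ?P \<theta>'\<bar> \<le> K * \<bar>\<theta> - \<theta>'\<bar> * ?M" and k2: "\<bar>?P \<theta>'\<bar> \<le> K * ?M"
        using K(2)[of \<theta> \<theta>' x y] K(2)[of \<theta>' \<theta>' x y] t ab by (auto simp: mult.assoc)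
      have "\<bar>?u \<theta> * ?P \<theta> - ?u \<theta>' * ?P \<theta>'\<bar> = \<bar>?u \<theta> * (?P \<theta> - ?P \<theta>') + (?u \<theta> - ?u \<theta>') * ?P \<theta>'\<bar>"
        by (simp add: algebra_simps)
      also have "\<dots> \<le> ?u \<theta> * \<bar>?P \<theta> - ?P \<theta>'\<bar> + \<bar>?u \<theta> - ?u \<theta>'\<bar> * \<bar>?P \<theta>'\<bar>"
        by (rule order_trans[OF abs_triangle_ineq]) (simp add: abs_mult)
      also have "\<dots> \<le> (?u a + ?u b) * (K * \<bar>\<theta> - \<theta>'\<bar> * ?M) + ((?u a + ?u b) * (\<bar>real_of_int j\<bar> * \<bar>\<theta> - \<theta>'\<bar>))
        * (K * ?M)"
        by (intro add_mono mult_mono dyadic_powr_Lipschitz t k1 k2) (use t in auto)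
      also have "\<dots> = K * \<bar>\<theta> - \<theta>'\<bar> * ((?u a + ?u b) * (1 + \<bar>real_of_int j\<bar>) * ?M)" by (simp add: algebra_simps)
      finally have "\<bar>e j k\<bar> * \<bar>?u \<theta> * ?P \<theta> - ?u \<theta>' * ?P \<theta>'\<bar>
        \<le> \<bar>e j k\<bar> * (K * \<bar>\<theta> - \<theta>'\<bar> * ((?u a + ?u b) * (1 + \<bar>real_of_int j\<bar>) * ?M))"
        by (rule mult_left_mono) simp
      moreover have "\<bar>?f (j, k)\<bar> = \<bar>e j k\<bar> * \<bar>?u \<theta> * ?P \<theta> - ?u \<theta>' * ?P \<theta>'\<bar>"
        unfolding abs_mult[symmetric] by (simp add: incr_def x_def y_def algebra_simps)
      moreover have "?g (j, k) = \<bar>e j k\<bar> * (K * \<bar>\<theta> - \<theta>'\<bar> * ((?u a + ?u b) * (1 + \<bar>real_of_int j\<bar>) * ?M))"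
      proof -
        have "\<bar>e' j k\<bar> = (1 + \<bar>real_of_int j\<bar>) * \<bar>e j k\<bar>" by (simp add: e'_def abs_mult)
        then show ?thesis unfolding majorant_def x_def y_def by (simp add: algebra_simps)
      qed
      ultimately show ?thesis by linarith
    qed
    have g: "?g summable_on UNIV" by (intro summable_on_cmult_right summable_on_add Ca Cb)
    have s: "incr e \<theta> s 0 summable_on UNIV" "incr e \<theta>' s 0 summable_on UNIV"
      by (intro gen_infsum(1) e; use t ab in linarith)+
    have a: "(\<lambda>jk. norm (?f jk)) summable_on UNIV"
      by (rule Infinite_Sum.abs_summable_on_comparison_test'[OF g]) (use le in auto)
    have "gen e s \<theta> - gen e s \<theta>' = infsum ?f UNIV"
      using gen_infsum(2)[OF e, of \<theta> s] gen_infsum(2)[OF e, of \<theta>' s] infsum_diff[OF s] t ab by simp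
    then have "\<bar>gen e s \<theta> - gen e s \<theta>'\<bar> \<le> infsum (\<lambda>jk. norm (?f jk)) UNIV"
      using norm_infsum_bound[OF a] by simp
    also have "\<dots> \<le> infsum ?g UNIV" by (rule infsum_mono[OF a g]) (use le in auto)
    also have "\<dots> = K * \<bar>\<theta> - \<theta>'\<bar> * (infsum (majorant e' a s 0) UNIV + infsum (majorant e' b s 0) UNIV)"
      by (subst infsum_cmult_right', subst infsum_add[OF Ca(2) Cb(2)]) simp
    also have "\<dots> \<le> K * \<bar>\<theta> - \<theta>'\<bar> * (Ca * E' 0 * max 1 \<bar>s - 0\<bar> + Cb * E' 0 * max 1 \<bar>s - 0\<bar>)"
      using K by (intro mult_left_mono add_mono Ca Cb) auto
    also have "\<dots> = K * ((Ca + Cb) * E' 0) * max 1 \<bar>s\<bar> * \<bar>\<theta> - \<theta>'\<bar>" by (simp add: algebra_simps)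
    finally show ?thesis .
  qed
  have "0 < K * ((Ca + Cb) * E' 0)" using K Ca Cb D by (simp add: E'_def)
  with main show ?thesis by blast
qed

end

subsection \<open>Recovering the coefficients\<close>

text \<open>\<open>g j\<close> is the size of the gauge \<open>G\<close> at distance \<open>2\<close> to the power \<open>-j\<close>; the negative power of \<open>u\<close>
  absorbs the logarithmic growth of \<open>G\<close> at \<open>0\<close> and cancels against \<open>u powr \<theta>\<close>.\<close>

definition gauge_levels :: "real \<Rightarrow> (real \<Rightarrow> real) \<Rightarrow> (nat \<Rightarrow> real) \<Rightarrow> bool" where
  "gauge_levels \<theta> G g \<longleftrightarrow> (\<exists>K>0. \<exists>\<delta>>0. \<exists>n. \<forall>j\<ge>n. 1 \<le> g j \<and>
     (\<forall>u>0. u < 2 ^ j * \<delta> \<longrightarrow> G (u / 2 ^ j) \<le> K * g j * (1 + u powr (- \<theta>))))"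

context lemarie_meyer_wavelet
begin

lemma Psi_bounded:
  assumes "0 \<le> \<theta>" "\<theta> \<le> 1"
  shows "\<exists>B. \<forall>x. \<bar>Psi \<psi> x \<theta>\<bar> \<le> B"
proof -
  obtain C where C: "C > 0" "\<And>s (s'::real) e x. \<bar>s\<bar> \<le> 3 \<and> \<bar>s'\<bar> \<le> 3 \<Longrightarrow> norm (T s e x) \<le> C * decay x"
    using T_bounds by metis
  have "norm (T (- (\<theta> + 1 / 2)) 0 x) \<le> C * 1" for x
  proof (rule order_trans[OF C(2)[of _ 0]])
    show "C * decay x \<le> C * 1" using C(1) by (intro mult_left_mono) (auto simp: decay_def)
  qed (use assms in auto)
  then show ?thesis
    unfolding Psi_eq by (intro exI[of _ C] allI order_trans[OF abs_Re_le_cmod]) simp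
qed

text \<open>The series of the increment is integrated term by term: biorthogonality leaves only the
  term (j, k), and the zero integral of the dual removes the values at t. Dominated convergence
  rests on linear growth of the increment against an integrable first moment of the dual.\<close>

lemma coefficient_integral:
  assumes e: "growth e" and \<theta>: "0 < \<theta>" "\<theta> < 1"
  defines "f \<equiv> \<lambda>j t u. gen e (t + u / dyadic j) \<theta> - gen e t \<theta>"
  shows "(LINT u|lborel. f j t u * dual \<theta> (u + (dyadic j * t - real_of_int k)))
    = 2 * pi * dyadic j powr (- \<theta>) * e j k"
proof -
  define v where "v = dyadic j * t - real_of_int k"
  \<comment> \<open>In the variable s = t + u / 2^j, q is the dual wavelet of index (j, k).\<close>
  define q where "q u = dual \<theta> (u + v)" for u
  define C where "C = 2 * pi * dyadic j powr (- \<theta>) * e j k"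
  obtain D where D: "D > 0" "\<And>x. \<bar>dual \<theta> x\<bar> \<le> D * decay x" using dual_decay \<theta> by (meson less_imp_le)
  obtain B where B: "\<And>x. \<bar>Psi \<psi> x \<theta>\<bar> \<le> B" using Psi_bounded \<theta> by (meson less_imp_le)
  obtain K where K: "K > 0" "\<And>s jk. \<bar>incr e \<theta> s t jk\<bar> \<le> K * majorant e \<theta> s t jk"
    using incr_bound \<theta> by (meson less_imp_le)
  obtain E where E: "local_bound e t (\<theta> / 2) E"
    using growth_local_bound[OF e, of "\<theta> / 2" t] \<theta> by auto
  obtain A where A: "A > 0" "\<And>s. majorant e \<theta> s t summable_on UNIV"
     "\<And>s. infsum (majorant e \<theta> s t) UNIV \<le> A * E 0 * max 1 \<bar>s - t\<bar>"
    using majorant_sum[of "\<theta> / 2" \<theta>] E \<theta> by fastforce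
  have [measurable]: "dual \<theta> \<in> borel_measurable borel" "(\<lambda>x. Psi \<psi> x \<theta>) \<in> borel_measurable borel"
    by (rule dual_measurable Psi_measurable)+
  have qm [measurable]: "q \<in> borel_measurable borel" unfolding q_def by measurable
  have q_int: "integrable lborel q"
  proof -
    have i: "integrable lborel (\<lambda>u. D * decay (v + 1 * u))"
      by (intro integrable_mult_right lborel_integrable_real_affine decay_integrable) simp
    show ?thesis
      by (rule Bochner_Integration.integrable_bound[OF i])
         (use D in \<open>auto simp: q_def add.commute intro!: order_trans[OF D(2)] order_trans[OF _ abs_ge_self]\<close>)
  qed
  have q0: "(LINT u|lborel. q u) = 0"
    using lborel_integral_real_affine[of 1 "dual \<theta>" v] dual_integral[of \<theta>] \<theta> by (simp add: q_def add.commute)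
  have qw: "\<bar>u\<bar> * \<bar>q u\<bar> \<le> (\<bar>u + v\<bar> + \<bar>v\<bar>) * (D * decay (v + 1 * u))" for u
    using D(2)[of "u + v"] by (intro mult_mono) (auto simp: q_def add.commute)
  have qi2: "integrable lborel (\<lambda>u. \<bar>u\<bar> * \<bar>q u\<bar>)"
  proof (rule Bochner_Integration.integrable_bound)
    show "integrable lborel (\<lambda>u. D * (\<bar>v + 1 * u\<bar> * decay (v + 1 * u)) + \<bar>v\<bar> * D * decay (v + 1 * u))"
      using lborel_integrable_real_affine[OF decay_integrable(2), of 1 v] lborel_integrable_real_affine[OF
        decay_integrable(1), of 1 v]
      by (intro Bochner_Integration.integrable_add integrable_mult_right) auto
    show "AE u in lborel. norm (\<bar>u\<bar> * \<bar>q u\<bar>)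
      \<le> norm (D * (\<bar>v + 1 * u\<bar> * decay (v + 1 * u)) + \<bar>v\<bar> * D * decay (v + 1 * u))"
    proof (intro AE_I2)
      fix u
      have "\<bar>u\<bar> * \<bar>q u\<bar> \<le> D * (\<bar>v + 1 * u\<bar> * decay (v + 1 * u)) + \<bar>v\<bar> * D * decay (v + 1 * u)"
        using qw[of u] by (simp add: algebra_simps)
      then show "norm (\<bar>u\<bar> * \<bar>q u\<bar>)
        \<le> norm (D * (\<bar>v + 1 * u\<bar> * decay (v + 1 * u)) + \<bar>v\<bar> * D * decay (v + 1 * u))"
        unfolding real_norm_def abs_mult[of "\<bar>u\<bar>"] abs_abs by (rule order_trans[OF _ abs_ge_self])
    qed
  qed simp
  have Pi: "integrable lborel (\<lambda>u. Psi \<psi> (dyadic j' * (t + u / dyadic j) - real_of_int k') \<theta> * q u)" for j' k'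
    by (rule Bochner_Integration.integrable_bound[OF integrable_mult_right[OF q_int, of B]])
       (use B in \<open>auto simp: abs_mult intro!: mult_right_mono order_trans[OF B abs_ge_self]\<close>)
  have pair: "(LINT u|lborel. Psi \<psi> (dyadic j' * (t + u / dyadic j) - real_of_int k') \<theta> * q u)
    = (if j' = j \<and> k' = k then 2 * pi else 0)" for j' k'
  proof -
    have "(LINT s|lborel. Psi \<psi> (dyadic j' * s - real_of_int k') \<theta> * dual \<theta> (dyadic j * s - real_of_int k)) =
      \<bar>1 / dyadic j\<bar> *\<^sub>R (LINT u|lborel. Psi \<psi> (dyadic j' * (t + (1 / dyadic j) * u) - real_of_int k') \<theta> *
        dual \<theta> (dyadic j * (t + (1 / dyadic j) * u) - real_of_int k))"
      by (rule lborel_integral_real_affine) simp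
    moreover have "dyadic j * (t + (1 / dyadic j) * u) - real_of_int k = u + v" for u
      by (simp add: v_def field_simps)
    ultimately have "(LINT u|lborel. Psi \<psi> (dyadic j' * (t + u / dyadic j) - real_of_int k') \<theta> * q u) =
      dyadic j * (LINT s|lborel. Psi \<psi> (dyadic j' * s - real_of_int k') \<theta> * dual \<theta>
        (dyadic j * s - real_of_int k))"
      by (simp add: q_def)
    also have "\<dots> = dyadic j * (if j' = j \<and> k' = k then 2 * pi / dyadic j else 0)"
      using dual_pairing[of \<theta> j' k' j k] \<theta> by (simp only: dyadic_def less_imp_le)
    also have "\<dots> = (if j' = j \<and> k' = k then 2 * pi else 0)" by simp
    finally show ?thesis .
  qed
  \<comment> \<open>An enumeration of the pairs turns the unordered sum into a sequence of partial
    sums, as dominated convergence requires.\<close>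
  define \<phi> where "\<phi> = from_nat_into (UNIV :: (int \<times> int) set)"
  have inf: "infinite (UNIV :: (int \<times> int) set)" by (metis finite_prod infinite_UNIV_int)
  have \<phi>: "bij_betw \<phi> UNIV UNIV" unfolding \<phi>_def by (rule bij_betw_from_nat_into[OF countableI_type inf])
  obtain i0 where i0: "\<phi> i0 = (j, k)" using \<phi> by (metis bij_betw_imp_surj surjD)
  have ii: "integrable lborel (\<lambda>u. incr e \<theta> (t + u / dyadic j) t (\<phi> i) * q u)"
    "(LINT u|lborel. incr e \<theta> (t + u / dyadic j) t (\<phi> i) * q u) = (if i = i0 then C else 0)" for i
  proof -
    obtain j' k' where jk: "\<phi> i = (j', k')" by (cases "\<phi> i")
    let ?c = "dyadic j' powr (- \<theta>) * e j' k'" and ?P0 = "Psi \<psi> (dyadic j' * t - real_of_int k') \<theta>"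
    have eq: "(\<lambda>u. incr e \<theta> (t + u / dyadic j) t (\<phi> i) * q u) =
      (\<lambda>u. ?c * (Psi \<psi> (dyadic j' * (t + u / dyadic j) - real_of_int k') \<theta> * q u - ?P0 * q u))"
      by (auto simp: incr_def jk algebra_simps)
    show "integrable lborel (\<lambda>u. incr e \<theta> (t + u / dyadic j) t (\<phi> i) * q u)"
      unfolding eq by (intro integrable_mult_right Bochner_Integration.integrable_diff Pi q_int)
    have "(LINT u|lborel. incr e \<theta> (t + u / dyadic j) t (\<phi> i) * q u)
      = ?c * (if j' = j \<and> k' = k then 2 * pi else 0)"
      unfolding eq integral_mult_right_zero
      by (subst Bochner_Integration.integral_diff) (auto intro: Pi q_int simp: pair q0)
    also have "\<dots> = (if i = i0 then C else 0)"
    proof (cases "i = i0")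
      case True then show ?thesis using i0 jk by (simp add: C_def)
    next
      case False
      then have "(j', k') \<noteq> (j, k)" using \<phi> i0 jk by (metis bij_betw_imp_inj_on injD)
      then show ?thesis using False by auto
    qed
    finally show "(LINT u|lborel. incr e \<theta> (t + u / dyadic j) t (\<phi> i) * q u) = (if i = i0 then C else 0)" .
  qed
  let ?S = "\<lambda>n u. (\<Sum>i<n. incr e \<theta> (t + u / dyadic j) t (\<phi> i)) * q u"
  have lim: "(\<lambda>n. ?S n u) \<longlonglongrightarrow> f j t u * q u" for u
  proof (intro tendsto_mult tendsto_const)
    let ?s = "t + u / dyadic j"
    have "incr e \<theta> ?s t summable_on UNIV" using A(2) \<theta> by (intro incr_summable) auto
    then have "((\<lambda>i. incr e \<theta> ?s t (\<phi> i)) has_sum infsum (incr e \<theta> ?s t) UNIV) UNIV"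
      using infsum_reindex_bij_betw[OF \<phi>, of "incr e \<theta> ?s t"] summable_on_reindex_bij_betw[OF \<phi>, of
        "incr e \<theta> ?s t"]
      by (metis has_sum_infsum)
    then show "(\<lambda>n. \<Sum>i<n. incr e \<theta> ?s t (\<phi> i)) \<longlonglongrightarrow> f j t u"
      using has_sum_imp_sums gen_diff[OF e \<theta>, of ?s t] unfolding sums_def f_def by metis
  qed
  \<comment> \<open>All partial sums obey one bound, because partial sums of the nonnegative
    \<open>majorant\<close> stay below its full sum.\<close>
  have bound: "\<bar>?S n u\<bar> \<le> K * (A * E 0 * (1 + \<bar>u\<bar> / dyadic j)) * \<bar>q u\<bar>" for n u
  proof -
    let ?s = "t + u / dyadic j"
    have "\<bar>\<Sum>i<n. incr e \<theta> ?s t (\<phi> i)\<bar> \<le> (\<Sum>i<n. K * majorant e \<theta> ?s t (\<phi> i))"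
      by (rule order_trans[OF sum_abs sum_mono]) (rule K(2))
    also have "\<dots> = K * (\<Sum>jk\<in>\<phi> ` {..<n}. majorant e \<theta> ?s t jk)"
      using bij_betw_imp_inj_on[OF \<phi>]
        by (subst sum.reindex) (auto simp: sum_distrib_left intro: inj_on_subset)
    also have "\<dots> \<le> K * infsum (majorant e \<theta> ?s t) UNIV"
      using K A(2) by (intro mult_left_mono finite_sum_le_infsum) (auto simp: majorant_nonneg)
    also have "\<dots> \<le> K * (A * E 0 * max 1 \<bar>?s - t\<bar>)" using K by (intro mult_left_mono A(3)) auto
    also have "\<dots> \<le> K * (A * E 0 * (1 + \<bar>u\<bar> / dyadic j))"
    proof -
      have AE: "0 \<le> A * E 0" using A(1) E by (simp add: local_bound_def)
      have m: "max 1 \<bar>?s - t\<bar> \<le> 1 + \<bar>u\<bar> / dyadic j" by simp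
      show ?thesis by (rule mult_left_mono[OF mult_left_mono[OF m AE]]) (use K(1) in simp)
    qed
    finally show ?thesis unfolding abs_mult by (rule mult_right_mono) simp
  qed
  have lim2: "(\<lambda>n. LINT u|lborel. ?S n u) \<longlonglongrightarrow> (LINT u|lborel. f j t u * q u)"
  proof (rule integral_dominated_convergence[where w = "\<lambda>u. K * (A * E 0 * (1 + \<bar>u\<bar> / dyadic j)) * \<bar>q u\<bar>"])
    show Sm: "?S n \<in> borel_measurable lborel" for n
    proof -
      have "?S n = (\<lambda>u. \<Sum>i<n. incr e \<theta> (t + u / dyadic j) t (\<phi> i) * q u)" by (simp add: sum_distrib_right)
      then show ?thesis using borel_measurable_integrable[OF ii(1)] by simp
    qed
    show "(\<lambda>u. f j t u * q u) \<in> borel_measurable lborel"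
      by (rule borel_measurable_LIMSEQ_real[OF lim Sm])
    have "(\<lambda>u. K * (A * E 0 * (1 + \<bar>u\<bar> / dyadic j)) * \<bar>q u\<bar>) =
      (\<lambda>u. K * (A * E 0) * \<bar>q u\<bar> + K * (A * E 0) / dyadic j * (\<bar>u\<bar> * \<bar>q u\<bar>))" by (simp add: algebra_simps)
    then show "integrable lborel (\<lambda>u. K * (A * E 0 * (1 + \<bar>u\<bar> / dyadic j)) * \<bar>q u\<bar>)"
      using q_int qi2 by (simp only:) (intro Bochner_Integration.integrable_add integrable_mult_right; simp)
    show "AE u in lborel. (\<lambda>n. ?S n u) \<longlonglongrightarrow> f j t u * q u" by (intro AE_I2 lim)
    show "AE u in lborel. norm (?S n u) \<le> K * (A * E 0 * (1 + \<bar>u\<bar> / dyadic j)) * \<bar>q u\<bar>" for n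
      by (intro AE_I2) (simp only: real_norm_def bound)
  qed
  have Sn: "(LINT u|lborel. ?S n u) = (if i0 < n then C else 0)" for n
    unfolding sum_distrib_right by (subst Bochner_Integration.integral_sum) (auto simp: ii)
  have "eventually (\<lambda>n. (LINT u|lborel. ?S n u) = C) sequentially"
    using eventually_gt_at_top[of i0] by eventually_elim (simp only: Sn if_True)
  then have "(\<lambda>n. LINT u|lborel. ?S n u) \<longlonglongrightarrow> C" by (rule tendsto_eventually)
  from LIMSEQ_unique[OF lim2 this] show ?thesis by (simp add: q_def v_def C_def)
qed

text \<open>The restriction on k keeps the argument of the dual within 1 of u, so a factor 8
  replaces the shift and the constant is independent of t, j, k and g.\<close>

lemma coefficient_bound:
  assumes e: "growth e" and \<theta>: "0 < \<theta>" "\<theta> < 1"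
  shows "\<exists>C>0. \<forall>t j k g. \<bar>dyadic j * t - real_of_int k\<bar> \<le> 1 \<and> integrable lborel (\<lambda>u. g u * decay u) \<and>
     (\<forall>u. \<bar>gen e (t + u / dyadic j) \<theta> - gen e t \<theta>\<bar> \<le> g u) \<longrightarrow>
     \<bar>e j k\<bar> \<le> C * dyadic j powr \<theta> * (LINT u|lborel. g u * decay u)"
proof -
  obtain D where D: "D > 0" "\<And>x. \<bar>dual \<theta> x\<bar> \<le> D * decay x" using dual_decay \<theta> by (meson less_imp_le)
  show ?thesis
  proof (intro exI[of _ "8 * D / (2 * pi)"] conjI allI impI)
    show "8 * D / (2 * pi) > 0" using D by simp
    fix t j k g
    assume a: "\<bar>dyadic j * t - real_of_int k\<bar> \<le> 1 \<and> integrable lborel (\<lambda>u. g u * decay u) \<and>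
     (\<forall>u. \<bar>gen e (t + u / dyadic j) \<theta> - gen e t \<theta>\<bar> \<le> g u)"
    let ?v = "dyadic j * t - real_of_int k" and ?f = "\<lambda>u. gen e (t + u / dyadic j) \<theta> - gen e t \<theta>"
    have g: "\<bar>?f u\<bar> \<le> g u" "0 \<le> g u" for u using a abs_ge_zero order_trans by blast+
    have "2 * pi * dyadic j powr (- \<theta>) * \<bar>e j k\<bar> = \<bar>LINT u|lborel. ?f u * dual \<theta> (u + ?v)\<bar>"
      unfolding coefficient_integral[OF assms] by (simp add: abs_mult)
    also have "\<dots> \<le> (LINT u|lborel. norm (?f u * dual \<theta> (u + ?v)))"
      using integral_norm_bound[of lborel "\<lambda>u. ?f u * dual \<theta> (u + ?v)"] by simp
    also have "\<dots> \<le> (LINT u|lborel. (8 * D) * (g u * decay u))"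
    proof (rule integral_mono')
      show "integrable lborel (\<lambda>u. (8 * D) * (g u * decay u))" using a by auto
      fix u
      show "norm (?f u * dual \<theta> (u + ?v)) \<le> (8 * D) * (g u * decay u)"
      proof -
        have "\<bar>dual \<theta> (u + ?v)\<bar> \<le> D * (8 * decay u)"
          using D(2)[of "u + ?v"] decay_shift[of u "u + ?v"] D(1) a by (smt (verit) mult_left_mono)
        then have "\<bar>?f u\<bar> * \<bar>dual \<theta> (u + ?v)\<bar> \<le> g u * (D * (8 * decay u))"
          using g by (intro mult_mono) auto
        then show ?thesis by (simp add: abs_mult mult_ac)
      qed
      show "0 \<le> (8 * D) * (g u * decay u)" using D g decay_nonneg by auto
    qed
    also have "\<dots> = 8 * D * (LINT u|lborel. g u * decay u)" by simp
    finally have "\<bar>e j k\<bar> \<le> 8 * D * (LINT u|lborel. g u * decay u) / (2 * pi * dyadic j powr (- \<theta>))"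
      by (subst pos_le_divide_eq) (auto simp: mult_ac)
    also have "x / (2 * pi * dyadic j powr (- \<theta>)) = x / (2 * pi) * dyadic j powr \<theta>" for x
      by (simp add: powr_minus_divide)
    finally show "\<bar>e j k\<bar> \<le> 8 * D / (2 * pi) * dyadic j powr \<theta> * (LINT u|lborel. g u * decay u)"
      by (simp add: mult_ac)
  qed
qed

text \<open>Split at |u| = 2^j \<delta>. The near part inherits a small factor from the hypothesis.
  In the far part only linear growth is known, but it is a multiple of 2^(-j) |u|, and after
  multiplication by 2^(j \<theta>) it vanishes as 2^(-j (1 - \<theta>)), while g stays above
  1.\<close>

lemma little_o_coefficients:
  assumes e: "growth e" and \<theta>: "0 < \<theta>" "\<theta> < 1" and G: "gauge_levels \<theta> G g"
    and small: "\<And>\<eta>. \<eta> > 0 \<Longrightarrow> \<exists>\<delta>>0. \<forall>s. 0 < \<bar>s - t\<bar> \<and> \<bar>s - t\<bar> < \<delta> \<longrightarrow>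
       \<bar>gen e s \<theta> - gen e t \<theta>\<bar> \<le> \<eta> * (\<bar>s - t\<bar> powr \<theta> * G \<bar>s - t\<bar>)"
    and \<eta>: "\<eta> > 0"
  shows "\<forall>\<^sub>F j in sequentially. \<bar>e (int j) \<lfloor>2 ^ j * t\<rfloor>\<bar> \<le> \<eta> * g j"
proof -
  obtain C where C: "C > 0" "\<And>t j k g. \<bar>dyadic j * t - real_of_int k\<bar> \<le> 1
    \<and> integrable lborel (\<lambda>u. g u * decay u) \<and>
     (\<forall>u. \<bar>gen e (t + u / dyadic j) \<theta> - gen e t \<theta>\<bar> \<le> g u) \<Longrightarrow>
     \<bar>e j k\<bar> \<le> C * dyadic j powr \<theta> * (LINT u|lborel. g u * decay u)"
    using coefficient_bound[OF e \<theta>] by blast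
  obtain K \<delta>0 n where K: "K > 0" "\<delta>0 > 0" "\<And>j. j \<ge> n \<Longrightarrow> 1 \<le> g j"
     "\<And>j u. j \<ge> n \<Longrightarrow> 0 < u \<Longrightarrow> u < 2 ^ j * \<delta>0 \<Longrightarrow> G (u / 2 ^ j) \<le> K * g j * (1 + u powr (- \<theta>))"
    using G unfolding gauge_levels_def by blast
  obtain E where E: "local_bound e t (\<theta> / 2) E"
    using growth_local_bound[OF e, of "\<theta> / 2" t] \<theta> by auto
  then obtain M0 where M0: "M0 > 0" "\<And>s. \<bar>gen e s \<theta> - gen e t \<theta>\<bar> \<le> M0 * E 0 * max 1 \<bar>s - t\<bar>"
    using gen_increment_bound[OF e _ _ \<theta>(2) E] \<theta> by auto
  define M where "M = M0 * E 0"
  have M: "M \<ge> 0" "\<And>s. \<bar>gen e s \<theta> - gen e t \<theta>\<bar> \<le> M * max 1 \<bar>s - t\<bar>"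
    using M0 E by (auto simp: M_def local_bound_def)
  define A where "A = (LINT u|lborel. (2 + \<bar>u\<bar>) * decay u)"
  define B where "B = (LINT u|lborel. \<bar>u\<bar> * decay u)"
  have iA: "integrable lborel (\<lambda>u. (2 + \<bar>u\<bar>) * decay u)" using decay_integrable by (simp add: distrib_right)
  have A: "A \<ge> 0" unfolding A_def by (intro integral_nonneg_AE AE_I2) (simp add: decay_nonneg)
  \<comment> \<open>Makes the near part at most \<eta>/2 times g j; the 1 keeps the denominator
    positive, as only A \<ge> 0 is established.\<close>
  define \<eta>' where "\<eta>' = \<eta> / (2 * (C * K * A + 1))"
  have CKA: "C * K * A + 1 > 0" using C K A by (intro add_nonneg_pos mult_nonneg_nonneg) auto
  have \<eta>': "\<eta>' > 0" using CKA \<eta> by (simp add: \<eta>'_def)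
  obtain \<delta>1 where \<delta>1: "\<delta>1 > 0" "\<And>s. 0 < \<bar>s - t\<bar> \<Longrightarrow> \<bar>s - t\<bar> < \<delta>1 \<Longrightarrow>
       \<bar>gen e s \<theta> - gen e t \<theta>\<bar> \<le> \<eta>' * (\<bar>s - t\<bar> powr \<theta> * G \<bar>s - t\<bar>)"
    using small[OF \<eta>'] by blast
  define \<delta> where "\<delta> = min \<delta>0 \<delta>1"
  have \<delta>: "\<delta> > 0" using K \<delta>1 by (simp add: \<delta>_def)
  define M' where "M' = M * (1 / \<delta> + 1)"
  have M': "M' \<ge> 0" using M \<delta> by (simp add: M'_def)
  have main: "\<bar>e (int j) \<lfloor>2 ^ j * t\<rfloor>\<bar> \<le> \<eta> / 2 * g j + C * M' * B * (2 powr (\<theta> - 1)) ^ j" if j: "j \<ge> n" for j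
  proof -
    let ?d = "2 ^ j :: real"
    have dy: "dyadic (int j) = ?d" by (simp add: dyadic_def powr_realpow)
    let ?a = "\<eta>' * K * g j * ?d powr (- \<theta>)" and ?b = "M' / ?d"
    let ?g = "\<lambda>u. ?a * (2 + \<bar>u\<bar>) + ?b * \<bar>u\<bar>"
    have a0: "?a \<ge> 0" using \<eta>' K(1) K(3)[OF j] by auto
    have b0: "?b \<ge> 0" using M' by auto
    have le: "\<bar>gen e (t + u / dyadic (int j)) \<theta> - gen e t \<theta>\<bar> \<le> ?g u" for u
    proof (cases "u = 0")
      case True then show ?thesis using a0 by simp
    next
      case False
      let ?s = "t + u / dyadic (int j)"
      have h: "\<bar>?s - t\<bar> = \<bar>u\<bar> / ?d" by (simp add: dy)
      show ?thesis
      proof (cases "\<bar>u\<bar> / ?d < \<delta>")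
        case True
        have "\<bar>gen e ?s \<theta> - gen e t \<theta>\<bar> \<le> \<eta>' * ((\<bar>u\<bar> / ?d) powr \<theta> * G (\<bar>u\<bar> / ?d))"
          using \<delta>1(2)[of ?s] True False unfolding h \<delta>_def by simp
        also have "\<dots> \<le> \<eta>' * ((\<bar>u\<bar> / ?d) powr \<theta> * (K * g j * (1 + \<bar>u\<bar> powr (- \<theta>))))"
          using \<eta>' False True by (intro mult_left_mono K(4)[OF j]) (auto simp: \<delta>_def field_simps)
        also have "\<dots> = ?a * (\<bar>u\<bar> powr \<theta> * (1 + \<bar>u\<bar> powr (- \<theta>)))"
        proof -
          have "(\<bar>u\<bar> / ?d) powr \<theta> = \<bar>u\<bar> powr \<theta> * ?d powr (- \<theta>)"
            by (simp add: powr_divide powr_minus_divide)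
          then show ?thesis by (simp only: mult_ac)
        qed
        also have "\<bar>u\<bar> powr \<theta> * (1 + \<bar>u\<bar> powr (- \<theta>)) = \<bar>u\<bar> powr \<theta> + 1"
          using False by (simp add: distrib_left flip: powr_add)
        also have "?a * (\<bar>u\<bar> powr \<theta> + 1) \<le> ?a * (2 + \<bar>u\<bar>)"
        proof (rule mult_left_mono[OF _ a0])
          have "\<bar>u\<bar> powr \<theta> \<le> (1 + \<bar>u\<bar>) powr \<theta>" using \<theta> by (intro powr_mono2) auto
          also have "\<dots> \<le> (1 + \<bar>u\<bar>) powr 1" using \<theta> by (intro powr_mono) auto
          finally show "\<bar>u\<bar> powr \<theta> + 1 \<le> 2 + \<bar>u\<bar>" by simp
        qed
        also have "\<dots> \<le> ?g u" using mult_nonneg_nonneg[OF b0 abs_ge_zero[of u]] by linarith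
        finally show ?thesis .
      next
        \<comment> \<open>Here |u| / 2^j \<ge> \<delta>, so the constant 1 in the linear bound is
          itself at most a multiple of |u| / 2^j.\<close>
        case far: False
        have "\<bar>gen e ?s \<theta> - gen e t \<theta>\<bar> \<le> M * max 1 (\<bar>u\<bar> / ?d)" using M(2)[of ?s] unfolding h .
        also have "\<dots> \<le> M * ((1 / \<delta> + 1) * (\<bar>u\<bar> / ?d))"
        proof (intro mult_left_mono M)
          have "1 \<le> (1 / \<delta>) * (\<bar>u\<bar> / ?d)" using far \<delta> by (simp add: field_simps)
          moreover have "0 \<le> \<bar>u\<bar> / ?d" by simp
          ultimately show "max 1 (\<bar>u\<bar> / ?d) \<le> (1 / \<delta> + 1) * (\<bar>u\<bar> / ?d)"
            unfolding distrib_right mult_1_left by (intro max.boundedI) linarith+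
        qed
        also have "\<dots> = ?b * \<bar>u\<bar>" by (simp add: M'_def)
        also have "\<dots> \<le> ?g u" using a0 by simp
        finally show ?thesis .
      qed
    qed
    have gd: "(\<lambda>u. ?g u * decay u) = (\<lambda>u. ?a * ((2 + \<bar>u\<bar>) * decay u) + ?b * (\<bar>u\<bar> * decay u))"
      by (simp add: algebra_simps)
    have gi: "integrable lborel (\<lambda>u. ?g u * decay u)"
      unfolding gd by (intro Bochner_Integration.integrable_add integrable_mult_right iA decay_integrable)
    have gI: "(LINT u|lborel. ?g u * decay u) = ?a * A + ?b * B"
      unfolding gd A_def B_def
      by (simp only: Bochner_Integration.integral_add[OF integrable_mult_right[OF iA]
        integrable_mult_right[OF decay_integrable(2)]]
          integral_mult_right_zero)
    have fl: "\<bar>dyadic (int j) * t - real_of_int \<lfloor>2 ^ j * t\<rfloor>\<bar> \<le> 1"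
      unfolding dy abs_le_iff using floor_correct[of "?d * t"] by linarith
    have "\<bar>e (int j) \<lfloor>2 ^ j * t\<rfloor>\<bar> \<le> C * dyadic (int j) powr \<theta> * (LINT u|lborel. ?g u * decay u)"
      by (rule C(2)[where t = t and j = "int j" and k = "\<lfloor>2 ^ j * t\<rfloor>" and g = ?g, OF
        conjI[OF fl conjI[OF gi allI[OF le]]]])
    also have "\<dots> = C * ?d powr \<theta> * (?a * A + ?b * B)" unfolding gI dy ..
    also have "\<dots> = C * K * A * \<eta>' * g j * (?d powr \<theta> * ?d powr (- \<theta>)) + C * M' * B * (?d powr \<theta> / ?d)"
      by (simp only: ring_distribs mult_ac times_divide_eq_right times_divide_eq_left)
    also have "?d powr \<theta> * ?d powr (- \<theta>) = 1" by (simp flip: powr_add)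
    also have "?d powr \<theta> / ?d = (2 powr (\<theta> - 1)) ^ j"
    proof -
      have "?d powr \<theta> / ?d = ?d powr (\<theta> - 1)" by (simp add: powr_diff)
      also have "\<dots> = (2 powr real j) powr (\<theta> - 1)" by (simp add: powr_realpow)
      also have "\<dots> = (2 powr (\<theta> - 1)) powr real j" by (simp add: powr_powr mult.commute)
      finally show ?thesis by (simp add: powr_realpow)
    qed
    also have "C * K * A * \<eta>' * g j * 1 + C * M' * B * (2 powr (\<theta> - 1)) ^ j
      \<le> \<eta> / 2 * g j + C * M' * B * (2 powr (\<theta> - 1)) ^ j"
    proof (rule add_right_mono)
      have "C * K * A * \<eta>' \<le> (C * K * A + 1) * \<eta>'" using \<eta>' by (intro mult_right_mono) auto
      also have "\<dots> = \<eta> / 2"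
      proof -
        have "z * (\<eta> / (2 * z)) = \<eta> / 2" if "z > 0" for z using that by simp
        from this[OF CKA] show ?thesis unfolding \<eta>'_def .
      qed
      finally have "C * K * A * \<eta>' \<le> \<eta> / 2" .
      moreover have "0 \<le> g j" using K(3)[OF j] by linarith
      ultimately have "C * K * A * \<eta>' * g j \<le> \<eta> / 2 * g j" by (rule mult_right_mono)
      then show "C * K * A * \<eta>' * g j * 1 \<le> \<eta> / 2 * g j" by (simp only: mult_1_right)
    qed
    finally show ?thesis .
  qed
  have "(\<lambda>j. C * M' * B * (2 powr (\<theta> - 1)) ^ j) \<longlonglongrightarrow> C * M' * B * 0"
    using \<theta> powr_less_mono[of "\<theta> - 1" 0 2] by (intro tendsto_intros LIMSEQ_power_zero) simp
  then have "\<forall>\<^sub>F j in sequentially. C * M' * B * (2 powr (\<theta> - 1)) ^ j < \<eta> / 2"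
    using \<eta> by (intro order_tendstoD(2)) auto
  then show ?thesis
    using eventually_ge_at_top[of n]
  proof eventually_elim
    case (elim j)
    have "\<eta> / 2 * 1 \<le> \<eta> / 2 * g j" using K(3)[OF elim(2)] \<eta> by (intro mult_left_mono) auto
    with main[OF elim(2)] elim(1) show ?case by linarith
  qed
qed

end

subsection \<open>Probabilities of Gaussian events\<close>

text \<open>Measurable covers of small probability replace the bad set, which for statements about
  all t is an uncountable union with no evident measurability.\<close>

lemma AE_by_small_cover:
  assumes "\<And>n::nat. A n \<in> sets M" "\<And>n \<omega>. \<omega> \<in> space M \<Longrightarrow> \<not> P \<omega> \<Longrightarrow> \<omega> \<in> A n" "prob_space M"
    and "(\<lambda>n. measure M (A n)) \<longlonglongrightarrow> 0"
  shows "AE \<omega> in M. P \<omega>"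
proof -
  interpret prob_space M by fact
  let ?N = "\<Inter>n. A n"
  have N: "?N \<in> sets M" using assms(1) by auto
  have le: "measure M ?N \<le> measure M (A n)" for n
    using assms(1) by (intro finite_measure_mono) auto
  have "measure M ?N \<le> 0"
    by (rule LIMSEQ_le_const[OF assms(4)]) (use le in auto)
  then have "?N \<in> null_sets M"
    using N by (simp add: emeasure_eq_measure null_sets_def measure_nonneg antisym)
  then show ?thesis by (rule AE_I') (use assms(2) in auto)
qed

locale iid_normal = prob_space M for M :: "'w measure" +
  fixes \<epsilon> :: "int \<Rightarrow> int \<Rightarrow> 'w \<Rightarrow> real"
  assumes iid: "iid_std_normal M \<epsilon>"
begin

abbreviation "X \<equiv> \<lambda>(j, k). \<epsilon> j k"

lemma indep: "indep_vars (\<lambda>_. borel) X UNIV"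
  using iid by (simp add: iid_std_normal_def)

lemma dist: "distributed M lborel (\<epsilon> j k) std_normal_density"
  using iid by (simp add: iid_std_normal_def)

lemma eps_measurable [measurable]: "\<epsilon> j k \<in> borel_measurable M"
  using distributed_measurable[OF dist[of j k]] by simp

lemma prob_eps:
  assumes "A \<in> sets borel"
  shows "prob {\<omega> \<in> space M. \<epsilon> j k \<omega> \<in> A} = (LINT x|lborel. std_normal_density x * indicator A x)"
proof -
  have m: "{\<omega> \<in> space M. \<epsilon> j k \<omega> \<in> A} \<in> sets M" using assms by measurable
  have "(LINT x|lborel. std_normal_density x * indicator A x) = (LINT \<omega>|M. indicator A (\<epsilon> j k \<omega>))"
    by (rule distributed_integral[OF dist]) (use assms in \<open>auto simp: normal_density_nonneg\<close>)
  also have "\<dots> = (LINT \<omega>|M. indicator {\<omega> \<in> space M. \<epsilon> j k \<omega> \<in> A} \<omega>)"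
    by (intro Bochner_Integration.integral_cong) (auto simp: indicator_def)
  finally show ?thesis using m by simp
qed

text \<open>On the tail, exp (-x^2/2) \<le> exp (-u^2/4) exp (-x^2/4), and the last factor is a
  multiple of the normal density of variance 2, which produces the sqrt 2.\<close>

lemma prob_large_le:
  assumes "u \<ge> 0"
  shows "prob {\<omega> \<in> space M. u < \<bar>\<epsilon> j k \<omega>\<bar>} \<le> sqrt 2 * exp (- u\<^sup>2 / 4)"
proof -
  let ?A = "{x::real. u < \<bar>x\<bar>}"
  have "prob {\<omega> \<in> space M. u < \<bar>\<epsilon> j k \<omega>\<bar>} = (LINT x|lborel. std_normal_density x * indicator ?A x)"
    using prob_eps[of ?A j k] by simp
  also have "\<dots> \<le> (LINT x|lborel. sqrt 2 * exp (- u\<^sup>2 / 4) * normal_density 0 (sqrt 2) x)"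
  proof (rule integral_mono')
    show "integrable lborel (\<lambda>x. sqrt 2 * exp (- u\<^sup>2 / 4) * normal_density 0 (sqrt 2) x)"
      by (intro integrable_mult_right integrable_normal_density) simp
    fix x :: real
    show "0 \<le> sqrt 2 * exp (- u\<^sup>2 / 4) * normal_density 0 (sqrt 2) x" by (simp add: normal_density_nonneg)
    show "std_normal_density x * indicator ?A x \<le> sqrt 2 * exp (- u\<^sup>2 / 4) * normal_density 0 (sqrt 2) x"
    proof (cases "x \<in> ?A")
      case True
      then have "u\<^sup>2 \<le> x\<^sup>2" using assms
        by (metis abs_of_nonneg less_imp_le mem_Collect_eq power2_abs power_mono)
      then have "exp (- x\<^sup>2 / 2) \<le> exp (- u\<^sup>2 / 4) * exp (- x\<^sup>2 / 4)"
        unfolding exp_add[symmetric] by simp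
      moreover have s2: "sqrt 2 * (1 / sqrt (4 * pi)) = 1 / sqrt (2 * pi)"
        using real_sqrt_mult[of 2 "2 * pi"] by (simp add: field_simps)
      have "sqrt 2 * exp (- u\<^sup>2 / 4) * normal_density 0 (sqrt 2) x
        = 1 / sqrt (2 * pi) * (exp (- u\<^sup>2 / 4) * exp (- x\<^sup>2 / 4))"
      proof -
        have nd: "normal_density 0 (sqrt 2) x = 1 / sqrt (4 * pi) * exp (- x\<^sup>2 / 4)"
          by (simp add: normal_density_def)
        have "sqrt 2 * A * (1 / sqrt (4 * pi) * B) = (sqrt 2 * (1 / sqrt (4 * pi))) * (A * B)" for A B
          by (simp only: mult_ac)
        then show ?thesis unfolding nd s2 .
      qed
      ultimately show ?thesis
        using True by (simp add: std_normal_density_def divide_right_mono)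
    qed (simp add: normal_density_nonneg)
  qed
  also have "\<dots> = sqrt 2 * exp (- u\<^sup>2 / 4)" by simp
  finally show ?thesis .
qed

text \<open>What remains of the density on [u, u + 1] after exp (-u^2) is split off, since (u + 1)^2
  / 2 \<le> u^2 + 1.\<close>

definition "gauss_c = exp (- 1) / sqrt (2 * pi)"

lemma gauss_c_pos: "gauss_c > 0" by (simp add: gauss_c_def)

text \<open>The first bound is for large u: the complement contains the event of lying in
  [u, u + 1], and 1 - x \<le> exp (-x). The second is for small u: the density is at most 1/2 and
  the interval has length 2 u.\<close>

lemma prob_small_le:
  assumes "u \<ge> 0"
  shows "prob {\<omega> \<in> space M. \<bar>\<epsilon> j k \<omega>\<bar> < u} \<le> exp (- (gauss_c * exp (- u\<^sup>2)))"
    and "prob {\<omega> \<in> space M. \<bar>\<epsilon> j k \<omega>\<bar> < u} \<le> u"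
proof -
  let ?A = "{u..u+1}" and ?B = "{x::real. \<bar>x\<bar> < u}"
  have "gauss_c * exp (- u\<^sup>2) = (LINT x|lborel. indicator ?A x *\<^sub>R (gauss_c * exp (- u\<^sup>2)))" by simp
  also have "\<dots> \<le> (LINT x|lborel. std_normal_density x * indicator ?A x)"
  proof (rule integral_mono)
    show "integrable lborel (\<lambda>x. indicator ?A x *\<^sub>R (gauss_c * exp (- u\<^sup>2)))"
      by (rule borel_integrable_compact) auto
    show "integrable lborel (\<lambda>x. std_normal_density x * indicator ?A x)"
      by (intro integrable_real_mult_indicator integrable_normal_density) auto
    fix x :: real
    show "indicator ?A x *\<^sub>R (gauss_c * exp (- u\<^sup>2)) \<le> std_normal_density x * indicator ?A x"
    proof (cases "x \<in> ?A")
      case True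
      have "x\<^sup>2 \<le> (u + 1)\<^sup>2" using True assms by (intro power_mono) auto
      also have "\<dots> \<le> 2 * u\<^sup>2 + 2" using zero_le_power2[of "u - 1"]
        by (simp add: power2_eq_square algebra_simps)
      finally have "exp (- 1) * exp (- u\<^sup>2) \<le> exp (- x\<^sup>2 / 2)" unfolding exp_add[symmetric] by simp
      then show ?thesis using True by (simp add: gauss_c_def std_normal_density_def divide_right_mono)
    qed simp
  qed
  also have "\<dots> = prob {\<omega> \<in> space M. \<epsilon> j k \<omega> \<in> ?A}" by (rule prob_eps[symmetric]) simp
  also have "\<dots> \<le> prob (space M - {\<omega> \<in> space M. \<bar>\<epsilon> j k \<omega>\<bar> < u})"
    by (intro finite_measure_mono) auto
  also have "\<dots> = 1 - prob {\<omega> \<in> space M. \<bar>\<epsilon> j k \<omega>\<bar> < u}"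
    by (rule prob_compl) measurable
  finally have "prob {\<omega> \<in> space M. \<bar>\<epsilon> j k \<omega>\<bar> < u} \<le> 1 - gauss_c * exp (- u\<^sup>2)" by simp
  also have "\<dots> \<le> exp (- (gauss_c * exp (- u\<^sup>2)))"
    using exp_ge_add_one_self[of "- (gauss_c * exp (- u\<^sup>2))"] by simp
  finally show "prob {\<omega> \<in> space M. \<bar>\<epsilon> j k \<omega>\<bar> < u} \<le> exp (- (gauss_c * exp (- u\<^sup>2)))" .
  have "prob {\<omega> \<in> space M. \<bar>\<epsilon> j k \<omega>\<bar> < u} = (LINT x|lborel. std_normal_density x * indicator ?B x)"
    using prob_eps[of ?B j k] by simp
  also have "\<dots> \<le> (LINT x|lborel. indicator {-u..u} x *\<^sub>R (1 / 2))"
  proof (rule integral_mono')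
    show "integrable lborel (\<lambda>x. indicator {-u..u} x *\<^sub>R (1 / 2 :: real))"
      by (rule borel_integrable_compact) auto
    fix x :: real
    have "sqrt 4 \<le> sqrt (2 * pi)" using pi_ge_two by (intro real_sqrt_le_mono) auto
    then have s: "2 \<le> sqrt (2 * pi)" by simp
    have "std_normal_density x \<le> 1 / 2"
    proof -
      have "std_normal_density x = exp (- x\<^sup>2 / 2) / sqrt (2 * pi)" by (simp add: std_normal_density_def)
      also have "\<dots> \<le> 1 / 2" using s by (intro frac_le) auto
      finally show ?thesis .
    qed
    then show "std_normal_density x * indicator ?B x \<le> indicator {-u..u} x *\<^sub>R (1 / 2)"
      by (auto simp: indicator_def)
  qed auto
  also have "\<dots> = u" using assms by simp
  finally show "prob {\<omega> \<in> space M. \<bar>\<epsilon> j k \<omega>\<bar> < u} \<le> u" .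
qed

lemma all_small_event [measurable]:
  assumes "countable I"
  shows "{\<omega> \<in> space M. \<forall>i\<in>I. \<bar>X i \<omega>\<bar> < u} \<in> sets M"
proof -
  have "{\<omega> \<in> space M. \<bar>X i \<omega>\<bar> < u} \<in> sets M" for i by (cases i) simp
  then show ?thesis by (intro sets.sets_Collect_countable_Ball assms)
qed

lemma prob_all_small:
  assumes I: "finite I" "I \<noteq> {}"
  shows "prob {\<omega> \<in> space M. \<forall>i\<in>I. \<bar>X i \<omega>\<bar> < u} = (\<Prod>i\<in>I. prob {\<omega> \<in> space M. \<bar>X i \<omega>\<bar> < u})"
proof -
  have "prob (\<Inter>i\<in>I. X i -` {x. \<bar>x\<bar> < u} \<inter> space M) = (\<Prod>i\<in>I. prob (X i -` {x. \<bar>x\<bar> < u} \<inter> space M))"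
    by (rule indep_varsD[OF indep]) (use I in auto)
  moreover have "(\<Inter>i\<in>I. X i -` {x. \<bar>x\<bar> < u} \<inter> space M) = {\<omega> \<in> space M. \<forall>i\<in>I. \<bar>X i \<omega>\<bar> < u}"
    using I by auto
  moreover have "X i -` {x. \<bar>x\<bar> < u} \<inter> space M = {\<omega> \<in> space M. \<bar>X i \<omega>\<bar> < u}" for i by auto
  ultimately show ?thesis by simp
qed

lemma prob_all_small_le:
  assumes I: "finite I" and u: "u \<ge> 0"
  shows "prob {\<omega> \<in> space M. \<forall>i\<in>I. \<bar>X i \<omega>\<bar> < u} \<le> exp (- (real (card I) * gauss_c * exp (- u\<^sup>2)))"
    and "prob {\<omega> \<in> space M. \<forall>i\<in>I. \<bar>X i \<omega>\<bar> < u} \<le> u ^ card I"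
proof -
  let ?x = "exp (- (gauss_c * exp (- u\<^sup>2)))"
  have "prob {\<omega> \<in> space M. \<forall>i\<in>I. \<bar>X i \<omega>\<bar> < u} \<le> ?x ^ card I"
  proof (cases "I = {}")
    case False
    have "(\<Prod>i\<in>I. prob {\<omega> \<in> space M. \<bar>X i \<omega>\<bar> < u}) \<le> (\<Prod>i\<in>I. ?x)"
      using prob_small_le(1)[OF u] by (intro prod_mono) (auto split: prod.splits)
    then show ?thesis using prob_all_small[OF I False] by simp
  qed simp
  then show "prob {\<omega> \<in> space M. \<forall>i\<in>I. \<bar>X i \<omega>\<bar> < u} \<le> exp (- (real (card I) * gauss_c * exp (- u\<^sup>2)))"
    by (simp add: exp_of_nat_mult[symmetric] mult_ac)
  show "prob {\<omega> \<in> space M. \<forall>i\<in>I. \<bar>X i \<omega>\<bar> < u} \<le> u ^ card I"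
  proof (cases "I = {}")
    case False
    have "(\<Prod>i\<in>I. prob {\<omega> \<in> space M. \<bar>X i \<omega>\<bar> < u}) \<le> (\<Prod>i\<in>I. u)"
      using prob_small_le(2)[OF u] by (intro prod_mono) (auto split: prod.splits)
    then show ?thesis using prob_all_small[OF I False] by simp
  qed simp
qed

subsection \<open>Global and ordinary upper bounds\<close>

lemma log_weight_ge: "4 \<le> log_weight j l"
proof -
  have "2 * 2 \<le> log_weight j l" unfolding log_weight_def by (intro mult_mono) auto
  then show ?thesis by simp
qed

lemma summable_on_int_inverse_square: "(\<lambda>k::int. 1 / (2 + \<bar>real_of_int k\<bar>)\<^sup>2) summable_on UNIV"
  by (rule summable_on_comparison_test[OF summable_on_inverse_square_int])
     (auto intro!: divide_left_mono power_mono)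

text \<open>Borel-Cantelli over all pairs. The centre may move with the level: K = 0 gives
  \<open>growth\<close>, and K j = \<lfloor>2^j t\<rfloor> gives a bound in terms of the distance
  from a fixed t.\<close>

lemma shifted_growth:
  fixes K :: "int \<Rightarrow> int"
  shows "AE \<omega> in M. \<exists>C. \<forall>j l. \<bar>\<epsilon> j (K j + l) \<omega>\<bar> \<le> C * sqrt (ln (log_weight j l))"
proof -
  let ?s = "\<lambda>(j, l). sqrt (ln (log_weight j l))"
  have spos: "?s i > 0" for i using log_weight_ge[of "fst i" "snd i"] by (auto split: prod.splits)
  define \<phi> where "\<phi> = from_nat_into (UNIV :: (int \<times> int) set)"
  have inf: "infinite (UNIV :: (int \<times> int) set)" by (metis finite_prod infinite_UNIV_int)
  have \<phi>: "bij_betw \<phi> UNIV UNIV" unfolding \<phi>_def by (rule bij_betw_from_nat_into[OF countableI_type inf])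
  define Y where "Y = (\<lambda>(j, l). \<epsilon> j (K j + l))"
  have Ym [measurable]: "Y i \<in> borel_measurable M" for i by (cases i) (simp add: Y_def)
  \<comment> \<open>sqrt 8 makes the tail exponent u^2/4 equal to twice the logarithm of the weight,
    hence the summable inverse square.\<close>
  define A where "A n = {\<omega> \<in> space M. sqrt 8 * ?s (\<phi> n) < \<bar>Y (\<phi> n) \<omega>\<bar>}" for n
  have Am: "A n \<in> sets M" for n unfolding A_def by measurable
  let ?w = "\<lambda>(j, l). sqrt 2 * (1 / (2 + \<bar>real_of_int j\<bar>)\<^sup>2 * (1 / (2 + \<bar>real_of_int l\<bar>)\<^sup>2))"
  have Ale: "prob (A n) \<le> ?w (\<phi> n)" for n
  proof -
    obtain j l where jl: "\<phi> n = (j, l)" by (cases "\<phi> n")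
    have W: "log_weight j l > 0" "ln (log_weight j l) \<ge> 0" using log_weight_ge[of j l] by auto
    have "prob (A n) \<le> sqrt 2 * exp (- (sqrt 8 * sqrt (ln (log_weight j l)))\<^sup>2 / 4)"
      unfolding A_def jl Y_def prod.case by (rule prob_large_le) (use W in auto)
    also have "- (sqrt 8 * sqrt (ln (log_weight j l)))\<^sup>2 / 4 = - (2 * ln (log_weight j l))"
      using W by (simp add: power_mult_distrib)
    also have "exp (- (2 * ln (log_weight j l))) = 1 / (log_weight j l)\<^sup>2"
    proof -
      have "exp (2 * ln (log_weight j l)) = (log_weight j l)\<^sup>2"
        using W exp_of_nat_mult[of 2 "ln (log_weight j l)"] by simp
      then show ?thesis by (simp add: exp_minus inverse_eq_divide)
    qed
    finally show ?thesis unfolding jl by (simp add: log_weight_def power_mult_distrib)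
  qed
  have w: "?w summable_on UNIV"
  proof -
    have "(\<lambda>(j, l). (1 / (2 + \<bar>real_of_int j\<bar>)\<^sup>2) * (1 / (2 + \<bar>real_of_int l\<bar>)\<^sup>2)) summable_on UNIV \<times> UNIV"
      using summable_on_int_inverse_square
      by (intro summable_on_SigmaI[where g = "\<lambda>j. (1 / (2 + \<bar>real_of_int j\<bar>)\<^sup>2)
        * infsum (\<lambda>l. 1 / (2 + \<bar>real_of_int l\<bar>)\<^sup>2) UNIV"])
         (auto intro!: has_sum_cmult_right has_sum_infsum summable_on_cmult_left
           simp del: times_divide_eq_left times_divide_eq_right mult_1_left)
    from summable_on_cmult_right[OF this, of "sqrt 2"] show ?thesis by (simp add: case_prod_unfold)
  qed
  have sA: "summable (\<lambda>n. prob (A n))"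
  proof (rule summable_comparison_test)
    have "(\<lambda>n. ?w (\<phi> n)) summable_on UNIV" using summable_on_reindex_bij_betw[OF \<phi>, of ?w] w by simp
    then show "summable (\<lambda>n. ?w (\<phi> n))" by (rule summable_on_imp_summable)
    show "\<exists>N. \<forall>n\<ge>N. norm (prob (A n)) \<le> ?w (\<phi> n)" using Ale by (intro exI[of _ 0]) simp
  qed
  have "AE \<omega> in M. eventually (\<lambda>n. \<omega> \<in> space M - A n) sequentially"
    by (rule borel_cantelli_AE1[OF Am _ sA]) (simp add: emeasure_eq_measure)
  then show ?thesis
  proof eventually_elim
    case (elim \<omega>)
    then obtain N where N: "\<And>n. n \<ge> N \<Longrightarrow> \<omega> \<in> space M - A n" by (auto simp: eventually_sequentially)
    \<comment> \<open>The finitely many exceptions are absorbed by the sum of their normalised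
      sizes.\<close>
    define C where "C = sqrt 8 + (\<Sum>n<N. \<bar>Y (\<phi> n) \<omega>\<bar> / ?s (\<phi> n))"
    have nn: "0 \<le> \<bar>Y (\<phi> x) \<omega>\<bar> / ?s (\<phi> x)" for x
      using less_imp_le[OF spos[of "\<phi> x"]] by (intro divide_nonneg_nonneg) auto
    have S: "0 \<le> (\<Sum>n<N. \<bar>Y (\<phi> n) \<omega>\<bar> / ?s (\<phi> n))" by (intro sum_nonneg nn)
    have *: "\<bar>Y (\<phi> n) \<omega>\<bar> \<le> C * ?s (\<phi> n)" for n
    proof (cases "n < N")
      case True
      have "\<bar>Y (\<phi> n) \<omega>\<bar> / ?s (\<phi> n) \<le> (\<Sum>n<N. \<bar>Y (\<phi> n) \<omega>\<bar> / ?s (\<phi> n))"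
        by (rule member_le_sum) (use True nn in auto)
      also have "\<dots> \<le> C" by (simp add: C_def)
      finally show ?thesis using spos[of "\<phi> n"] by (simp add: pos_divide_le_eq)
    next
      case False
      then have "\<bar>Y (\<phi> n) \<omega>\<bar> \<le> sqrt 8 * ?s (\<phi> n)" using N[of n] by (auto simp: A_def)
      also have "\<dots> \<le> C * ?s (\<phi> n)" using S spos[of "\<phi> n"]
        by (intro mult_right_mono) (auto simp: C_def less_imp_le)
      finally show ?thesis .
    qed
    show ?case
    proof (intro exI[of _ C] allI)
      fix j l
      obtain n where "\<phi> n = (j, l)" using \<phi> by (metis bij_betw_imp_surj surjD)
      then show "\<bar>\<epsilon> j (K j + l) \<omega>\<bar> \<le> C * sqrt (ln (log_weight j l))" using *[of n] by (simp add: Y_def)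
    qed
  qed
qed

subsection \<open>Lower bounds\<close>

text \<open>There are about \<open>2 ^ n\<close> dyadic paths of length \<open>n\<close>, and along each of them all coefficients
  are below \<open>1/4\<close> with probability at most \<open>4\<^sup>-\<^sup>n\<close>.\<close>

lemma path_lower_bound:
  "AE \<omega> in M. \<forall>t::real. \<forall>j0. \<exists>j\<ge>j0. 1 / 4 \<le> \<bar>\<epsilon> (int j) \<lfloor>2 ^ j * t\<rfloor> \<omega>\<bar>"
proof -
  \<comment> \<open>The ancestors, in levels j0 to j0 + n, of the dyadic interval k of level j0 + n:
    going up one level halves the index.\<close>
  let ?path = "\<lambda>j0 n (k::int). (\<lambda>i. (int (j0 + i), k div 2 ^ (n - i))) ` {..n}"
  \<comment> \<open>The 2 m 2^(j0 + n) intervals of level j0 + n between -m and m, each the end of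
    one path.\<close>
  let ?R = "\<lambda>m j0 n. {- (int m * 2 ^ (j0 + n)) ..< int m * 2 ^ (j0 + n)}"
  let ?A = "\<lambda>j0 m n. \<Union>k\<in>?R m j0 n. {\<omega> \<in> space M. \<forall>i\<in>?path j0 n k. \<bar>X i \<omega>\<bar> < 1 / 4}"
  have one: "AE \<omega> in M. \<forall>t. - real m \<le> t \<and> t < real m \<longrightarrow> (\<exists>j\<ge>j0. 1 / 4 \<le> \<bar>\<epsilon> (int j) \<lfloor>2 ^ j * t\<rfloor> \<omega>\<bar>)" for m j0
  proof (rule AE_by_small_cover[where A = "?A j0 m"])
    show "?A j0 m n \<in> sets M" for n
      by (intro sets.finite_UN all_small_event) auto
    show "prob_space M" by (rule prob_space_axioms)
    fix n \<omega> assume w: "\<omega> \<in> space M" "\<not> (\<forall>t. - real m \<le> t \<and> t < real m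
      \<longrightarrow> (\<exists>j\<ge>j0. 1 / 4 \<le> \<bar>\<epsilon> (int j) \<lfloor>2 ^ j * t\<rfloor> \<omega>\<bar>))"
    then obtain t where t: "- real m \<le> t" "t < real m" and "\<not> (\<exists>j\<ge>j0. 1 / 4 \<le> \<bar>\<epsilon> (int j) \<lfloor>2 ^ j * t\<rfloor> \<omega>\<bar>)"
      by blast
    then have t3: "\<bar>\<epsilon> (int j) \<lfloor>2 ^ j * t\<rfloor> \<omega>\<bar> < 1 / 4" if "j \<ge> j0" for j using that by (meson not_le)
    define k where "k = \<lfloor>2 ^ (j0 + n) * t\<rfloor>"
    have kR: "k \<in> ?R m j0 n"
    proof -
      have "real m * - (2 ^ (j0 + n)) \<le> 2 ^ (j0 + n) * t" using mult_left_mono[OF t(1), of "2 ^ (j0 + n)"]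
        by (simp add: mult.commute)
      moreover have "2 ^ (j0 + n) * t < real m * 2 ^ (j0 + n)"
        using mult_strict_left_mono[OF t(2), of "2 ^ (j0 + n)"] by (simp add: mult.commute)
      ultimately show ?thesis unfolding k_def by (simp add: le_floor_iff floor_less_iff)
    qed
    have "\<forall>i\<in>?path j0 n k. \<bar>X i \<omega>\<bar> < 1 / 4"
    proof
      fix x assume "x \<in> ?path j0 n k"
      then obtain i where i: "i \<in> {..n}" and x: "x = (int (j0 + i), k div 2 ^ (n - i))" by blast
      have "k div 2 ^ (n - i) = \<lfloor>2 ^ (j0 + n) * t / real_of_int (2 ^ (n - i))\<rfloor>"
        unfolding k_def by (rule floor_divide_real_eq_div[symmetric]) simp
      also have "2 ^ (j0 + n) * t / real_of_int (2 ^ (n - i)) = 2 ^ (j0 + i) * t"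
        using i by (simp add: field_simps flip: power_add)
      finally show "\<bar>X x \<omega>\<bar> < 1 / 4" using t3[of "j0 + i"] by (simp add: x)
    qed
    then show "\<omega> \<in> ?A j0 m n" using kR w by blast
  next
    have le: "prob (?A j0 m n) \<le> real m * 2 ^ (j0 + 1) * (1 / 2) ^ n" for n
    proof -
      have "prob (?A j0 m n) \<le> (\<Sum>k\<in>?R m j0 n. prob {\<omega> \<in> space M. \<forall>i\<in>?path j0 n k. \<bar>X i \<omega>\<bar> < 1 / 4})"
        by (intro measure_UNION_le all_small_event) auto
      also have "\<dots> \<le> (\<Sum>k\<in>?R m j0 n. (1 / 4) ^ n)"
      proof (rule sum_mono)
        fix k
        have "card (?path j0 n k) = Suc n" by (subst card_image) (auto simp: inj_on_def)
        then have "prob {\<omega> \<in> space M. \<forall>i\<in>?path j0 n k. \<bar>X i \<omega>\<bar> < 1 / 4} \<le> (1 / 4) ^ Suc n"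
          using prob_all_small_le(2)[of "?path j0 n k" "1 / 4"] by simp
        also have "\<dots> \<le> (1 / 4) ^ n" by simp
        finally show "prob {\<omega> \<in> space M. \<forall>i\<in>?path j0 n k. \<bar>X i \<omega>\<bar> < 1 / 4} \<le> (1 / 4) ^ n" .
      qed
      also have "\<dots> = real (nat (2 * (int m * 2 ^ (j0 + n)))) * (1 / 4) ^ n" by simp
      also have "real (nat (2 * (int m * 2 ^ (j0 + n)))) = 2 * (real m * 2 ^ (j0 + n))"
        by (simp add: nat_mult_distrib nat_power_eq)
      also have "2 * (real m * 2 ^ (j0 + n)) * (1 / 4) ^ n = real m * 2 ^ (j0 + 1) * (2 * (1 / 4)) ^ n"
        unfolding power_mult_distrib by (simp add: power_add)
      finally show ?thesis by simp
    qed
    have "(\<lambda>n. real m * 2 ^ (j0 + 1) * (1 / 2) ^ n) \<longlonglongrightarrow> real m * 2 ^ (j0 + 1) * 0"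
      by (intro tendsto_intros LIMSEQ_power_zero) simp
    then have lim: "(\<lambda>n. real m * 2 ^ (j0 + 1) * (1 / 2) ^ n) \<longlonglongrightarrow> 0" by simp
    show "(\<lambda>n. prob (?A j0 m n)) \<longlonglongrightarrow> 0"
      by (rule tendsto_sandwich[OF _ _ tendsto_const lim]; intro always_eventually allI measure_nonneg le)
  qed
  have "AE \<omega> in M. \<forall>m j0. \<forall>t. - real m \<le> t \<and> t < real m \<longrightarrow> (\<exists>j\<ge>j0. 1 / 4 \<le> \<bar>\<epsilon> (int j) \<lfloor>2 ^ j * t\<rfloor> \<omega>\<bar>)"
    using one by (simp add: AE_all_countable)
  then show ?thesis
  proof eventually_elim
    case (elim \<omega>)
    show ?case
    proof (intro allI)
      fix t j0
      obtain m :: nat where "\<bar>t\<bar> < real m" using reals_Archimedean2 by blast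
      then have "- real m \<le> t \<and> t < real m" by auto
      with elim show "\<exists>j\<ge>j0. 1 / 4 \<le> \<bar>\<epsilon> (int j) \<lfloor>2 ^ j * t\<rfloor> \<omega>\<bar>" by blast
    qed
  qed
qed

text \<open>The coefficients along t lie in different levels and are independent. On the levels from
  n to 2 n the threshold is at most its value at 2 n, which each coefficient exceeds with
  probability at least of order n^(-1/16); n such trials cannot all fail in the limit.\<close>

lemma fixed_time_lower_bound:
  fixes t :: real
  shows
  "AE \<omega> in M. \<forall>j0. \<exists>j\<ge>j0. 1 / 4 * sqrt (ln (real j)) \<le> \<bar>\<epsilon> (int j) \<lfloor>2 ^ j * t\<rfloor> \<omega>\<bar>"
proof -
  let ?I = "\<lambda>n. (\<lambda>j. (int j, \<lfloor>2 ^ j * t\<rfloor>)) ` {n..<2 * n}"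
  let ?u = "\<lambda>n. 1 / 4 * sqrt (ln (real (2 * n)))"
  have one: "AE \<omega> in M. \<exists>j\<ge>j0. 1 / 4 * sqrt (ln (real j)) \<le> \<bar>\<epsilon> (int j) \<lfloor>2 ^ j * t\<rfloor> \<omega>\<bar>" for j0
  \<comment> \<open>The index n + j0 + 1 makes the block nonempty and lets it start after
    j0.\<close>
  proof (rule AE_by_small_cover[where A = "\<lambda>n. {\<omega> \<in> space M. \<forall>i\<in>?I (n + j0 + 1). \<bar>X i \<omega>\<bar> < ?u (n + j0 + 1)}"])
    show "{\<omega> \<in> space M. \<forall>i\<in>?I (n + j0 + 1). \<bar>X i \<omega>\<bar> < ?u (n + j0 + 1)} \<in> sets M" for n
      by (intro all_small_event) auto
    show "prob_space M" by (rule prob_space_axioms)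
    fix n \<omega> assume w: "\<omega> \<in> space M" "\<not> (\<exists>j\<ge>j0. 1 / 4 * sqrt (ln (real j)) \<le> \<bar>\<epsilon> (int j) \<lfloor>2 ^ j * t\<rfloor> \<omega>\<bar>)"
    have "\<bar>\<epsilon> (int j) \<lfloor>2 ^ j * t\<rfloor> \<omega>\<bar> < ?u (n + j0 + 1)" if "j \<in> {n + j0 + 1..<2 * (n + j0 + 1)}" for j
    proof -
      have "j \<ge> j0" using that by simp
      then have "\<bar>\<epsilon> (int j) \<lfloor>2 ^ j * t\<rfloor> \<omega>\<bar> < 1 / 4 * sqrt (ln (real j))" using w(2) by (meson not_le)
      also have "\<dots> \<le> ?u (n + j0 + 1)"
        using that by (intro mult_left_mono real_sqrt_le_mono ln_mono) auto
      finally show ?thesis .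
    qed
    then show "\<omega> \<in> {\<omega> \<in> space M. \<forall>i\<in>?I (n + j0 + 1). \<bar>X i \<omega>\<bar> < ?u (n + j0 + 1)}" using w(1) by auto
  next
    have le: "prob {\<omega> \<in> space M. \<forall>i\<in>?I n. \<bar>X i \<omega>\<bar> < ?u n}
      \<le> exp (- (real n * gauss_c * exp (- (ln (2 * real n) / 16))))" if "n \<ge> 1" for n
    proof -
      have c: "card (?I n) = n" by (subst card_image) (auto simp: inj_on_def)
      have sq: "(?u n)\<^sup>2 = ln (2 * real n) / 16" using that by (simp add: power_mult_distrib power2_eq_square)
      have "prob {\<omega> \<in> space M. \<forall>i\<in>?I n. \<bar>X i \<omega>\<bar> < ?u n}
        \<le> exp (- (real (card (?I n)) * gauss_c * exp (- (?u n)\<^sup>2)))"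
        by (rule prob_all_small_le(1)) (use that in auto)
      then show ?thesis unfolding c sq .
    qed
    have "((\<lambda>x::real. exp (- (x * gauss_c * exp (- (ln (2 * x) / 16))))) \<longlongrightarrow> 0) at_top"
      using gauss_c_pos by real_asymp
    from filterlim_compose[OF this filterlim_real_sequentially]
    have "(\<lambda>n. exp (- (real n * gauss_c * exp (- (ln (2 * real n) / 16))))) \<longlonglongrightarrow> 0" .
    then have "(\<lambda>n. prob {\<omega> \<in> space M. \<forall>i\<in>?I n. \<bar>X i \<omega>\<bar> < ?u n}) \<longlonglongrightarrow> 0"
      by (rule tendsto_sandwich[OF _ _ tendsto_const, rotated 2])
         (use le in \<open>auto intro!: eventually_sequentiallyI[of 1]\<close>)
    from LIMSEQ_ignore_initial_segment[OF this, of "j0 + 1"]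
    show "(\<lambda>n. prob {\<omega> \<in> space M. \<forall>i\<in>?I (n + j0 + 1). \<bar>X i \<omega>\<bar> < ?u (n + j0 + 1)}) \<longlonglongrightarrow> 0"
      by (simp only: add.assoc)
  qed
  then show ?thesis by (simp add: AE_all_countable)
qed

text \<open>Below a fixed dyadic interval there are 2^n coefficients n levels further down. Each
  exceeds the threshold with probability at least of order exp (-n/16), so all of them stay below it
  with doubly exponentially small probability.\<close>

lemma dense_lower_bound:
  "AE \<omega> in M. \<forall>j0 k0 J. \<exists>j\<ge>J. \<exists>k. j0 \<le> j \<and> k0 * 2 ^ (j - j0) \<le> k \<and> k < (k0 + 1) * 2 ^ (j - j0) \<and>
     1 / 4 * sqrt (real j) \<le> \<bar>\<epsilon> (int j) k \<omega>\<bar>"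
proof -
  have one: "AE \<omega> in M. \<exists>j\<ge>J. \<exists>k. j0 \<le> j \<and> k0 * 2 ^ (j - j0) \<le> k \<and> k < (k0 + 1) * 2 ^ (j - j0) \<and>
     1 / 4 * sqrt (real j) \<le> \<bar>\<epsilon> (int j) k \<omega>\<bar>" for j0 k0 J
  proof -
    let ?I = "\<lambda>n. Pair (int (j0 + n)) ` {k0 * 2 ^ n ..< (k0 + 1) * 2 ^ n}"
    let ?A = "\<lambda>n. {\<omega> \<in> space M. \<forall>i\<in>?I n. \<bar>X i \<omega>\<bar> < 1 / 4 * sqrt (real (j0 + n))}"
    show ?thesis
    proof (rule AE_by_small_cover[where A = "\<lambda>n. ?A (n + J)"])
      show "?A (n + J) \<in> sets M" for n by (intro all_small_event) auto
      show "prob_space M" by (rule prob_space_axioms)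
      fix n \<omega> assume w: "\<omega> \<in> space M" "\<not> (\<exists>j\<ge>J. \<exists>k. j0 \<le> j \<and> k0 * 2 ^ (j - j0) \<le> k
        \<and> k < (k0 + 1) * 2 ^ (j - j0) \<and>
        1 / 4 * sqrt (real j) \<le> \<bar>\<epsilon> (int j) k \<omega>\<bar>)"
      have "\<bar>\<epsilon> (int (j0 + (n + J))) k \<omega>\<bar> < 1 / 4 * sqrt (real (j0 + (n + J)))"
        if "k \<in> {k0 * 2 ^ (n + J) ..< (k0 + 1) * 2 ^ (n + J)}" for k
      proof (rule ccontr)
        assume "\<not> \<bar>\<epsilon> (int (j0 + (n + J))) k \<omega>\<bar> < 1 / 4 * sqrt (real (j0 + (n + J)))"
        then have "j0 + (n + J) \<ge> J \<and> j0 \<le> j0 + (n + J) \<and> k0 * 2 ^ (j0 + (n + J) - j0) \<le> k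
          \<and> k < (k0 + 1) * 2 ^ (j0 + (n + J) - j0) \<and>
           1 / 4 * sqrt (real (j0 + (n + J))) \<le> \<bar>\<epsilon> (int (j0 + (n + J))) k \<omega>\<bar>"
          using that by (simp add: not_less)
        then show False using w(2) by blast
      qed
      then show "\<omega> \<in> ?A (n + J)" using w(1) by auto
    next
      have le: "prob (?A n) \<le> exp (- (gauss_c * exp (real n / 2 - real j0 / 16)))" for n
      proof -
        have c: "card (?I n) = 2 ^ n"
          by (subst card_image) (auto simp: inj_on_def algebra_simps nat_power_eq)
        have sq: "(1 / 4 * sqrt (real (j0 + n)))\<^sup>2 = (real j0 + real n) / 16"
          by (simp add: power_mult_distrib power2_eq_square)
        have "prob (?A n) \<le> exp (- (real (card (?I n)) * gauss_c * exp (- (1 / 4 * sqrt (real (j0 + n)))\<^sup>2)))"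
          by (rule prob_all_small_le(1)) auto
        also have "\<dots> \<le> exp (- (gauss_c * exp (real n / 2 - real j0 / 16)))"
        proof -
          \<comment> \<open>From ln 2 \<ge> 2/3 and 2/3 - 1/16 \<ge> 1/2.\<close>
          have "exp (real n / 2 - real j0 / 16) \<le> exp (real n * ln 2 - (real j0 + real n) / 16)"
          proof -
            have "real n * (2 / 3) \<le> real n * ln 2" by (intro mult_left_mono ln2_ge_two_thirds) auto
            moreover have "x / 2 - y / 16 \<le> A - (y + x) / 16" if "x * (2 / 3) \<le> A" "0 \<le> x" for x y A :: real
              using that by (simp add: field_simps)
            ultimately have "real n / 2 - real j0 / 16 \<le> real n * ln 2 - (real j0 + real n) / 16" by simp
            then show ?thesis by (simp only: exp_le_cancel_iff)
          qed
          also have "\<dots> = 2 ^ n * exp (- ((real j0 + real n) / 16))"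
            unfolding exp_diff exp_minus divide_inverse by (simp add: exp_of_nat_mult)
          finally have "gauss_c * exp (real n / 2 - real j0 / 16)
            \<le> gauss_c * (2 ^ n * exp (- ((real j0 + real n) / 16)))"
            using gauss_c_pos by (intro mult_left_mono) auto
          then show ?thesis unfolding c sq by (simp add: mult_ac)
        qed
        finally show ?thesis .
      qed
      have "((\<lambda>x::real. exp (- (gauss_c * exp (x / 2 - real j0 / 16)))) \<longlongrightarrow> 0) at_top"
        using gauss_c_pos by real_asymp
      from filterlim_compose[OF this filterlim_real_sequentially]
      have "(\<lambda>n. exp (- (gauss_c * exp (real n / 2 - real j0 / 16)))) \<longlonglongrightarrow> 0" .
      then have "(\<lambda>n. prob (?A n)) \<longlonglongrightarrow> 0"
        by (rule tendsto_sandwich[OF _ _ tendsto_const, rotated 2]) (use le in auto)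
      from LIMSEQ_ignore_initial_segment[OF this, of J]
      show "(\<lambda>n. prob (?A (n + J))) \<longlonglongrightarrow> 0" .
    qed
  qed
  then show ?thesis by (simp add: AE_all_countable)
qed

subsection \<open>Slow points\<close>

text \<open>\<open>\<kappa>\<close> indexes the octal interval from \<open>\<kappa> / 8 ^ n\<close> to \<open>(\<kappa> + 1) / 8 ^ n\<close>. Only the children \<open>1\<close> and \<open>5\<close> are
  kept in the tree, because the exclusion events of their subtrees involve disjoint sets of
  coefficients and are therefore independent.\<close>

definition excluded :: "real \<Rightarrow> real \<Rightarrow> nat \<Rightarrow> int \<Rightarrow> 'w set" where
  "excluded p C n \<kappa> = {\<omega> \<in> space M. \<exists>i k. (\<kappa> - 1) * 2 ^ i \<le> k \<and> k < (\<kappa> + 2) * 2 ^ i \<and>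
     C * 2 powr (p * real i) < \<bar>\<epsilon> (int (3 * n + i)) k \<omega>\<bar>}"

text \<open>Percolation on a binary tree: some path through m further generations below \<kappa>
  meets no excluded vertex.\<close>

fun surviving :: "real \<Rightarrow> real \<Rightarrow> nat \<Rightarrow> nat \<Rightarrow> int \<Rightarrow> 'w set" where
  "surviving p C 0 n \<kappa> = space M - excluded p C n \<kappa>"
| "surviving p C (Suc m) n \<kappa> = (space M - excluded p C n \<kappa>) \<inter>
     (surviving p C m (Suc n) (8 * \<kappa> + 1) \<union> surviving p C m (Suc n) (8 * \<kappa> + 5))"

text \<open>The coefficients inspected by \<open>excluded\<close>: all finer levels over the
  interval and its two neighbours, and so everything inspected by later generations.\<close>

definition region :: "nat \<Rightarrow> int \<Rightarrow> (int \<times> int) set" where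
  "region n \<kappa> = {(int (3 * n + i), k) | i k. (\<kappa> - 1) * 2 ^ i \<le> k \<and> k < (\<kappa> + 2) * 2 ^ i}"

definition gens :: "int \<times> int \<Rightarrow> 'w set set" where
  "gens i = {X i -` A \<inter> space M | A. A \<in> sets borel}"

text \<open>Survival events are built recursively, so they are tracked through the sigma-algebra of
  the coefficients they depend on rather than through a formula.\<close>

definition region_algebra :: "(int \<times> int) set \<Rightarrow> 'w measure" where
  "region_algebra R = sigma (space M) (\<Union>i\<in>R. gens i)"

lemma gens_subset: "(\<Union>i\<in>R. gens i) \<subseteq> Pow (space M)"
  by (auto simp: gens_def)

lemma sets_region_algebra: "sets (region_algebra R) = sigma_sets (space M) (\<Union>i\<in>R. gens i)"
  unfolding region_algebra_def by (rule sets_measure_of[OF gens_subset])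

lemma space_region_algebra: "space (region_algebra R) = space M"
  unfolding region_algebra_def by (rule space_measure_of[OF gens_subset])

lemma region_algebra_mono: "R \<subseteq> R' \<Longrightarrow> sets (region_algebra R) \<subseteq> sets (region_algebra R')"
  unfolding sets_region_algebra by (intro sigma_sets_mono') auto

lemma region_algebra_events: "sets (region_algebra R) \<subseteq> events"
proof -
  have "(\<Union>i\<in>R. gens i) \<subseteq> events"
  proof safe
    fix a j k assume "a \<in> gens (j, k)"
    then show "a \<in> events" using eps_measurable[of j k] by (auto simp: gens_def measurable_sets)
  qed
  then show ?thesis unfolding sets_region_algebra by (rule sets.sigma_sets_subset)
qed

lemma excluded_region: "excluded p C n \<kappa> \<in> sets (region_algebra (region n \<kappa>))"
proof -
  let ?I = "{(i, k). (\<kappa> - 1) * 2 ^ i \<le> k \<and> k < (\<kappa> + 2) * 2 ^ i}"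
  have "excluded p C n \<kappa>
    = (\<Union>(i, k)\<in>?I. \<epsilon> (int (3 * n + i)) k -` {x. C * 2 powr (p * real i) < \<bar>x\<bar>} \<inter> space M)"
    by (auto simp: excluded_def)
  also have "\<dots> \<in> sets (region_algebra (region n \<kappa>))"
  proof (rule sets.countable_UN'')
    fix x assume x: "x \<in> ?I"
    obtain i k where ik: "x = (i, k)" by (cases x)
    have "\<epsilon> (int (3 * n + i)) k -` {x. C * 2 powr (p * real i) < \<bar>x\<bar>} \<inter> space M \<in> gens (int (3 * n + i), k)"
      unfolding gens_def by (auto intro!: exI[of _ "{x. C * 2 powr (p * real i) < \<bar>x\<bar>}"])
    moreover have "(int (3 * n + i), k) \<in> region n \<kappa>" using x ik by (auto simp: region_def)
    ultimately show "(case x of (i, k) \<Rightarrow> \<epsilon> (int (3 * n + i)) k -` {x. C * 2 powr (p * real i)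
      < \<bar>x\<bar>} \<inter> space M) \<in> sets (region_algebra (region n \<kappa>))"
      unfolding sets_region_algebra ik by (auto intro: sigma_sets.Basic)
  qed auto
  finally show ?thesis .
qed

text \<open>Child c inspects the block from 8 \<kappa> + c - 1 to 8 \<kappa> + c + 2. For c = 1 and
  c = 5 these are [8 \<kappa>, 8 \<kappa> + 3) and [8 \<kappa> + 4, 8 \<kappa> + 7): disjoint and
  inside the block of the parent. A generation is three dyadic levels, whence i + 3.\<close>

lemma region_children:
  "region (Suc n) (8 * \<kappa> + 1) \<subseteq> region n \<kappa>" "region (Suc n) (8 * \<kappa> + 5) \<subseteq> region n \<kappa>"
  "region (Suc n) (8 * \<kappa> + 1) \<inter> region (Suc n) (8 * \<kappa> + 5) = {}"
proof -
  have "(int (3 * Suc n + i), k) \<in> region n \<kappa>"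
    if "(8 * \<kappa> + c - 1) * 2 ^ i \<le> k" "k < (8 * \<kappa> + c + 2) * 2 ^ i" "1 \<le> c" "c \<le> 5" for i k c
  proof -
    have "(\<kappa> - 1) * 2 ^ (i + 3) \<le> (8 * \<kappa> + c - 1) * 2 ^ i"
      using that by (simp add: power_add)
    moreover have "(8 * \<kappa> + c + 2) * 2 ^ i \<le> (\<kappa> + 2) * 2 ^ (i + 3)"
      using that mult_right_mono[of "8 * \<kappa> + c + 2" "8 * (\<kappa> + 2)" "2 ^ i"] by (simp add: power_add mult_ac)
    ultimately have "(\<kappa> - 1) * 2 ^ (i + 3) \<le> k" "k < (\<kappa> + 2) * 2 ^ (i + 3)" using that by linarith+
    moreover have "int (3 * Suc n + i) = int (3 * n + (i + 3))" by simp
    ultimately show ?thesis unfolding region_def by blast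
  qed
  from this[of 1] this[of 5] show "region (Suc n) (8 * \<kappa> + 1) \<subseteq> region n \<kappa>" "region (Suc n) (8 * \<kappa>
    + 5) \<subseteq> region n \<kappa>"
    unfolding region_def[of "Suc n"] by auto
  show "region (Suc n) (8 * \<kappa> + 1) \<inter> region (Suc n) (8 * \<kappa> + 5) = {}"
  proof -
    have le: "(8 * \<kappa> + 3) * 2 ^ i \<le> (8 * \<kappa> + 4) * (2::int) ^ i" for i by (intro mult_right_mono) auto
    show ?thesis
    proof (rule equals0I)
      fix x assume x: "x \<in> region (Suc n) (8 * \<kappa> + 1) \<inter> region (Suc n) (8 * \<kappa> + 5)"
      then obtain i k where 1: "x = (int (3 * Suc n + i), k)" "k < (8 * \<kappa> + 1 + 2) * 2 ^ i"
        unfolding region_def by blast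
      from x obtain i' k' where 2: "x = (int (3 * Suc n + i'), k')" "(8 * \<kappa> + 5 - 1) * 2 ^ i' \<le> k'"
        unfolding region_def by blast
      have "i' = i" "k' = k" using 1(1) 2(1) by auto
      moreover have "8 * \<kappa> + 1 + 2 = 8 * \<kappa> + 3" "8 * \<kappa> + 5 - 1 = 8 * \<kappa> + 4" by simp_all
      ultimately show False using 1(2) 2(2) le[of i] by (metis not_le order_trans)
    qed
  qed
qed

lemma surviving_region: "surviving p C m n \<kappa> \<in> sets (region_algebra (region n \<kappa>))"
proof (induction m arbitrary: n \<kappa>)
  case 0
  show ?case using sets.Diff[OF sets.top excluded_region[of p C n \<kappa>]] by (simp add: space_region_algebra)
next
  case (Suc m)
  have "space M - excluded p C n \<kappa> \<in> sets (region_algebra (region n \<kappa>))"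
    using sets.Diff[OF sets.top excluded_region[of p C n \<kappa>]] by (simp add: space_region_algebra)
  moreover have "surviving p C m (Suc n) (8 * \<kappa> + 1) \<in> sets (region_algebra (region n \<kappa>))"
    by (rule subsetD[OF region_algebra_mono[OF region_children(1)] Suc.IH])
  moreover have "surviving p C m (Suc n) (8 * \<kappa> + 5) \<in> sets (region_algebra (region n \<kappa>))"
    by (rule subsetD[OF region_algebra_mono[OF region_children(2)] Suc.IH])
  ultimately show ?case unfolding surviving.simps(2) by (intro sets.Int sets.Un)
qed

lemma surviving_event [measurable]: "surviving p C m n \<kappa> \<in> events"
  by (rule subsetD[OF region_algebra_events surviving_region])

lemma excluded_event [measurable]: "excluded p C n \<kappa> \<in> events"
  by (rule subsetD[OF region_algebra_events excluded_region])

lemma region_independence: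
  assumes R: "R1 \<inter> R2 = {}" and A: "A \<in> sets (region_algebra R1)" and B: "B \<in> sets (region_algebra R2)"
  shows "prob (A \<inter> B) = prob A * prob B"
proof -
  let ?I = "\<lambda>b. if b then R1 else R2"
  have "indep_sets gens UNIV" using indep unfolding indep_vars_def2 gens_def by simp
  then have i: "indep_sets gens (\<Union>b\<in>UNIV. ?I b)" by (rule indep_sets_mono_index[rotated]) simp
  have "indep_sets (\<lambda>b. sigma_sets (space M) (\<Union>i\<in>?I b. gens i)) UNIV"
  proof (rule indep_sets_collect_sigma[OF i])
    show "Int_stable (gens i)" for i
    proof (rule Int_stableI)
      fix a b assume "a \<in> gens i" "b \<in> gens i"
      then obtain A B where "a = X i -` A \<inter> space M" "b = X i -` B \<inter> space M" "A \<in> sets borel" "B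
        \<in> sets borel"
        by (auto simp: gens_def)
      then show "a \<inter> b \<in> gens i" unfolding gens_def by (intro CollectI exI[of _ "A \<inter> B"]) auto
    qed
    show "disjoint_family_on ?I UNIV" using R by (auto simp: disjoint_family_on_def)
  qed
  from indep_setsD[OF this, of UNIV "\<lambda>b. if b then A else B"] A B
  show ?thesis unfolding sets_region_algebra by (simp add: UNIV_bool Int_commute mult.commute)
qed

text \<open>Depth i holds 3 * 2^i coefficients, and a Gaussian tail at C 2^(p i) is below any power
  of its argument. A power N with p N > 1 yields 4^(-i), so the sum over i converges uniformly in n
  and \<kappa> and vanishes as C grows.\<close>

lemma prob_excluded_small:
  assumes p: "0 < p" and \<eta>: "0 < \<eta>"
  shows "\<exists>C0>0. \<forall>C\<ge>C0. \<forall>n \<kappa>. prob (excluded p C n \<kappa>) \<le> \<eta>"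
proof -
  obtain N :: nat where N: "1 / p < real N" using reals_Archimedean2 by blast
  then have N0: "N > 0" using p by (cases N) auto
  have pN: "1 < p * real N" using N p by (simp add: field_simps)
  \<comment> \<open>Makes (4 N / C^2)^N at most \<eta> / (6 sqrt 2): 3 is the number of blocks, 2
    the geometric sum, sqrt 2 the tail constant.\<close>
  define C0 where "C0 = sqrt (4 * real N * (1 + 6 * sqrt 2 / \<eta>))"
  have q: "1 + 6 * sqrt 2 / \<eta> > 1" using \<eta> by simp
  then have C0: "C0 > 0" unfolding C0_def using N0 by auto
  show ?thesis
  proof (intro exI[of _ C0] conjI allI impI C0)
    fix C :: real and n :: nat and \<kappa> :: int assume C: "C \<ge> C0"
    then have Cpos: "C > 0" using C0 by simp
    let ?B = "\<lambda>i k. {\<omega> \<in> space M. C * 2 powr (p * real i) < \<bar>\<epsilon> (int (3 * n + i)) k \<omega>\<bar>}"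
    let ?K = "\<lambda>i::nat. {(\<kappa> - 1) * 2 ^ i ..< (\<kappa> + 2) * 2 ^ i}"
    let ?A = "\<lambda>i. \<Union>k\<in>?K i. ?B i k"
    let ?y = "(4 * real N / C\<^sup>2) ^ N"
    have eq: "excluded p C n \<kappa> = (\<Union>i. ?A i)"
    proof (intro set_eqI iffI)
      fix \<omega> assume "\<omega> \<in> excluded p C n \<kappa>"
      then obtain i k where ik: "\<omega> \<in> ?B i k" "(\<kappa> - 1) * 2 ^ i \<le> k" "k < (\<kappa> + 2) * 2 ^ i"
        unfolding excluded_def by blast
      then have "k \<in> ?K i" by simp
      with ik(1) show "\<omega> \<in> (\<Union>i. ?A i)" by blast
    next
      fix \<omega> assume "\<omega> \<in> (\<Union>i. ?A i)"
      then obtain i k where "k \<in> ?K i" "\<omega> \<in> ?B i k" by blast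
      then show "\<omega> \<in> excluded p C n \<kappa>" unfolding excluded_def by auto
    qed
    have Am: "?A i \<in> events" for i by (intro sets.finite_UN) auto
    have y: "?y \<le> \<eta> / (6 * sqrt 2)"
    proof -
      have "C0\<^sup>2 \<le> C\<^sup>2" using C C0 by (intro power_mono) auto
      then have c2: "4 * real N * (1 + 6 * sqrt 2 / \<eta>) \<le> C\<^sup>2" unfolding C0_def using q by simp
      have "4 * real N / C\<^sup>2 \<le> 1 / (1 + 6 * sqrt 2 / \<eta>)"
        using c2 Cpos q by (simp add: field_simps)
      then have "?y \<le> (1 / (1 + 6 * sqrt 2 / \<eta>)) ^ N" by (intro power_mono) auto
      also have "\<dots> \<le> (1 / (1 + 6 * sqrt 2 / \<eta>)) ^ 1" using q N0 by (intro power_decreasing) auto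
      also have "\<dots> \<le> 1 / (6 * sqrt 2 / \<eta>)"
      proof -
        have "1 / (1 + z) \<le> 1 / z" if "z > 0" for z :: real using that by (simp add: frac_le)
        from this[of "6 * sqrt 2 / \<eta>"] \<eta> show ?thesis by simp
      qed
      finally show ?thesis by simp
    qed
    have Ale: "prob (?A i) \<le> 3 * sqrt 2 * ?y * (1 / 2) ^ i" for i
    proof -
      let ?u = "C * 2 powr (p * real i)"
      have B: "prob (?B i k) \<le> sqrt 2 * (?y * (1 / 4) ^ i)" for k
      proof -
        define x where "x = ?u\<^sup>2 / 4"
        have x: "x > 0" using Cpos by (simp add: x_def)
        have "exp (- x) \<le> (real N / x) ^ N"
        proof -
          have "(x / real N) ^ N \<le> (1 + x / real N) ^ N" using x by (intro power_mono) auto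
          also have "\<dots> \<le> exp x" using exp_ge_one_plus_x_over_n_power_n[of N x] N0 x by simp
          finally have "1 / exp x \<le> 1 / (x / real N) ^ N" using x N0 by (intro divide_left_mono) auto
          then show ?thesis by (simp add: exp_minus inverse_eq_divide power_divide)
        qed
        also have "real N / x = 4 * real N / C\<^sup>2 * (1 / 2 powr (2 * p * real i))"
        proof -
          have "(2 powr (p * real i))\<^sup>2 = 2 powr (2 * p * real i)"
            by (simp add: power2_eq_square mult.assoc flip: powr_add)
          then show ?thesis using Cpos by (simp add: x_def power_mult_distrib)
        qed
        also have "(4 * real N / C\<^sup>2 * (1 / 2 powr (2 * p * real i))) ^ N
          = ?y * (1 / 2 powr (2 * p * real i)) ^ N"
          by (rule power_mult_distrib)
        also have "\<dots> \<le> ?y * (1 / 4) ^ i"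
        proof (rule mult_left_mono)
          have "(2 powr z) ^ N = 2 powr (real N * z)" for z :: real
            by (simp add: powr_powr mult.commute flip: powr_realpow)
          then have "(1 / 2 powr (2 * p * real i)) ^ N = 1 / 2 powr (real N * (2 * p * real i))"
            by (simp only: power_divide power_one)
          also have "real N * (2 * p * real i) = 2 * (p * real N) * real i" by simp
          finally have "(1 / 2 powr (2 * p * real i)) ^ N = 1 / 2 powr (2 * (p * real N) * real i)" .
          also have "\<dots> \<le> 1 / 2 powr (2 * 1 * real i)"
            using pN by (intro divide_left_mono powr_mono mult_right_mono) auto
          also have "2 powr (2 * 1 * real i) = (4::real) ^ i"
            by (simp flip: powr_powr powr_realpow)
          finally show "(1 / 2 powr (2 * p * real i)) ^ N \<le> (1 / 4) ^ i" by (simp add: power_divide)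
        qed simp
        finally have "sqrt 2 * exp (- x) \<le> sqrt 2 * (?y * (1 / 4) ^ i)" by simp
        moreover have "prob (?B i k) \<le> sqrt 2 * exp (- x)"
          using prob_large_le[of ?u "int (3 * n + i)" k] Cpos by (simp add: x_def)
        ultimately show ?thesis by linarith
      qed
      have "prob (?A i) \<le> (\<Sum>k\<in>?K i. prob (?B i k))" by (intro measure_UNION_le) auto
      also have "\<dots> \<le> (\<Sum>k\<in>?K i. sqrt 2 * (?y * (1 / 4) ^ i))" by (intro sum_mono B)
      also have "\<dots> = real (card (?K i)) * (sqrt 2 * (?y * (1 / 4) ^ i))" by simp
      also have "card (?K i) = 3 * 2 ^ i"
      proof -
        have "(\<kappa> + 2) * 2 ^ i - (\<kappa> - 1) * 2 ^ i = int (3 * 2 ^ i)" by (simp add: algebra_simps)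
        then show ?thesis unfolding card_atLeastLessThan_int by (simp only: nat_int)
      qed
      also have "real (3 * 2 ^ i) * (sqrt 2 * (?y * (1 / 4) ^ i)) = 3 * sqrt 2 * ?y * (2 * (1 / 4)) ^ i"
        unfolding power_mult_distrib[of 2] by simp
      finally show ?thesis by simp
    qed
    have gs: "(\<lambda>i. 3 * sqrt 2 * ?y * (1 / 2) ^ i) sums (3 * sqrt 2 * ?y * 2)"
      using geometric_sums[of "1 / 2 :: real"] by (intro sums_mult) simp
    have sm: "summable (\<lambda>i. prob (?A i))"
      by (rule summable_comparison_test[OF _ sums_summable[OF gs]]) (use Ale in \<open>auto intro!: exI[of _ 0]\<close>)
    have "prob (excluded p C n \<kappa>) \<le> (\<Sum>i. prob (?A i))"
      unfolding eq by (rule finite_measure_subadditive_countably[OF _ sm]) (use Am in auto)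
    also have "\<dots> \<le> 3 * sqrt 2 * ?y * 2"
      using suminf_le[OF Ale sm sums_summable[OF gs]] sums_unique[OF gs] by simp
    also have "\<dots> = 6 * sqrt 2 * ?y" by simp
    also have "\<dots> \<le> \<eta>" using mult_left_mono[OF y, of "6 * sqrt 2"] by simp
    finally show "prob (excluded p C n \<kappa>) \<le> \<eta>" .
  qed
qed

text \<open>If \<open>q\<close> bounds the exclusion probability and \<open>f\<close> the failure probability of the two independent
  subtrees, failure has probability at most \<open>q + f\<^sup>2\<close>, and \<open>f = 2 * q\<close> is preserved.\<close>

lemma prob_not_surviving:
  assumes q: "\<And>n \<kappa>. prob (excluded p C n \<kappa>) \<le> q" "0 \<le> q" "q \<le> 1 / 4"
  shows "prob (space M - surviving p C m n \<kappa>) \<le> 2 * q"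
proof (induction m arbitrary: n \<kappa>)
  case 0
  have "space M - (space M - excluded p C n \<kappa>) = excluded p C n \<kappa>" by (auto simp: excluded_def)
  then show ?case using q(1)[of n \<kappa>] q(2) by simp
next
  case (Suc m)
  let ?A = "space M - surviving p C m (Suc n) (8 * \<kappa> + 1)"
    and ?B = "space M - surviving p C m (Suc n) (8 * \<kappa> + 5)"
  have AB: "?A \<in> sets (region_algebra (region (Suc n) (8 * \<kappa> + 1)))" "?B
    \<in> sets (region_algebra (region (Suc n) (8 * \<kappa> + 5)))"
    using sets.compl_sets[OF surviving_region[of p C m "Suc n" "8 * \<kappa> + 1"]] sets.compl_sets[OF
      surviving_region[of p C m "Suc n" "8 * \<kappa> + 5"]]
    by (simp_all add: space_region_algebra)
  have "prob (space M - surviving p C (Suc m) n \<kappa>) \<le> prob (excluded p C n \<kappa> \<union> (?A \<inter> ?B))"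
    by (intro finite_measure_mono) auto
  also have "\<dots> \<le> prob (excluded p C n \<kappa>) + prob (?A \<inter> ?B)"
    by (intro measure_Un_le) auto
  also have "prob (?A \<inter> ?B) = prob ?A * prob ?B"
    by (rule region_independence[OF region_children(3) AB])
  also have "prob (excluded p C n \<kappa>) + prob ?A * prob ?B \<le> q + (2 * q) * (2 * q)"
    using q by (intro add_mono mult_mono Suc.IH) auto
  also have "\<dots> \<le> q + (2 * q) * (1 / 2)" using q by (intro add_left_mono mult_left_mono) auto
  finally show ?case by simp
qed

lemma surviving_antimono: "surviving p C (Suc m) n \<kappa> \<subseteq> surviving p C m n \<kappa>"
proof (induction m arbitrary: n \<kappa>)
  case (Suc m)
  show ?case
    unfolding surviving.simps(2)[of p C "Suc m" n \<kappa>] surviving.simps(2)[of p C m n \<kappa>]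
    by (intro Int_mono Un_mono Suc.IH subset_refl)
qed auto

lemma surviving_decseq: "decseq (\<lambda>m. surviving p C m n \<kappa>)"
  by (intro decseq_SucI surviving_antimono)

text \<open>For a fixed C survival is only likely. Failure has probability tending to 0 as C grows,
  so almost surely some C, depending on the sample and the vertex, serves all generations.\<close>

lemma AE_surviving:
  assumes p: "0 < p"
  shows "AE \<omega> in M. \<forall>n \<kappa>. \<exists>C. \<forall>m. \<omega> \<in> surviving p C m n \<kappa>"
proof -
  have "AE \<omega> in M. \<exists>C. \<forall>m. \<omega> \<in> surviving p C m n \<kappa>" for n \<kappa>
  proof -
    have ex: "\<exists>C. prob (space M - (\<Inter>m. surviving p C m n \<kappa>)) \<le> 1 / real (Suc l)" for l
    proof -
      define q where "q = 1 / (4 * real (Suc l))"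
      have q: "0 < q" "q \<le> 1 / 4" "2 * q \<le> 1 / real (Suc l)" by (auto simp: q_def field_simps)
      obtain C where C: "\<And>n \<kappa>. prob (excluded p C n \<kappa>) \<le> q"
        using prob_excluded_small[OF p q(1)] by blast
      have lim: "(\<lambda>m. prob (surviving p C m n \<kappa>)) \<longlonglongrightarrow> prob (\<Inter>m. surviving p C m n \<kappa>)"
        by (rule finite_Lim_measure_decseq[OF _ surviving_decseq]) auto
      have ge: "1 - 2 * q \<le> prob (surviving p C m n \<kappa>)" for m
        using prob_not_surviving[OF C _ q(2), of m n \<kappa>] q prob_compl[OF surviving_event[of p C m n \<kappa>]] by simp
      have "1 - 2 * q \<le> prob (\<Inter>m. surviving p C m n \<kappa>)"
        by (rule LIMSEQ_le_const[OF lim]) (use ge in auto)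
      moreover have "(\<Inter>m. surviving p C m n \<kappa>) \<in> events" by (intro sets.countable_INT) auto
      ultimately have "prob (space M - (\<Inter>m. surviving p C m n \<kappa>)) \<le> 1 / real (Suc l)"
        using q by (simp add: prob_compl)
      then show ?thesis by blast
    qed
    then obtain c where c: "\<And>l. prob (space M - (\<Inter>m. surviving p (c l) m n \<kappa>)) \<le> 1 / real (Suc l)" by metis
    show ?thesis
    proof (rule AE_by_small_cover[where A = "\<lambda>l. space M - (\<Inter>m. surviving p (c l) m n \<kappa>)"])
      show "space M - (\<Inter>m. surviving p (c l) m n \<kappa>) \<in> events" for l
        by (intro sets.compl_sets sets.countable_INT) auto
      have "(\<lambda>l. 1 / real (Suc l)) \<longlonglongrightarrow> 0" using LIMSEQ_inverse_real_of_nat by (simp add: inverse_eq_divide)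
      then show "(\<lambda>l. prob (space M - (\<Inter>m. surviving p (c l) m n \<kappa>))) \<longlonglongrightarrow> 0"
        by (rule tendsto_sandwich[OF _ _ tendsto_const, rotated 2]) (use c in auto)
    qed (auto intro: prob_space_axioms)
  qed
  then show ?thesis by (simp add: AE_all_countable)
qed

text \<open>Only offsets with |l| below 2^(j - 3 n), that is within 8^(-n) of t, are controlled,
  since the tree starts at level n. Further coefficients are left to the global growth.\<close>

definition slow_coefficients :: "real \<Rightarrow> 'w \<Rightarrow> real \<Rightarrow> bool" where
  "slow_coefficients p \<omega> t \<longleftrightarrow> (\<exists>n C. \<forall>j\<ge>3 * n. \<forall>l. 1 + \<bar>real_of_int l\<bar> \<le> 2 ^ (j - 3 * n) \<longrightarrow>
     \<bar>\<epsilon> (int j) (\<lfloor>2 ^ j * t\<rfloor> + l) \<omega>\<bar> \<le> C * (1 + \<bar>real_of_int l\<bar>) powr p)"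

lemma surviving_not_excluded: "\<omega> \<in> surviving p C m n \<kappa> \<Longrightarrow> \<omega> \<in> space M \<and> \<omega> \<notin> excluded p C n \<kappa>"
  by (cases m) auto

text \<open>Koenig's lemma for two children: survival is monotone in m, so if each child failed at
  some depth, both would fail at the larger one.\<close>

lemma surviving_path:
  assumes "\<forall>m. \<omega> \<in> surviving p C m n \<kappa>"
  obtains \<kappa>' where "\<kappa>' = 8 * \<kappa> + 1 \<or> \<kappa>' = 8 * \<kappa> + 5" "\<forall>m. \<omega> \<in> surviving p C m (Suc n) \<kappa>'"
proof -
  let ?S = "\<lambda>m c. \<omega> \<in> surviving p C m (Suc n) (8 * \<kappa> + c)"
  have or: "?S m 1 \<or> ?S m 5" for m using spec[OF assms, of "Suc m"] by auto
  have down: "?S m' c \<Longrightarrow> m \<le> m' \<Longrightarrow> ?S m c" for m m' c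
    using surviving_decseq[of p C "Suc n" "8 * \<kappa> + c"] by (auto simp: decseq_def)
  have "(\<forall>m. ?S m 1) \<or> (\<forall>m. ?S m 5)"
  proof (rule ccontr)
    assume "\<not> ((\<forall>m. ?S m 1) \<or> (\<forall>m. ?S m 5))"
    then obtain m1 m2 where "\<not> ?S m1 1" "\<not> ?S m2 5" by blast
    then have "\<not> ?S (max m1 m2) 1" "\<not> ?S (max m1 m2) 5" using down by (meson max.cobounded1 max.cobounded2)+
    then show False using or by blast
  qed
  then show thesis using that by blast
qed

text \<open>An infinite path defines nested intervals shrinking to t. Given j and l, take the
  deepest vertex for which 2^d \<ge> 1 + |l|, where d is the number of levels from it to j: then 2^d
  is comparable with 1 + |l|, and nonexclusion of this vertex gives the bound.\<close>

lemma slow_point: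
  assumes p: "0 < p" and S: "\<forall>m. \<omega> \<in> surviving p C m n \<kappa>"
  shows "\<exists>t. real_of_int \<kappa> / 8 ^ n \<le> t \<and> t \<le> (real_of_int \<kappa> + 1) / 8 ^ n \<and> slow_coefficients p \<omega> t"
proof -
  have "\<exists>f. \<forall>i. ((\<forall>m. \<omega> \<in> surviving p C m (n + i) (f i)) \<and> (i = 0 \<longrightarrow> f i = \<kappa>))
    \<and> (f (Suc i) = 8 * f i + 1 \<or> f (Suc i) = 8 * f i + 5)"
  proof (rule dependent_nat_choice)
    show "\<exists>x. (\<forall>m. \<omega> \<in> surviving p C m (n + 0) x) \<and> (0 = (0::nat) \<longrightarrow> x = \<kappa>)" using S by auto
    fix x i assume "(\<forall>m. \<omega> \<in> surviving p C m (n + i) x) \<and> (i = 0 \<longrightarrow> x = \<kappa>)"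
    then obtain y where "y = 8 * x + 1 \<or> y = 8 * x + 5" "\<forall>m. \<omega> \<in> surviving p C m (Suc (n + i)) y"
      using surviving_path by blast
    then show "\<exists>y. ((\<forall>m. \<omega> \<in> surviving p C m (n + Suc i) y) \<and> (Suc i = 0 \<longrightarrow> y = \<kappa>))
      \<and> (y = 8 * x + 1 \<or> y = 8 * x + 5)"
      by auto
  qed
  then obtain f where f: "\<And>i. ((\<forall>m. \<omega> \<in> surviving p C m (n + i) (f i)) \<and> (i = 0 \<longrightarrow> f i = \<kappa>))
    \<and> (f (Suc i) = 8 * f i + 1 \<or> f (Suc i) = 8 * f i + 5)"
    by blast
  have f0: "f 0 = \<kappa>" and fS: "\<And>i m. \<omega> \<in> surviving p C m (n + i) (f i)"
    and step: "\<And>i. f (Suc i) = 8 * f i + 1 \<or> f (Suc i) = 8 * f i + 5" using f by blast+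
  define a where "a i = real_of_int (f i) / 8 ^ (n + i)" for i
  define b where "b i = (real_of_int (f i) + 1) / 8 ^ (n + i)" for i
  have a_mono: "a i \<le> a (Suc i)" for i
    using step[of i] by (auto simp: a_def field_simps)
  have b_mono: "b (Suc i) < b i" for i
    using step[of i] by (auto simp: b_def field_simps)
  have inc: "incseq a" by (intro incseq_SucI a_mono)
  have dec: "decseq b" by (intro decseq_SucI less_imp_le b_mono)
  have ab: "a i \<le> b i" for i by (simp add: a_def b_def divide_right_mono)
  have ab': "a i \<le> b j" for i j
  proof -
    have "a i \<le> a (max i j)" using inc by (simp add: incseq_def)
    also have "\<dots> \<le> b (max i j)" by (rule ab)
    also have "\<dots> \<le> b j" using dec by (simp add: decseq_def)
    finally show ?thesis .
  qed
  define t where "t = (SUP i. a i)"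
  have bdd: "bdd_above (range a)" using ab'[of _ 0] by (intro bdd_aboveI[of _ "b 0"]) auto
  have ta: "a i \<le> t" for i unfolding t_def by (intro cSUP_upper bdd) simp
  have tb: "t \<le> b i" for i unfolding t_def by (intro cSUP_least) (auto intro: ab')
  \<comment> \<open>Strictness comes from never taking the last child; otherwise \<lfloor>2^j
    t\<rfloor> could fall into the next interval.\<close>
  have tb': "t < b i" for i using tb[of "Suc i"] b_mono[of i] by simp
  have "slow_coefficients p \<omega> t"
    unfolding slow_coefficients_def
  proof (intro exI[of _ n] exI[of _ "C * 8 powr p"] allI impI)
    fix j l assume j: "3 * n \<le> j" and l: "1 + \<bar>real_of_int l\<bar> \<le> 2 ^ (j - 3 * n)"
    define r where "r = j - 3 * n"
    \<comment> \<open>C bounds the absolute value of a coefficient.\<close>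
    have C0: "0 \<le> C"
    proof -
      have "\<omega> \<in> space M" "\<omega> \<notin> excluded p C (n + 0) (f 0)" using surviving_not_excluded[OF fS[of 0 0]] by auto
      then have "\<not> ((f 0 - 1) * 2 ^ 0 \<le> f 0 \<and> f 0 < (f 0 + 2) * 2 ^ 0 \<and>
        C * 2 powr (p * real 0) < \<bar>\<epsilon> (int (3 * (n + 0) + 0)) (f 0) \<omega>\<bar>)"
        unfolding excluded_def by blast
      then have "\<bar>\<epsilon> (int (3 * n)) (f 0) \<omega>\<bar> \<le> C" by simp
      then show ?thesis using abs_ge_zero order_trans by blast
    qed
    define P where "P i \<longleftrightarrow> 3 * i \<le> r \<and> 1 + \<bar>real_of_int l\<bar> \<le> 2 ^ (r - 3 * i)" for i
    have P0: "P 0" using l by (simp add: P_def r_def)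
    define i where "i = (GREATEST i. P i)"
    have Pb: "P k \<Longrightarrow> k \<le> r" for k by (auto simp: P_def)
    have Pi: "P i" unfolding i_def by (rule GreatestI_nat[where P = P and b = r, OF P0]) (rule Pb)
    have nPi: "\<not> P (Suc i)"
      using Greatest_le_nat[of P "Suc i" r] Pb unfolding i_def by fastforce
    define d where "d = r - 3 * i"
    have jd: "j = 3 * (n + i) + d" using Pi j by (auto simp: P_def d_def r_def)
    have ld: "1 + \<bar>real_of_int l\<bar> \<le> 2 ^ d" using Pi by (simp add: P_def d_def)
    \<comment> \<open>Maximality of i leaves less than one generation to spare, hence the factor
      8.\<close>
    have d8: "2 ^ d \<le> 8 * (1 + \<bar>real_of_int l\<bar>)"
    proof (cases "d \<le> 3")
      case True
      then have "(2::real) ^ d \<le> 2 ^ 3" by (intro power_increasing) auto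
      then show ?thesis by simp
    next
      case False
      then have "3 * Suc i \<le> r" by (auto simp: d_def)
      moreover have "r - 3 * Suc i = d - 3" by (auto simp: d_def)
      ultimately have "2 ^ (d - 3) < 1 + \<bar>real_of_int l\<bar>" using nPi by (auto simp: P_def not_le)
      moreover have "(2::real) ^ d = 8 * 2 ^ (d - 3)" using False by (simp add: power_diff)
      ultimately show ?thesis by simp
    qed
    let ?g = "\<lfloor>2 ^ j * t\<rfloor>"
    have e8: "(2::real) ^ j = 8 ^ (n + i) * 2 ^ d" unfolding jd power_add power_mult by simp
    have g1: "f i * 2 ^ d \<le> ?g"
    proof -
      have "real_of_int (f i) \<le> 8 ^ (n + i) * t" using ta[of i] by (simp add: a_def field_simps)
      then have "real_of_int (f i) * 2 ^ d \<le> 8 ^ (n + i) * t * 2 ^ d" by (rule mult_right_mono) simp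
      then show ?thesis by (simp add: le_floor_iff e8 mult_ac)
    qed
    have g2: "?g < (f i + 1) * 2 ^ d"
    proof -
      have "8 ^ (n + i) * t < real_of_int (f i) + 1" using tb'[of i] by (simp add: b_def field_simps)
      then have "8 ^ (n + i) * t * 2 ^ d < (real_of_int (f i) + 1) * 2 ^ d"
        by (rule mult_strict_right_mono) simp
      then show ?thesis by (simp add: floor_less_iff e8 mult_ac)
    qed
    have l2: "\<bar>l\<bar> \<le> 2 ^ d"
    proof -
      have "real_of_int \<bar>l\<bar> \<le> real_of_int (2 ^ d)" using ld by simp
      then show ?thesis by (simp only: of_int_le_iff)
    qed
    \<comment> \<open>Offsets up to 2^d reach at most the two neighbouring intervals, which is why
      \<open>excluded\<close> inspects three.\<close>
    have k1: "(f i - 1) * 2 ^ d \<le> ?g + l" and k2: "?g + l < (f i + 2) * 2 ^ d"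
      using g1 g2 l2 by (auto simp: algebra_simps abs_le_iff)
    have "\<omega> \<in> space M" "\<omega> \<notin> excluded p C (n + i) (f i)" using surviving_not_excluded[OF fS[of 0 i]] by auto
    then have "\<bar>\<epsilon> (int (3 * (n + i) + d)) (?g + l) \<omega>\<bar> \<le> C * 2 powr (p * real d)"
      using k1 k2 unfolding excluded_def mem_Collect_eq by (meson not_less)
    also have "C * 2 powr (p * real d) \<le> C * 8 powr p * (1 + \<bar>real_of_int l\<bar>) powr p"
    proof -
      have "2 powr (p * real d) = (2 ^ d) powr p" by (simp add: powr_powr mult.commute flip: powr_realpow)
      also have "\<dots> \<le> (8 * (1 + \<bar>real_of_int l\<bar>)) powr p" using d8 p by (intro powr_mono2) auto
      also have "\<dots> = 8 powr p * (1 + \<bar>real_of_int l\<bar>) powr p" by (rule powr_mult)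
      finally show ?thesis using C0 by (simp add: mult.assoc mult_left_mono)
    qed
    finally show "\<bar>\<epsilon> (int j) (?g + l) \<omega>\<bar> \<le> C * 8 powr p * (1 + \<bar>real_of_int l\<bar>) powr p"
      unfolding jd .
  qed
  moreover have "real_of_int \<kappa> / 8 ^ n \<le> t" "t \<le> (real_of_int \<kappa> + 1) / 8 ^ n"
    using ta[of 0] tb[of 0] by (auto simp: a_def b_def f0)
  ultimately show ?thesis by blast
qed

lemma AE_slow_points:
  assumes "0 < p"
  shows "AE \<omega> in M. \<forall>n \<kappa>. \<exists>t. real_of_int \<kappa> / 8 ^ n \<le> t \<and> t \<le> (real_of_int \<kappa> + 1) / 8 ^ n
    \<and> slow_coefficients p \<omega> t"
  using AE_surviving[OF assms] by eventually_elim (metis slow_point[OF assms])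

end

subsection \<open>The three gauges\<close>

lemma neg_ln_le:
  fixes u :: real
  assumes "0 < u" "0 < q"
  shows "- ln u \<le> u powr (- q) / q"
proof (cases "u \<le> 1")
  case True
  have "ln (1 / u) \<le> (1 / u) powr q / q" using True assms by (intro ln_powr_bound) auto
  then show ?thesis using assms by (simp add: ln_div powr_divide powr_minus_divide)
next
  case False
  then have "- ln u \<le> 0" using assms by simp
  also have "0 \<le> u powr (- q) / q" using assms by simp
  finally show ?thesis .
qed

text \<open>The bound is a multiple of a square because the gauges take square roots; for this the
  logarithm of u is estimated with the exponent 2 \<theta>.\<close>

lemma ln_dyadic_scale:
  fixes u \<theta> :: real
  assumes "0 < u" "0 < \<theta>" "1 \<le> j"
  shows "ln (inverse (u / 2 ^ j)) \<le> real j * ((1 + 1 / (2 * \<theta>)) * (1 + u powr (- \<theta>))\<^sup>2)"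
proof -
  have sq: "u powr (- (2 * \<theta>)) = (u powr (- \<theta>))\<^sup>2"
    by (simp add: power2_eq_square flip: powr_add)
  have "ln (inverse (u / 2 ^ j)) = real j * ln 2 - ln u"
    using assms by (simp add: ln_div ln_realpow ln_inverse)
  also have "\<dots> \<le> real j * 1 + u powr (- (2 * \<theta>)) / (2 * \<theta>)"
  proof -
    have "real j * ln 2 \<le> real j * 1" using ln_le_minus_one[of "2::real"] by (intro mult_left_mono) auto
    then show ?thesis using neg_ln_le[of u "2 * \<theta>"] assms by linarith
  qed
  also have "\<dots> \<le> real j * 1 + real j * (u powr (- (2 * \<theta>)) / (2 * \<theta>))"
  proof -
    have "1 * (u powr (- (2 * \<theta>)) / (2 * \<theta>)) \<le> real j * (u powr (- (2 * \<theta>)) / (2 * \<theta>))"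
      using assms by (intro mult_right_mono) auto
    then show ?thesis by linarith
  qed
  also have "\<dots> = real j * (1 + 1 / (2 * \<theta>) * (u powr (- \<theta>))\<^sup>2)"
    unfolding sq by (simp add: algebra_simps)
  also have "\<dots> \<le> real j * ((1 + 1 / (2 * \<theta>)) * (1 + u powr (- \<theta>))\<^sup>2)"
  proof (rule mult_left_mono)
    have "1 \<le> (1 + u powr (- \<theta>))\<^sup>2" "(u powr (- \<theta>))\<^sup>2 \<le> (1 + u powr (- \<theta>))\<^sup>2"
      by (auto intro: power_mono one_le_power)
    then have "1 + c * (u powr (- \<theta>))\<^sup>2 \<le> (1 + u powr (- \<theta>))\<^sup>2 + c * (1 + u powr (- \<theta>))\<^sup>2" if "c \<ge> 0" for c
      using that by (intro add_mono mult_left_mono) auto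
    from this[of "1 / (2 * \<theta>)"] show "1 + 1 / (2 * \<theta>) * (u powr (- \<theta>))\<^sup>2
      \<le> (1 + 1 / (2 * \<theta>)) * (1 + u powr (- \<theta>))\<^sup>2"
      using assms by (simp add: distrib_right)
  qed simp
  finally show ?thesis .
qed

lemma gauge_levelsI:
  assumes "0 < K" "\<And>j. n \<le> j \<Longrightarrow> 1 \<le> g j"
    and "\<And>j u. n \<le> j \<Longrightarrow> 0 < u \<Longrightarrow> u < 2 ^ j \<Longrightarrow> G (u / 2 ^ j) \<le> K * g j * (1 + u powr (- \<theta>))"
  shows "gauge_levels \<theta> G g"
proof -
  have "\<exists>n. \<forall>j\<ge>n. 1 \<le> g j \<and> (\<forall>u>0. u < 2 ^ j * 1 \<longrightarrow> G (u / 2 ^ j) \<le> K * g j * (1 + u powr (- \<theta>)))"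
    using assms(2,3) by (intro exI[of _ n]) auto
  then have "\<exists>\<delta>>0. \<exists>n. \<forall>j\<ge>n. 1 \<le> g j \<and> (\<forall>u>0. u < 2 ^ j * \<delta> \<longrightarrow> G (u / 2 ^ j) \<le> K * g j * (1 + u powr (- \<theta>)))"
    using zero_less_one by blast
  with assms(1) show ?thesis unfolding gauge_levels_def by blast
qed

lemma gauge_levels_rapid:
  assumes "0 < \<theta>"
  shows "gauge_levels \<theta> (\<lambda>h. sqrt (ln (inverse h))) (\<lambda>j. sqrt (real j))"
proof (rule gauge_levelsI[where K = "sqrt (1 + 1 / (2 * \<theta>))" and n = 1])
  show "0 < sqrt (1 + 1 / (2 * \<theta>))" using assms by (simp add: add_pos_nonneg)
  fix j :: nat and u :: real assume j: "1 \<le> j" and u: "0 < u"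
  have "sqrt (ln (inverse (u / 2 ^ j))) \<le> sqrt (real j * ((1 + 1 / (2 * \<theta>)) * (1 + u powr (- \<theta>))\<^sup>2))"
    by (intro real_sqrt_le_mono ln_dyadic_scale u assms j)
  also have "\<dots> = sqrt (1 + 1 / (2 * \<theta>)) * sqrt (real j) * (1 + u powr (- \<theta>))"
    by (simp add: real_sqrt_mult)
  finally show "sqrt (ln (inverse (u / 2 ^ j)))
    \<le> sqrt (1 + 1 / (2 * \<theta>)) * sqrt (real j) * (1 + u powr (- \<theta>))" .
qed auto

lemma ln_3_bounds: "1 \<le> ln (3::real)" "ln (3::real) \<le> 2"
proof -
  have "ln (exp 1) \<le> ln (3::real)" using exp_le by (intro ln_mono) auto
  then show "1 \<le> ln (3::real)" by simp
  show "ln (3::real) \<le> 2" using ln_le_minus_one[of "3::real"] by simp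
qed

text \<open>The inner logarithm is bounded by a product; the logarithm of that product is a sum
  whose terms are all dominated by ln j times a square, once ln j \<ge> 1.\<close>

lemma gauge_levels_ordinary:
  assumes "0 < \<theta>"
  shows "gauge_levels \<theta> (\<lambda>h. sqrt (ln (ln (inverse h)))) (\<lambda>j. sqrt (ln (real j)))"
\<comment> \<open>Levels start at 3 because e < 3 gives ln j \<ge> 1. The 3 in K is 1 for the term
  ln j and 2 for the logarithm of the square.\<close>
proof (rule gauge_levelsI[where K = "sqrt (3 + 1 / (2 * \<theta>))" and n = 3])
  let ?c = "1 + 1 / (2 * \<theta>)"
  show "0 < sqrt (3 + 1 / (2 * \<theta>))" using assms by (simp add: add_pos_nonneg)
  have ln_j: "1 \<le> ln (real j)" if "3 \<le> j" for j
  proof -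
    have "ln 3 \<le> ln (real j)" using that by (intro ln_mono) auto
    then show ?thesis using ln_3_bounds by linarith
  qed
  then show "1 \<le> sqrt (ln (real j))" if "3 \<le> j" for j using that by simp
  fix j :: nat and u :: real assume j3: "3 \<le> j" and u: "0 < u" "u < 2 ^ j"
  have j: "1 \<le> ln (real j)" by (rule ln_j[OF j3])
  let ?w = "1 + u powr (- \<theta>)"
  have w: "1 \<le> ?w" "1 \<le> ?w\<^sup>2" by (auto intro: one_le_power)
  have "1 < inverse (u / 2 ^ j)" using u by (simp add: field_simps)
  then have y: "0 < ln (inverse (u / 2 ^ j))" by (rule ln_gt_zero)
  have "ln (ln (inverse (u / 2 ^ j))) \<le> ln (real j * (?c * ?w\<^sup>2))"
    using y ln_dyadic_scale[OF u(1) assms, of j] j3 by (intro ln_mono) auto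
  also have "\<dots> = ln (real j) + (ln ?c + 2 * ln ?w)"
  proof -
    have c: "?c > 0" using assms by (simp add: add_pos_nonneg)
    have "ln (x * (y * z)) = ln x + (ln y + ln z)" if "0 < x" "0 < y" "0 < z" for x y z :: real
      using that by (simp add: ln_mult_pos)
    from this[OF _ c, of "real j" "?w\<^sup>2"] have "ln (real j * (?c * ?w\<^sup>2)) = ln (real j) + (ln ?c + ln (?w\<^sup>2))"
      using j3 w(2) by linarith
    also have "ln (?w\<^sup>2) = 2 * ln ?w" using w by (simp add: ln_realpow)
    finally show ?thesis .
  qed
  also have "\<dots> \<le> ln (real j) + (1 / (2 * \<theta>) + 2 * ?w\<^sup>2)"
  proof -
    have "ln ?c \<le> 1 / (2 * \<theta>)" using ln_le_minus_one[of ?c] assms by (simp add: add_pos_nonneg)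
    moreover have "ln ?w \<le> ?w" using ln_le_minus_one[of ?w] w by simp
    moreover have "?w \<le> ?w\<^sup>2" using w(1) by (intro self_le_power) auto
    ultimately show ?thesis by simp
  qed
  also have "\<dots> \<le> ln (real j) * ((3 + 1 / (2 * \<theta>)) * ?w\<^sup>2)"
  proof -
    let ?L = "ln (real j)"
    define z where "z = ?L * ?w\<^sup>2"
    have z: "1 \<le> z" using mult_mono[OF j w(2)] j unfolding z_def by simp
    have "1 / (2 * \<theta>) * 1 \<le> 1 / (2 * \<theta>) * z" by (rule mult_left_mono[OF z]) (use assms in simp)
    moreover have "?w\<^sup>2 \<le> z" using mult_right_mono[OF j, of "?w\<^sup>2"] unfolding z_def by simp
    moreover have "?L \<le> z" using mult_left_mono[OF w(2), of ?L] j unfolding z_def by simp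
    moreover have "?L * ((3 + 1 / (2 * \<theta>)) * ?w\<^sup>2) = 3 * z + 1 / (2 * \<theta>) * z"
      unfolding z_def by (simp add: algebra_simps)
    ultimately show ?thesis by linarith
  qed
  finally have "sqrt (ln (ln (inverse (u / 2 ^ j)))) \<le> sqrt (ln (real j) * ((3 + 1 / (2 * \<theta>)) * ?w\<^sup>2))"
    by (rule real_sqrt_le_mono)
  also have "\<dots> = sqrt (3 + 1 / (2 * \<theta>)) * sqrt (ln (real j)) * ?w"
    using w by (simp add: real_sqrt_mult)
  finally show "sqrt (ln (ln (inverse (u / 2 ^ j)))) \<le> sqrt (3 + 1 / (2 * \<theta>)) * sqrt (ln (real j)) * ?w" .
qed

lemma gauge_levels_slow: "gauge_levels \<theta> (\<lambda>h. 1) (\<lambda>j. 1)"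
  by (rule gauge_levelsI[where K = 1 and n = 0]) auto

text \<open>J is the finest level with 2^J h \<le> 1. Then 2^J h > 1/2, which gives the factor 2 in
  the third claim; the last one uses ln 2 \<ge> 1/2.\<close>

lemma dyadic_level:
  assumes "0 < h" "h \<le> 1"
  defines "J \<equiv> \<lfloor>log 2 (1 / h)\<rfloor>"
  shows "0 \<le> J" "dyadic J * h \<le> 1" "0 < \<theta> \<Longrightarrow> \<theta> \<le> 1 \<Longrightarrow> dyadic J powr (- \<theta>) \<le> 2 * h powr \<theta>"
    "real_of_int J \<le> 2 * ln (1 / h)"
proof -
  have l0: "0 \<le> log 2 (1 / h)" using assms by simp
  then show J0: "0 \<le> J" by (simp add: J_def)
  have "dyadic J \<le> 2 powr (log 2 (1 / h))" unfolding dyadic_def J_def by (intro powr_mono) auto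
  also have "\<dots> = 1 / h" using assms by simp
  finally show "dyadic J * h \<le> 1" using assms by (simp add: field_simps)
  have "2 powr (log 2 (1 / h)) \<le> 2 powr (real_of_int J + 1)"
    unfolding J_def by (intro powr_mono) linarith+
  then have le: "1 / dyadic J \<le> 2 * h" using assms by (simp add: powr_add dyadic_def[symmetric] field_simps)
  show "dyadic J powr (- \<theta>) \<le> 2 * h powr \<theta>" if \<theta>: "0 < \<theta>" "\<theta> \<le> 1"
  proof -
    have "dyadic J powr (- \<theta>) = (1 / dyadic J) powr \<theta>" by (simp add: powr_minus_divide powr_divide)
    also have "\<dots> \<le> (2 * h) powr \<theta>" using le \<theta> by (intro powr_mono2) auto
    also have "\<dots> = 2 powr \<theta> * h powr \<theta>" by (rule powr_mult)
    also have "\<dots> \<le> 2 powr 1 * h powr \<theta>" using \<theta> by (intro mult_right_mono powr_mono) auto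
    finally show ?thesis by simp
  qed
  have "real_of_int J \<le> log 2 (1 / h)" by (simp add: J_def)
  also have "\<dots> = ln (1 / h) / ln 2" by (simp add: log_def)
  also have "\<dots> \<le> ln (1 / h) / (1 / 2)"
    using ln2_ge_two_thirds assms by (intro divide_left_mono) auto
  finally show "real_of_int J \<le> 2 * ln (1 / h)" by simp
qed

text \<open>Compares the profile of a local bound, at the level belonging to the distance h, with
  the gauge at h.\<close>

lemma rapid_profile:
  "\<forall>\<^sub>F h in at_right 0. sqrt (1 + \<bar>real_of_int \<lfloor>log 2 (1 / h)\<rfloor>\<bar>) \<le> 2 * sqrt (ln (inverse h))"
proof -
  have "\<forall>\<^sub>F h in at_right (0::real). 1 \<le> ln (inverse h)" by real_asymp
  moreover have "\<forall>\<^sub>F h in at_right (0::real). 0 < h \<and> h \<le> 1"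
    unfolding eventually_at_right_field by (intro exI[of _ 1]) auto
  ultimately show ?thesis
  proof eventually_elim
    case (elim h)
    have "1 + \<bar>real_of_int \<lfloor>log 2 (1 / h)\<rfloor>\<bar> \<le> 4 * ln (inverse h)"
      using dyadic_level(1,4)[of h] elim by (simp add: inverse_eq_divide)
    then have "sqrt (1 + \<bar>real_of_int \<lfloor>log 2 (1 / h)\<rfloor>\<bar>) \<le> sqrt (4 * ln (inverse h))"
      by (rule real_sqrt_le_mono)
    then show ?case by (simp add: real_sqrt_mult)
  qed
qed

lemma ordinary_profile:
  "\<forall>\<^sub>F h in at_right 0. sqrt (ln (3 + \<bar>real_of_int \<lfloor>log 2 (1 / h)\<rfloor>\<bar>)) \<le> 2 * sqrt (ln (ln (inverse h)))"
proof -
  have "\<forall>\<^sub>F h in at_right (0::real). 5 \<le> ln (inverse h)" by real_asymp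
  moreover have "\<forall>\<^sub>F h in at_right (0::real). 0 < h \<and> h \<le> 1"
    unfolding eventually_at_right_field by (intro exI[of _ 1]) auto
  ultimately show ?thesis
  proof eventually_elim
    case (elim h)
    let ?x = "ln (inverse h)"
    have h1: "1 \<le> inverse h" using elim one_le_inverse by blast
    have "3 + \<bar>real_of_int \<lfloor>log 2 (1 / h)\<rfloor>\<bar> \<le> 3 + 2 * ?x"
      using dyadic_level(1,4)[of h] elim by (simp add: inverse_eq_divide)
    also have "\<dots> \<le> ?x\<^sup>2"
    proof -
      \<comment> \<open>With x \<ge> 5 one has 3 + 2 x \<le> 5 x \<le> x^2, so that ln (3 + 2 x)
        \<le> 2 ln x.\<close>
      have "5 * ?x \<le> ?x * ?x" using elim h1 by (intro mult_right_mono) auto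
      then show ?thesis using elim by (simp add: power2_eq_square)
    qed
    finally have "ln (3 + \<bar>real_of_int \<lfloor>log 2 (1 / h)\<rfloor>\<bar>) \<le> ln (?x\<^sup>2)" by (intro ln_mono) auto
    also have "\<dots> = 2 * ln ?x" using elim by (simp add: ln_realpow)
    also have "\<dots> \<le> 4 * ln ?x" using elim ln_ge_zero[of ?x] by linarith
    finally have "sqrt (ln (3 + \<bar>real_of_int \<lfloor>log 2 (1 / h)\<rfloor>\<bar>)) \<le> sqrt (4 * ln ?x)"
      by (rule real_sqrt_le_mono)
    then show ?case by (simp add: real_sqrt_mult)
  qed
qed

subsection \<open>Local bounds at ordinary and slow points\<close>

text \<open>Centred at \<lfloor>2^j t\<rfloor>, the weight separates into level and offset; a power
  of the distance absorbs the logarithm of the offset, and the square root of a logarithm of the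
  level remains. The shift by 3 makes this logarithm at least 1.\<close>

lemma ordinary_local_bound:
  assumes e: "\<And>j l. \<bar>e j (\<lfloor>dyadic j * t\<rfloor> + l)\<bar> \<le> C * sqrt (ln (log_weight j l))" and p: "0 < p" "p \<le> 1"
  shows "\<exists>C>0. local_bound e t p (\<lambda>j. C * sqrt (ln (3 + \<bar>real_of_int j\<bar>)))"
proof -
  define K where "K = 3 + 1 / (2 * p)"
  have K: "K > 0" using p by (simp add: K_def add_pos_nonneg)
  define D where "D = (\<bar>C\<bar> + 1) * sqrt K"
  have L1: "1 \<le> ln (3 + \<bar>real_of_int j\<bar>)" for j
  proof -
    have "ln 3 \<le> ln (3 + \<bar>real_of_int j\<bar>)" by (intro ln_mono) auto
    then show ?thesis using ln_3_bounds by linarith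
  qed
  have b: "\<bar>e j k\<bar> \<le> D * sqrt (ln (3 + \<bar>real_of_int j\<bar>)) * (1 + \<bar>real_of_int k - dyadic j * t\<bar>) powr p"
    for j k
  proof -
    let ?L = "ln (3 + \<bar>real_of_int j\<bar>)" and ?w = "1 + \<bar>real_of_int k - dyadic j * t\<bar>"
    define l where "l = k - \<lfloor>dyadic j * t\<rfloor>"
    have l1: "\<bar>real_of_int l\<bar> \<le> \<bar>real_of_int k - dyadic j * t\<bar> + 1"
      unfolding l_def of_int_diff using floor_correct[of "dyadic j * t"] by linarith
    have "2 + a \<le> 3 * (1 + b)" if "a \<le> b + 1" "0 \<le> b" for a b :: real using that by simp
    from this[OF l1 abs_ge_zero] have l: "2 + \<bar>real_of_int l\<bar> \<le> 3 * ?w" .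
    have "ln (log_weight j l) = ln (2 + \<bar>real_of_int j\<bar>) + ln (2 + \<bar>real_of_int l\<bar>)"
      unfolding log_weight_def by (rule ln_mult_pos) auto
    also have "\<dots> \<le> ?L + ln (3 * ?w)" using l by (intro add_mono ln_mono) auto
    also have "ln (3 * ?w) = ln 3 + ln ?w" by (rule ln_mult_pos) auto
    also have "?L + (ln 3 + ln ?w) \<le> ?L + (2 + ?w powr (2 * p) / (2 * p))"
      using p ln_3_bounds by (intro add_left_mono add_mono ln_powr_bound) auto
    also have "\<dots> \<le> ?L * (K * ?w powr (2 * p))"
    proof -
      have W: "1 \<le> ?w powr (2 * p)" using p by (intro ge_one_powr_ge_zero) auto
      have LW: "1 * 1 \<le> ?L * ?w powr (2 * p)" using L1 W by (intro mult_mono) auto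
      have "?L * 1 \<le> ?L * ?w powr (2 * p)" using L1[of j] W by (intro mult_left_mono) auto
      moreover have "1 / (2 * p) * (1 * ?w powr (2 * p)) \<le> 1 / (2 * p) * (?L * ?w powr (2 * p))"
        using L1[of j] p by (intro mult_left_mono mult_right_mono) auto
      ultimately show ?thesis using LW by (simp add: K_def algebra_simps)
    qed
    finally have "sqrt (ln (log_weight j l)) \<le> sqrt (?L * (K * ?w powr (2 * p)))" by (rule real_sqrt_le_mono)
    also have "\<dots> = sqrt K * sqrt ?L * ?w powr p"
    proof -
      have "sqrt (?w powr (2 * p)) = ?w powr p"
        by (subst powr_half_sqrt[symmetric]) (auto simp: powr_powr)
      then show ?thesis by (simp add: real_sqrt_mult)
    qed
    finally have s: "sqrt (ln (log_weight j l)) \<le> sqrt K * sqrt ?L * ?w powr p" .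
    have "\<bar>e j k\<bar> \<le> C * sqrt (ln (log_weight j l))" using e[of j l] by (simp add: l_def)
    also have "\<dots> \<le> (\<bar>C\<bar> + 1) * sqrt (ln (log_weight j l))"
    proof (intro mult_right_mono)
      have "1 * 1 \<le> log_weight j l" unfolding log_weight_def by (intro mult_mono) auto
      then show "0 \<le> sqrt (ln (log_weight j l))" by simp
    qed simp
    also have "\<dots> \<le> (\<bar>C\<bar> + 1) * (sqrt K * sqrt ?L * ?w powr p)" using s by (intro mult_left_mono) auto
    finally show ?thesis by (simp add: D_def mult_ac)
  qed
  have D: "D > 0" using K by (simp add: D_def add_nonneg_pos)
  have prof: "D * sqrt (ln (3 + \<bar>real_of_int (J + i)\<bar>))
    \<le> D * sqrt (ln (3 + \<bar>real_of_int J\<bar>)) * (1 + \<bar>real_of_int i\<bar>)\<^sup>2" for i J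
  proof -
    let ?L = "ln (3 + \<bar>real_of_int J\<bar>)" and ?i = "\<bar>real_of_int i\<bar>"
    have m: "1 \<le> (1 + ?i)\<^sup>2" by (intro one_le_power) auto
    have "3 + \<bar>real_of_int (J + i)\<bar> \<le> (3 + \<bar>real_of_int J\<bar>) * (1 + ?i)"
    proof -
      have e: "(3 + \<bar>real_of_int J\<bar>) * (1 + ?i) = 3 + \<bar>real_of_int J\<bar> + ?i + (2 * ?i + \<bar>real_of_int J\<bar> * ?i)"
        by (simp add: algebra_simps)
      have "\<bar>real_of_int (J + i)\<bar> \<le> \<bar>real_of_int J\<bar> + ?i" unfolding of_int_add by (rule abs_triangle_ineq)
      moreover have "0 \<le> 2 * ?i + \<bar>real_of_int J\<bar> * ?i" by simp
      ultimately show ?thesis unfolding e by linarith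
    qed
    then have "ln (3 + \<bar>real_of_int (J + i)\<bar>) \<le> ln ((3 + \<bar>real_of_int J\<bar>) * (1 + ?i))" by (intro ln_mono) auto
    also have "\<dots> = ?L + ln (1 + ?i)" by (rule ln_mult_pos) auto
    also have "\<dots> \<le> ?L + 1 * ?i" using ln_add_one_self_le_self[of ?i] by simp
    also have "\<dots> \<le> ?L + ?L * ?i" using L1[of J] by (intro add_left_mono mult_right_mono) auto
    also have "\<dots> = ?L * (1 + ?i)" by (simp add: algebra_simps)
    also have "\<dots> \<le> ?L * ((1 + ?i)\<^sup>2)\<^sup>2"
    proof (rule mult_left_mono)
      have "1 + ?i \<le> (1 + ?i) ^ 4" by (rule self_le_power) auto
      then show "1 + ?i \<le> ((1 + ?i)\<^sup>2)\<^sup>2" by (simp flip: power_mult)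
    qed (use L1[of J] in simp)
    finally have "sqrt (ln (3 + \<bar>real_of_int (J + i)\<bar>)) \<le> sqrt (?L * ((1 + ?i)\<^sup>2)\<^sup>2)"
      by (rule real_sqrt_le_mono)
    also have "\<dots> = sqrt ?L * (1 + ?i)\<^sup>2" by (simp only: real_sqrt_mult real_sqrt_abs abs_power2)
    finally show ?thesis using D by (simp add: mult.assoc)
  qed
  show ?thesis
    unfolding local_bound_def
  proof (intro exI[of _ D] conjI allI impI D b prof)
    show "0 \<le> D * sqrt (ln (3 + \<bar>real_of_int j\<bar>))" for j
      using D L1[of j] by (intro mult_nonneg_nonneg real_sqrt_ge_zero) auto
  qed
qed

text \<open>The slow bound covers fine levels near t. At levels below 3 n the global growth is
  bounded; at fine levels and far offsets, 2^j is at most a multiple of the distance, so a power of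
  the distance absorbs sqrt j.\<close>

lemma slow_local_bound:
  assumes e: "growth e" and p: "0 < p" "p \<le> 1"
    and slow: "\<And>j l. j \<ge> 3 * n \<Longrightarrow> 1 + \<bar>real_of_int l\<bar> \<le> 2 ^ (j - 3 * n) \<Longrightarrow>
       \<bar>e (int j) (\<lfloor>2 ^ j * t\<rfloor> + l)\<bar> \<le> C * (1 + \<bar>real_of_int l\<bar>) powr p"
  shows "\<exists>C>0. local_bound e t p (\<lambda>j. if 0 \<le> j then C else C * sqrt (1 + \<bar>real_of_int j\<bar>))"
proof -
  \<comment> \<open>Global growth is taken with exponent p/2 so that another p/2 is free to absorb
    sqrt j.\<close>
  obtain D where D: "D > 0" "local_bound e t (p / 2) (\<lambda>j. D * sqrt (1 + \<bar>real_of_int j\<bar>))"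
    using growth_local_bound[OF e, of "p / 2" t] p by auto
  let ?w = "\<lambda>j k. 1 + \<bar>real_of_int k - dyadic j * t\<bar>"
  have gl: "\<bar>e j k\<bar> \<le> D * sqrt (1 + \<bar>real_of_int j\<bar>) * ?w j k powr (p / 2)" for j k
    using D(2) by (simp add: local_bound_def)
  have wp: "?w j k powr (p / 2) \<le> ?w j k powr p" for j k using p by (intro powr_mono) auto
  define A where "A = sqrt (1 + 1 / (p * ln 2))"
  have A: "A \<ge> 0" using p by (simp add: A_def)
  have jA: "sqrt (1 + real j) \<le> A * (2 ^ j) powr (p / 2)" for j :: nat
  proof -
    have P: "(2 ^ j) powr p = exp (real j * (p * ln 2))" by (simp add: powr_def ln_realpow mult_ac)
    have "real j * (p * ln 2) \<le> (2 ^ j) powr p"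
      unfolding P using exp_ge_add_one_self[of "real j * (p * ln 2)"] by linarith
    then have "real j \<le> (2 ^ j) powr p / (p * ln 2)" using p by (simp add: field_simps)
    moreover have "1 \<le> (2 ^ j :: real) powr p" using p by (intro ge_one_powr_ge_zero) auto
    ultimately have "1 + real j \<le> (1 + 1 / (p * ln 2)) * (2 ^ j) powr p" by (simp add: algebra_simps)
    then have "sqrt (1 + real j) \<le> sqrt ((1 + 1 / (p * ln 2)) * (2 ^ j) powr p)" by (rule real_sqrt_le_mono)
    also have "\<dots> = A * (2 ^ j) powr (p / 2)"
      by (simp add: A_def real_sqrt_mult powr_half_sqrt[symmetric] powr_powr)
    finally show ?thesis .
  qed
  \<comment> \<open>The summands serve, in order, negative levels, the slow bound, levels below 3 n,
    and far offsets.\<close>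
  define E where "E = D + 2 * \<bar>C\<bar> + D * sqrt (1 + 3 * real n) + D * A * (2 * 8 ^ n)"
  have E: "E \<ge> D" "E \<ge> 2 * \<bar>C\<bar>" "E \<ge> D * sqrt (1 + 3 * real n)" "E \<ge> D * A * (2 * 8 ^ n)" "E > 0"
    using D(1) A by (auto simp: E_def add_nonneg_nonneg add_pos_nonneg)
  have b: "\<bar>e (int j) k\<bar> \<le> E * ?w (int j) k powr p" for j k
  proof -
    let ?W = "?w (int j) k"
    have dj: "dyadic (int j) = 2 ^ j" by (simp add: dyadic_def powr_realpow)
    define l where "l = k - \<lfloor>2 ^ j * t\<rfloor>"
    have l1: "\<bar>real_of_int l\<bar> \<le> \<bar>real_of_int k - 2 ^ j * t\<bar> + 1"
      unfolding l_def of_int_diff using floor_correct[of "2 ^ j * t"] by linarith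
    have "1 + a \<le> 2 * (1 + b)" if "a \<le> b + 1" "0 \<le> b" for a b :: real using that by simp
    from this[OF l1 abs_ge_zero] have l: "1 + \<bar>real_of_int l\<bar> \<le> 2 * ?W" unfolding dj .
    have W: "0 \<le> ?W powr p" by simp
    consider "3 * n \<le> j" "1 + \<bar>real_of_int l\<bar> \<le> 2 ^ (j - 3 * n)" | "j < 3 * n" | "3 * n
      \<le> j" "2 ^ (j - 3 * n) < 1 + \<bar>real_of_int l\<bar>"
      by linarith
    then show ?thesis
    proof cases
      case 1
      have "\<bar>e (int j) k\<bar> \<le> C * (1 + \<bar>real_of_int l\<bar>) powr p" using slow[OF 1] by (simp add: l_def)
      also have "\<dots> \<le> \<bar>C\<bar> * (2 * ?W) powr p" using l p by (intro mult_mono powr_mono2) auto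
      also have "\<dots> = \<bar>C\<bar> * (2 powr p * ?W powr p)" by (subst powr_mult) auto
      also have "\<dots> \<le> \<bar>C\<bar> * (2 powr 1 * ?W powr p)" using p
        by (intro mult_left_mono mult_right_mono powr_mono) auto
      also have "\<dots> = 2 * \<bar>C\<bar> * ?W powr p" by simp
      also have "\<dots> \<le> E * ?W powr p" using E W by (intro mult_right_mono) auto
      finally show ?thesis .
    next
      case 2
      have "\<bar>e (int j) k\<bar> \<le> D * sqrt (1 + real j) * ?W powr (p / 2)" using gl[of "int j" k] by simp
      also have "\<dots> \<le> D * sqrt (1 + 3 * real n) * ?W powr p"
        using 2 D wp by (intro mult_mono mult_left_mono real_sqrt_le_mono) auto
      also have "\<dots> \<le> E * ?W powr p" using E W by (intro mult_right_mono) auto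
      finally show ?thesis .
    next
      case 3
      have "(2::real) ^ j = 8 ^ n * 2 ^ (j - 3 * n)"
      proof -
        have "(2::real) ^ j = 2 ^ (3 * n + (j - 3 * n))" using 3 by simp
        then show ?thesis by (simp only: power_add power_mult) simp
      qed
      also have "\<dots> \<le> 8 ^ n * (2 * ?W)" using 3 l by (intro mult_left_mono) auto
      also have "\<dots> = 2 * 8 ^ n * ?W" by (simp only: mult_ac)
      finally have "(2 ^ j) powr (p / 2) \<le> (2 * 8 ^ n * ?W) powr (p / 2)" using p
        by (intro powr_mono2) simp_all
      also have "\<dots> = (2 * 8 ^ n) powr (p / 2) * ?W powr (p / 2)" by (rule powr_mult)
      also have "\<dots> \<le> (2 * 8 ^ n) powr 1 * ?W powr (p / 2)"
        using p by (intro mult_right_mono powr_mono) (auto intro: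
          order_trans[OF _ mult_mono[of 1 2 1 "8 ^ n"]])
      finally have q: "(2 ^ j) powr (p / 2) \<le> 2 * 8 ^ n * ?W powr (p / 2)" by simp
      have "\<bar>e (int j) k\<bar> \<le> D * sqrt (1 + real j) * ?W powr (p / 2)" using gl[of "int j" k] by simp
      also have "\<dots> \<le> D * (A * (2 * 8 ^ n * ?W powr (p / 2))) * ?W powr (p / 2)"
        using D A q jA[of j] by (intro mult_right_mono mult_left_mono order_trans[OF jA]) auto
      also have "\<dots> = D * A * (2 * 8 ^ n) * (?W powr (p / 2) * ?W powr (p / 2))" by (simp add: mult_ac)
      also have "?W powr (p / 2) * ?W powr (p / 2) = ?W powr p" by (simp flip: powr_add)
      also have "D * A * (2 * 8 ^ n) * ?W powr p \<le> E * ?W powr p" using E W by (intro mult_right_mono) auto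
      finally show ?thesis .
    qed
  qed
  show ?thesis
    unfolding local_bound_def
  proof (intro exI[of _ E] conjI allI impI E(5))
    fix j k
    show "\<bar>e j k\<bar> \<le> (if 0 \<le> j then E else E * sqrt (1 + \<bar>real_of_int j\<bar>)) * ?w j k powr p"
    proof (cases "0 \<le> j")
      case True
      then show ?thesis using b[of "nat j" k] by simp
    next
      case False
      have "\<bar>e j k\<bar> \<le> D * sqrt (1 + \<bar>real_of_int j\<bar>) * ?w j k powr (p / 2)" by (rule gl)
      also have "\<dots> \<le> E * sqrt (1 + \<bar>real_of_int j\<bar>) * ?w j k powr p"
        using E wp by (intro mult_mono mult_right_mono) auto
      finally show ?thesis using False by simp
    qed
    show "0 \<le> (if 0 \<le> j then E else E * sqrt (1 + \<bar>real_of_int j\<bar>))" using E by auto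
  next
    fix J i :: int assume J: "0 \<le> J"
    have one: "1 \<le> (1 + \<bar>real_of_int i\<bar>)\<^sup>2" by (intro one_le_power) auto
    show "(if 0 \<le> J + i then E else E * sqrt (1 + \<bar>real_of_int (J + i)\<bar>))
      \<le> (if 0 \<le> J then E else E * sqrt (1 + \<bar>real_of_int J\<bar>)) * (1 + \<bar>real_of_int i\<bar>)\<^sup>2"
    proof (cases "0 \<le> J + i")
      case True
      then show ?thesis using J E one by (simp add: mult_le_cancel_left1)
    next
      case False
      have "sqrt (1 + \<bar>real_of_int (J + i)\<bar>) \<le> 1 + \<bar>real_of_int i\<bar>"
      proof (rule real_le_lsqrt)
        have "1 + \<bar>real_of_int (J + i)\<bar> \<le> 1 + \<bar>real_of_int i\<bar>" using False J by simp
        also have "\<dots> \<le> (1 + \<bar>real_of_int i\<bar>)\<^sup>2" by (rule self_le_power) auto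
        finally show "1 + \<bar>real_of_int (J + i)\<bar> \<le> (1 + \<bar>real_of_int i\<bar>)\<^sup>2" .
      qed auto
      also have "\<dots> \<le> (1 + \<bar>real_of_int i\<bar>)\<^sup>2" by (rule self_le_power) auto
      finally show ?thesis using False J E by (simp add: mult_left_mono)
    qed
  qed
qed

subsection \<open>From coefficients to oscillations\<close>

context lemarie_meyer_wavelet
begin

definition oscillation :: "(int \<Rightarrow> int \<Rightarrow> real) \<Rightarrow> (real \<Rightarrow> real) \<Rightarrow> real \<Rightarrow> (real \<Rightarrow> real) \<Rightarrow> ereal" where
  "oscillation e H t G
    = Limsup (at t) (\<lambda>s. ereal (\<bar>gen e s (H s) - gen e t (H t)\<bar> / (\<bar>s - t\<bar> powr H t * G \<bar>s - t\<bar>)))"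

text \<open>The Lipschitz constant in the exponent grows like max 1 |s|, which is bounded near
  t.\<close>

lemma varying_exponent_error:
  assumes e: "growth e" and ab: "0 < a" "a < b" "b < 1" and H: "\<And>t. H t \<in> {a..b}"
    and \<gamma>: "\<exists>\<gamma>>H t. \<exists>R>0. \<exists>c>0. \<forall>s. \<bar>s - t\<bar> \<le> R \<longrightarrow> \<bar>H s - H t\<bar> \<le> c * \<bar>s - t\<bar> powr \<gamma>"
  shows "\<exists>\<gamma>>H t. \<exists>R>0. \<exists>C>0. \<forall>s. \<bar>s - t\<bar> \<le> R \<longrightarrow> \<bar>gen e s (H s) - gen e s (H t)\<bar> \<le> C * \<bar>s - t\<bar> powr \<gamma>"
proof -
  obtain \<gamma> R c where g: "\<gamma> > H t" "R > 0" "c > 0" "\<And>s. \<bar>s - t\<bar> \<le> R \<Longrightarrow> \<bar>H s - H t\<bar> \<le> c * \<bar>s - t\<bar> powr \<gamma>"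
    using \<gamma> by blast
  obtain C where C: "C > 0" "\<And>s \<theta> \<theta>'. a \<le> \<theta> \<and> \<theta> \<le> b \<and> a \<le> \<theta>' \<and> \<theta>' \<le> b \<Longrightarrow>
     \<bar>gen e s \<theta> - gen e s \<theta>'\<bar> \<le> C * max 1 \<bar>s\<bar> * \<bar>\<theta> - \<theta>'\<bar>"
    using gen_Lipschitz[OF e ab(1) less_imp_le[OF ab(2)] ab(3)] by blast
  have pos: "0 < C * (1 + \<bar>t\<bar> + R) * c" using C(1) g by (simp add: add_pos_nonneg)
  have "\<bar>gen e s (H s) - gen e s (H t)\<bar> \<le> C * (1 + \<bar>t\<bar> + R) * c * \<bar>s - t\<bar> powr \<gamma>" if s: "\<bar>s - t\<bar> \<le> R" for s
  proof -
    have "\<bar>gen e s (H s) - gen e s (H t)\<bar> \<le> C * max 1 \<bar>s\<bar> * \<bar>H s - H t\<bar>"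
      using H[of s] H[of t] by (intro C(2)) auto
    also have "\<dots> \<le> C * (1 + \<bar>t\<bar> + R) * (c * \<bar>s - t\<bar> powr \<gamma>)"
    proof (intro mult_mono)
      have "\<bar>s\<bar> \<le> \<bar>s - t\<bar> + \<bar>t\<bar>" using abs_triangle_ineq[of "s - t" t] by simp
      then show "max 1 \<bar>s\<bar> \<le> 1 + \<bar>t\<bar> + R" using s g(2) by simp
    qed (use C(1) g s in auto)
    finally show ?thesis by (simp add: mult.assoc)
  qed
  then show ?thesis using g(1,2) pos by blast
qed

text \<open>The level \<lfloor>log 2 (1 / h)\<rfloor> with h = |s - t| gives the part with fixed
  exponent; the change of exponent contributes at most C h^\<gamma>, and h^\<gamma> \<le> h^(H t) G
  h because G h \<ge> 1.\<close>

lemma oscillation_finite: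
  assumes e: "growth e" and ab: "0 < a" "a < b" "b < 1" and H: "\<And>t. H t \<in> {a..b}"
    and \<gamma>: "\<exists>\<gamma>>H t. \<exists>R>0. \<exists>c>0. \<forall>s. \<bar>s - t\<bar> \<le> R \<longrightarrow> \<bar>H s - H t\<bar> \<le> c * \<bar>s - t\<bar> powr \<gamma>"
    and p: "0 \<le> p" "p < a" and lb: "local_bound e t p E"
    and G: "\<forall>\<^sub>F h in at_right 0. 1 \<le> G h" "\<forall>\<^sub>F h in at_right 0. E \<lfloor>log 2 (1 / h)\<rfloor> \<le> K * G h"
  shows "oscillation e H t G < \<infinity>"
proof -
  let ?\<theta> = "H t"
  have \<theta>: "0 < ?\<theta>" "?\<theta> < 1" "p < ?\<theta>" using H[of t] ab p by auto
  obtain \<gamma> R C where r: "\<gamma> > ?\<theta>" "R > 0" "C > 0" "\<And>s. \<bar>s - t\<bar> \<le> R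
    \<Longrightarrow> \<bar>gen e s (H s) - gen e s ?\<theta>\<bar> \<le> C * \<bar>s - t\<bar> powr \<gamma>"
    using varying_exponent_error[OF e ab H \<gamma>] by blast
  obtain D where D: "D > 0" "\<And>s J. J \<ge> 0 \<Longrightarrow> dyadic J * \<bar>s - t\<bar> \<le> 1
    \<Longrightarrow> \<bar>gen e s ?\<theta> - gen e t ?\<theta>\<bar> \<le> D * E J * dyadic J powr (- ?\<theta>)"
    using gen_increment_bound[OF e p(1) \<theta>(3,2) lb] by blast
  obtain \<delta>1 where \<delta>1: "\<delta>1 > 0" "\<And>h. 0 < h \<Longrightarrow> h < \<delta>1 \<Longrightarrow> 1 \<le> G h" using G(1)
    by (auto simp: eventually_at_right_field)
  obtain \<delta>2 where \<delta>2: "\<delta>2 > 0" "\<And>h. 0 < h \<Longrightarrow> h < \<delta>2 \<Longrightarrow> E \<lfloor>log 2 (1 / h)\<rfloor> \<le> K * G h" using G(2)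
    by (auto simp: eventually_at_right_field)
  define \<delta> where "\<delta> = min (min \<delta>1 \<delta>2) (min R 1)"
  have \<delta>: "\<delta> > 0" using \<delta>1 \<delta>2 r by (simp add: \<delta>_def)
  have "\<forall>\<^sub>F s in at t. ereal (\<bar>gen e s (H s) - gen e t (H t)\<bar> / (\<bar>s - t\<bar> powr H t * G \<bar>s - t\<bar>))
    \<le> ereal (2 * D * K + C)"
    unfolding eventually_at
  proof (intro exI[of _ \<delta>] conjI \<delta> ballI impI)
    fix s assume s: "s \<noteq> t \<and> dist s t < \<delta>"
    define h where "h = \<bar>s - t\<bar>"
    have h: "0 < h" "h < \<delta>1" "h < \<delta>2" "h \<le> R" "h \<le> 1" using s by (auto simp: h_def \<delta>_def dist_real_def)
    let ?J = "\<lfloor>log 2 (1 / h)\<rfloor>"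
    note J = dyadic_level[OF h(1,5)]
    have E: "0 \<le> E ?J" using lb by (simp add: local_bound_def)
    have Gh: "1 \<le> G h" by (rule \<delta>1(2)[OF h(1,2)])
    have "\<bar>gen e s ?\<theta> - gen e t ?\<theta>\<bar> \<le> D * E ?J * dyadic ?J powr (- ?\<theta>)"
      using D(2)[OF J(1), of s] J(2) by (simp add: h_def)
    also have "\<dots> \<le> D * E ?J * (2 * h powr ?\<theta>)"
      using D(1) E \<theta> by (intro mult_left_mono J(3)) auto
    also have "\<dots> \<le> D * (K * G h) * (2 * h powr ?\<theta>)"
      using D(1) by (intro mult_right_mono mult_left_mono \<delta>2(2)[OF h(1,3)]) auto
    finally have 1: "\<bar>gen e s ?\<theta> - gen e t ?\<theta>\<bar> \<le> 2 * D * K * (h powr ?\<theta> * G h)" by (simp add: mult_ac)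
    have "\<bar>gen e s (H s) - gen e s ?\<theta>\<bar> \<le> C * h powr \<gamma>" using r(4)[of s] h by (simp add: h_def)
    also have "\<dots> \<le> C * h powr ?\<theta>" using r h by (intro mult_left_mono powr_mono') auto
    also have "\<dots> \<le> C * (h powr ?\<theta> * G h)"
      using r Gh by (intro mult_left_mono) (auto simp: mult_le_cancel_left1)
    finally have "\<bar>gen e s (H s) - gen e t ?\<theta>\<bar> \<le> (2 * D * K + C) * (h powr ?\<theta> * G h)"
      using 1 by (simp add: distrib_right)
    moreover have "0 < h powr ?\<theta> * G h" using h Gh by (intro mult_pos_pos) auto
    ultimately show "ereal (\<bar>gen e s (H s) - gen e t (H t)\<bar> / (\<bar>s - t\<bar> powr H t * G \<bar>s - t\<bar>))
      \<le> ereal (2 * D * K + C)"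
      unfolding h_def[symmetric] by (simp add: pos_divide_le_eq)
  qed
  then have "oscillation e H t G \<le> ereal (2 * D * K + C)"
    unfolding oscillation_def by (rule Limsup_bounded)
  then show ?thesis by (rule order.strict_trans1) simp
qed

text \<open>If the limsup were 0, the increments with exponent frozen at H t would still be little-o
  of the gauge, since h^\<gamma> is little-o of h^(H t); then the coefficients along t would be
  little-o of g.\<close>

lemma oscillation_positive:
  assumes e: "growth e" and ab: "0 < a" "a < b" "b < 1" and H: "\<And>t. H t \<in> {a..b}"
    and \<gamma>: "\<exists>\<gamma>>H t. \<exists>R>0. \<exists>c>0. \<forall>s. \<bar>s - t\<bar> \<le> R \<longrightarrow> \<bar>H s - H t\<bar> \<le> c * \<bar>s - t\<bar> powr \<gamma>"
    and G: "\<forall>\<^sub>F h in at_right 0. 1 \<le> G h" "gauge_levels (H t) G g"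
    and large: "c > 0" "\<And>n. \<exists>j\<ge>n. c * g j \<le> \<bar>e (int j) \<lfloor>2 ^ j * t\<rfloor>\<bar>"
  shows "0 < oscillation e H t G"
proof (rule ccontr)
  assume "\<not> 0 < oscillation e H t G"
  then have L: "oscillation e H t G \<le> 0" by simp
  let ?\<theta> = "H t"
  have \<theta>: "0 < ?\<theta>" "?\<theta> < 1" using H[of t] ab by auto
  obtain \<gamma> R C where r: "\<gamma> > ?\<theta>" "R > 0" "C > 0" "\<And>s. \<bar>s - t\<bar> \<le> R
    \<Longrightarrow> \<bar>gen e s (H s) - gen e s ?\<theta>\<bar> \<le> C * \<bar>s - t\<bar> powr \<gamma>"
    using varying_exponent_error[OF e ab H \<gamma>] by blast
  obtain \<delta>1 where \<delta>1: "\<delta>1 > 0" "\<And>h. 0 < h \<Longrightarrow> h < \<delta>1 \<Longrightarrow> 1 \<le> G h" using G(1)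
    by (auto simp: eventually_at_right_field)
  have small: "\<exists>\<delta>>0. \<forall>s. 0 < \<bar>s - t\<bar> \<and> \<bar>s - t\<bar> < \<delta> \<longrightarrow>
       \<bar>gen e s ?\<theta> - gen e t ?\<theta>\<bar> \<le> \<eta> * (\<bar>s - t\<bar> powr ?\<theta> * G \<bar>s - t\<bar>)" if \<eta>: "\<eta> > 0" for \<eta>
  proof -
    have "oscillation e H t G < ereal (\<eta> / 2)" using L \<eta> by (rule_tac order.strict_trans1) auto
    then have "\<forall>\<^sub>F s in at t. ereal (\<bar>gen e s (H s) - gen e t (H t)\<bar> / (\<bar>s - t\<bar> powr H t * G \<bar>s - t\<bar>))
      < ereal (\<eta> / 2)"
      unfolding oscillation_def by (rule Limsup_lessD)
    then obtain \<delta>2 where \<delta>2: "\<delta>2 > 0" "\<And>s. s \<noteq> t \<Longrightarrow> dist s t < \<delta>2 \<Longrightarrow>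
        \<bar>gen e s (H s) - gen e t (H t)\<bar> / (\<bar>s - t\<bar> powr H t * G \<bar>s - t\<bar>) < \<eta> / 2"
      by (auto simp: eventually_at)
    \<comment> \<open>The radius up to which C h^(\<gamma> - \<theta>) \<le> \<eta>/2.\<close>
    define \<delta>3 where "\<delta>3 = (\<eta> / (2 * C)) powr (1 / (\<gamma> - ?\<theta>))"
    define \<delta> where "\<delta> = min (min \<delta>1 \<delta>2) (min R \<delta>3)"
    have \<delta>: "\<delta> > 0" using \<delta>1 \<delta>2 r \<eta> by (simp add: \<delta>_def \<delta>3_def)
    show ?thesis
    proof (intro exI[of _ \<delta>] conjI \<delta> allI impI)
      fix s assume s: "0 < \<bar>s - t\<bar> \<and> \<bar>s - t\<bar> < \<delta>"
      define h where "h = \<bar>s - t\<bar>"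
      have h: "0 < h" "h < \<delta>1" "h < \<delta>2" "h \<le> R" "h \<le> \<delta>3" using s by (auto simp: h_def \<delta>_def)
      have Gh: "1 \<le> G h" by (rule \<delta>1(2)[OF h(1,2)])
      have pos: "0 < h powr ?\<theta> * G h" using h Gh by (intro mult_pos_pos) auto
      have "s \<noteq> t" "dist s t < \<delta>2" using s h by (auto simp: h_def dist_real_def)
      from \<delta>2(2)[OF this] have 1: "\<bar>gen e s (H s) - gen e t ?\<theta>\<bar> \<le> \<eta> / 2 * (h powr ?\<theta> * G h)"
        using pos unfolding h_def[symmetric] by (simp add: pos_divide_less_eq)
      have "h powr (\<gamma> - ?\<theta>) \<le> \<delta>3 powr (\<gamma> - ?\<theta>)" using h r by (intro powr_mono2) auto
      also have "\<dots> = \<eta> / (2 * C)" using r \<eta> by (simp add: \<delta>3_def powr_powr)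
      finally have "C * h powr (\<gamma> - ?\<theta>) \<le> \<eta> / 2" using r by (simp add: field_simps)
      then have "C * h powr (\<gamma> - ?\<theta>) * h powr ?\<theta> \<le> \<eta> / 2 * h powr ?\<theta>" by (rule mult_right_mono) simp
      then have "C * h powr \<gamma> \<le> \<eta> / 2 * h powr ?\<theta>" by (simp add: mult.assoc flip: powr_add)
      also have "\<dots> \<le> \<eta> / 2 * (h powr ?\<theta> * G h)"
        using \<eta> Gh by (intro mult_left_mono) (auto simp: mult_le_cancel_left1)
      finally have 2: "\<bar>gen e s (H s) - gen e s ?\<theta>\<bar> \<le> \<eta> / 2 * (h powr ?\<theta> * G h)"
        using r(4)[of s] h by (simp add: h_def)
      have "\<bar>gen e s ?\<theta> - gen e t ?\<theta>\<bar> \<le> \<eta> / 2 * (h powr ?\<theta> * G h) + \<eta> / 2 * (h powr ?\<theta> * G h)"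
      proof -
        have "\<bar>r - q\<bar> \<le> \<bar>p - q\<bar> + \<bar>p - r\<bar>" for p q r :: real by linarith
        from this[of "gen e s ?\<theta>" "gen e t ?\<theta>" "gen e s (H s)"] show ?thesis
          using 1 2 by linarith
      qed
      then show "\<bar>gen e s ?\<theta> - gen e t ?\<theta>\<bar> \<le> \<eta> * (\<bar>s - t\<bar> powr ?\<theta> * G \<bar>s - t\<bar>)"
        by (simp add: h_def mult_ac)
    qed
  qed
  have "\<forall>\<^sub>F j in sequentially. \<bar>e (int j) \<lfloor>2 ^ j * t\<rfloor>\<bar> \<le> c / 2 * g j"
    using little_o_coefficients[OF e \<theta> G(2) small, of "c / 2"] large(1) by simp
  then obtain n1 where n1: "\<And>j. j \<ge> n1 \<Longrightarrow> \<bar>e (int j) \<lfloor>2 ^ j * t\<rfloor>\<bar> \<le> c / 2 * g j"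
    by (auto simp: eventually_sequentially)
  obtain n2 where n2: "\<And>j. j \<ge> n2 \<Longrightarrow> 1 \<le> g j" using G(2) unfolding gauge_levels_def by blast
  obtain j where j: "j \<ge> max n1 n2" "c * g j \<le> \<bar>e (int j) \<lfloor>2 ^ j * t\<rfloor>\<bar>" using large(2) by blast
  have "c * g j \<le> c / 2 * g j" using n1[of j] j by simp
  moreover have "0 < c * g j" using n2[of j] j large(1) by (intro mult_pos_pos) auto
  ultimately show False by simp
qed

end

subsection \<open>Ordinary points by Fubini's theorem\<close>

context iid_normal
begin

text \<open>C ranges over the naturals so that the condition is a countable combination of
  measurable ones in \<omega> and t, as Fubini's theorem requires.\<close>

definition ordinary_coefficients :: "'w \<Rightarrow> real \<Rightarrow> bool" where
  "ordinary_coefficients \<omega> t \<longleftrightarrow>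
     (\<exists>C::nat. \<forall>j l. \<bar>\<epsilon> j (\<lfloor>dyadic j * t\<rfloor> + l) \<omega>\<bar> \<le> real C * sqrt (ln (log_weight j l))) \<and>
     (\<forall>n. \<exists>j\<ge>n. 1 / 4 * sqrt (ln (real j)) \<le> \<bar>\<epsilon> (int j) \<lfloor>2 ^ j * t\<rfloor> \<omega>\<bar>)"

lemma AE_ordinary_fixed: "AE \<omega> in M. ordinary_coefficients \<omega> t"
  using shifted_growth[of "\<lambda>j. \<lfloor>dyadic j * t\<rfloor>"] fixed_time_lower_bound[of t]
proof eventually_elim
  case (elim \<omega>)
  then obtain C where C: "\<And>j l. \<bar>\<epsilon> j (\<lfloor>dyadic j * t\<rfloor> + l) \<omega>\<bar> \<le> C * sqrt (ln (log_weight j l))" by blast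
  obtain N :: nat where N: "C \<le> real N" using real_arch_simple by blast
  have "\<bar>\<epsilon> j (\<lfloor>dyadic j * t\<rfloor> + l) \<omega>\<bar> \<le> real N * sqrt (ln (log_weight j l))" for j l
  proof (rule order_trans[OF C mult_right_mono[OF N]])
    show "0 \<le> sqrt (ln (log_weight j l))" using log_weight_ge[of j l] by simp
  qed
  then show ?case using elim(2) unfolding ordinary_coefficients_def by blast
qed

lemma AE_ordinary: "AE \<omega> in M. AE t in lborel. ordinary_coefficients \<omega> t"
proof -
  interpret P: pair_sigma_finite M lborel ..
  \<comment> \<open>The index depends on t but takes countably many values, which gives joint
    measurability.\<close>
  have [measurable]: "(\<lambda>x. \<epsilon> j (\<lfloor>c * snd x\<rfloor> + l) (fst x)) \<in> borel_measurable (M \<Otimes>\<^sub>M lborel)" for j l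
    and c :: real
    by (rule measurable_compose_countable[where f = "\<lambda>i x. \<epsilon> j (i + l) (fst x)" and g =
      "\<lambda>x. \<lfloor>c * snd x\<rfloor>"]) measurable
  have [measurable]: "(\<lambda>x. \<epsilon> j \<lfloor>c * snd x\<rfloor> (fst x)) \<in> borel_measurable (M \<Otimes>\<^sub>M lborel)" for j and c :: real
    by (rule measurable_compose_countable[where f = "\<lambda>i x. \<epsilon> j i (fst x)" and g =
      "\<lambda>x. \<lfloor>c * snd x\<rfloor>"]) measurable
  have "{x \<in> space (M \<Otimes>\<^sub>M lborel). ordinary_coefficients (fst x) (snd x)} \<in> sets (M \<Otimes>\<^sub>M lborel)"
    unfolding ordinary_coefficients_def by measurable
  from P.AE_commute[OF this] show ?thesis using AE_ordinary_fixed by simp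
qed

end

subsection \<open>Rapid points by Baire's theorem\<close>

lemma dyadic_interval_inside:
  fixes x y :: real
  assumes "x < y" "1 < b"
  obtains n k where "x \<le> real_of_int k / b ^ n" "(real_of_int k + 1) / b ^ n \<le> y"
proof -
  obtain n where n: "2 / (y - x) < b ^ n" using real_arch_pow[OF assms(2)] by blast
  have bn: "b ^ n > 0" using assms by simp
  have "2 < (y - x) * b ^ n" using n assms by (simp add: pos_divide_less_eq mult.commute)
  then have l: "x * b ^ n + 2 < y * b ^ n" by (simp add: algebra_simps)
  define k where "k = \<lceil>x * b ^ n\<rceil>"
  have "x * b ^ n \<le> k" "k < x * b ^ n + 1" unfolding k_def by linarith+
  then have "x \<le> real_of_int k / b ^ n" "(real_of_int k + 1) / b ^ n \<le> y"
    using bn l by (auto simp: pos_le_divide_eq pos_divide_le_eq)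
  then show thesis using that by blast
qed

text \<open>\<open>U n\<close> consists of the open dyadic cells of level at least n that carry a
  large coefficient. The hypothesis makes it dense, and a point of all \<open>U n\<close> lies in
  such cells at arbitrarily fine levels.\<close>

lemma rapid_point_exists:
  fixes e :: "int \<Rightarrow> int \<Rightarrow> real" and I :: "real set"
  assumes dense: "\<And>j0 k0 J. \<exists>j\<ge>J. \<exists>k. j0 \<le> j \<and> k0 * 2 ^ (j - j0) \<le> k \<and> k < (k0 + 1) * 2 ^ (j - j0)
    \<and> c * g j \<le> \<bar>e (int j) k\<bar>"
    and I: "open I" "I \<noteq> {}"
  shows "\<exists>t\<in>I. \<forall>n. \<exists>j\<ge>n. c * g j \<le> \<bar>e (int j) \<lfloor>2 ^ j * t\<rfloor>\<bar>"
proof -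
  \<comment> \<open>Open cells make \<open>U n\<close> open and still determine \<lfloor>2^j
    t\<rfloor>.\<close>
  define D where "D j k = {real_of_int k / 2 ^ j <..< (real_of_int k + 1) / 2 ^ j}" for j :: nat and k :: int
  define U where "U n = \<Union>{D j k | j k. n \<le> j \<and> c * g j \<le> \<bar>e (int j) k\<bar>}" for n
  have oU: "open (U n)" for n unfolding U_def D_def by (intro open_Union) auto
  have dU: "closure (U n) = UNIV" for n
  proof -
    have "U n \<inter> V \<noteq> {}" if V: "open V" "V \<noteq> {}" for V
    proof -
      obtain x where x: "x \<in> V" using V by blast
      then obtain d where d: "d > 0" "ball x d \<subseteq> V" using V open_contains_ball by blast
      obtain j0 k0 where jk0: "x \<le> real_of_int k0 / 2 ^ j0" "(real_of_int k0 + 1) / 2 ^ j0 \<le> x + d / 2"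
        by (rule dyadic_interval_inside[of x "x + d / 2" 2]) (use d in auto)
      obtain j k where jk: "j \<ge> n" "j0 \<le> j" "k0 * 2 ^ (j - j0) \<le> k" "k < (k0 + 1) * 2 ^ (j - j0)" "c * g j
        \<le> \<bar>e (int j) k\<bar>"
        using dense by blast
      define z where "z = (real_of_int k + 1 / 2) / 2 ^ j"
      have zD: "z \<in> D j k" by (simp add: z_def D_def divide_strict_right_mono)
      have pj: "(2::real) ^ j = 2 ^ j0 * 2 ^ (j - j0)" using jk(2) by (simp flip: power_add)
      have "real_of_int k0 * 2 ^ (j - j0) \<le> real_of_int k"
        using jk(3) by (metis of_int_le_iff of_int_mult of_int_numeral of_int_power)
      then have "real_of_int k0 / 2 ^ j0 \<le> real_of_int k / 2 ^ j" unfolding pj by (simp add: field_simps)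
      moreover have "real_of_int k / 2 ^ j \<le> z" unfolding z_def by (intro divide_right_mono) auto
      ultimately have z1: "x \<le> z" using jk0(1) by linarith
      have "k + 1 \<le> (k0 + 1) * 2 ^ (j - j0)" using jk(4) by simp
      then have "real_of_int (k + 1) \<le> real_of_int ((k0 + 1) * 2 ^ (j - j0))" by (simp only: of_int_le_iff)
      then have "real_of_int k + 1 \<le> (real_of_int k0 + 1) * 2 ^ (j - j0)" by simp
      then have "(real_of_int k + 1) / 2 ^ j \<le> (real_of_int k0 + 1) * 2 ^ (j - j0) / 2 ^ j"
        by (rule divide_right_mono) simp
      also have "\<dots> = (real_of_int k0 + 1) / 2 ^ j0" unfolding pj by simp
      finally have "(real_of_int k + 1) / 2 ^ j \<le> (real_of_int k0 + 1) / 2 ^ j0" .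
      moreover have "z \<le> (real_of_int k + 1) / 2 ^ j" unfolding z_def by (intro divide_right_mono) auto
      ultimately have "z \<le> x + d / 2" using jk0(2) by linarith
      then have "z \<in> ball x d" using z1 d by (simp add: dist_real_def)
      then have "z \<in> V" using d by blast
      moreover have "z \<in> U n" using zD jk(1,5) unfolding U_def by blast
      ultimately show ?thesis by blast
    qed
    from this[of "- closure (U n)"] show ?thesis using closure_subset[of "U n"] by blast
  qed
  have "(UNIV :: real set) \<subseteq> closure (\<Inter>(range U))"
    by (rule Baire) (auto simp: oU dU)
  then have "I \<inter> \<Inter>(range U) \<noteq> {}" using I open_Int_closure_eq_empty[of I "\<Inter>(range U)"] by auto
  then obtain t where t: "t \<in> I" "\<And>n. t \<in> U n" by auto
  have "\<exists>j\<ge>n. c * g j \<le> \<bar>e (int j) \<lfloor>2 ^ j * t\<rfloor>\<bar>" for n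
  proof -
    obtain j k where jk: "t \<in> D j k" "n \<le> j" "c * g j \<le> \<bar>e (int j) k\<bar>" using t(2)[of n] unfolding U_def
      by blast
    have "\<lfloor>2 ^ j * t\<rfloor> = k" using jk(1) by (intro floor_unique) (auto simp: D_def field_simps)
    then show ?thesis using jk by blast
  qed
  then show ?thesis using t(1) by blast
qed

section \<open>Assembly of the rapid, ordinary and slow points\<close>

theorem theorem2p2:
  fixes M :: "'w measure" and \<epsilon> :: "int \<Rightarrow> int \<Rightarrow> 'w \<Rightarrow> real"
    and \<psi> H :: "real \<Rightarrow> real" and a b :: real
  assumes "prob_space M"
    and "iid_std_normal M \<epsilon>"
    and "lemarie_meyer \<psi>"
    and "0 < a" and "a < b" and "b < 1"
    and "\<And>t. H t \<in> {a..b}"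
    and "\<And>t. \<exists>\<gamma>>H t. \<exists>R>0. \<exists>c>0. \<forall>s. \<bar>s - t\<bar> \<le> R \<longrightarrow> \<bar>H s - H t\<bar> \<le> c * \<bar>s - t\<bar> powr \<gamma>"
  shows "AE \<omega> in M. \<forall>I. open I \<and> is_interval I \<and> I \<noteq> {} \<longrightarrow>
    (let L = (\<lambda>t g. Limsup (at t) (\<lambda>s. ereal (\<bar>mbm \<psi> \<epsilon> H \<omega> s - mbm \<psi> \<epsilon> H \<omega> t\<bar> /
                                           (\<bar>s - t\<bar> powr H t * g \<bar>s - t\<bar>)))) in
      (\<exists>t\<in>I. 0 < L t (\<lambda>h. sqrt (ln (inverse h))) \<and> L t (\<lambda>h. sqrt (ln (inverse h))) < \<infinity>) \<and>
      (AE t in lborel. t \<in> I \<longrightarrow>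
        0 < L t (\<lambda>h. sqrt (ln (ln (inverse h)))) \<and> L t (\<lambda>h. sqrt (ln (ln (inverse h)))) < \<infinity>) \<and>
      (\<exists>t\<in>I. 0 < L t (\<lambda>h. 1) \<and> L t (\<lambda>h. 1) < \<infinity>))"
proof -
  interpret iid_normal M \<epsilon>
    using assms(1,2) by (intro iid_normal.intro iid_normal_axioms.intro)
  interpret lemarie_meyer_wavelet \<psi>
    using assms(3) by (rule lemarie_meyer_wavelet.intro)
  note ab = assms(4-6) and H = assms(7) and \<gamma> = assms(8)
  define p where "p = a / 2"
  have p: "0 < p" "p \<le> 1" "0 \<le> p" "p < a" using ab by (auto simp: p_def)
  let ?G1 = "\<lambda>h::real. sqrt (ln (inverse h))" and ?G2 = "\<lambda>h::real. sqrt (ln (ln (inverse h)))"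
    and ?G3 = "\<lambda>h::real. 1::real"
  have G1: "\<forall>\<^sub>F h in at_right 0. 1 \<le> ?G1 h" by real_asymp
  have G2: "\<forall>\<^sub>F h in at_right 0. 1 \<le> ?G2 h" by real_asymp
  have G3: "\<forall>\<^sub>F h in at_right 0. 1 \<le> ?G3 h" by simp
  have Hpos: "0 < H t" for t using H[of t] ab by auto
  \<comment> \<open>The summand 0 is the constant centre K = 0 in \<open>shifted_growth\<close>,
    which gives \<open>growth\<close>.\<close>
  have "AE \<omega> in M. \<exists>C. \<forall>j l. \<bar>\<epsilon> j (0 + l) \<omega>\<bar> \<le> C * sqrt (ln (log_weight j l))"
    by (rule shifted_growth)
  then show ?thesis
    using path_lower_bound dense_lower_bound AE_ordinary AE_slow_points[OF p(1)]
  proof eventually_elim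
    case (elim \<omega>)
    define e where "e = (\<lambda>j k. \<epsilon> j k \<omega>)"
    have gr: "growth e" using elim(1) by (simp add: growth_def e_def)
    have L: "Limsup (at t) (\<lambda>s. ereal (\<bar>mbm \<psi> \<epsilon> H \<omega> s - mbm \<psi> \<epsilon> H \<omega> t\<bar> / (\<bar>s - t\<bar> powr H t * g \<bar>s - t\<bar>)))
      = oscillation e H t g" for t g
      by (simp add: oscillation_def mbm_def gen_eq e_def)
    note finite = oscillation_finite[OF gr ab H \<gamma> p(3,4)]
    note positive = oscillation_positive[OF gr ab H \<gamma>]
    have rapid: "0 < oscillation e H t ?G1 \<and> oscillation e H t ?G1 < \<infinity>"
      if t: "\<And>n. \<exists>j\<ge>n. 1 / 4 * sqrt (real j) \<le> \<bar>e (int j) \<lfloor>2 ^ j * t\<rfloor>\<bar>" for t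
    proof
      obtain C where C: "C > 0" "local_bound e t p (\<lambda>j. C * sqrt (1 + \<bar>real_of_int j\<bar>))"
        using growth_local_bound[OF gr p(1,2)] by blast
      show "oscillation e H t ?G1 < \<infinity>"
      proof (rule finite[OF C(2) G1])
        show "\<forall>\<^sub>F h in at_right 0. C * sqrt (1 + \<bar>real_of_int \<lfloor>log 2 (1 / h)\<rfloor>\<bar>) \<le> (C * 2) * ?G1 h"
          using rapid_profile by eventually_elim (use C(1) in \<open>simp add: mult.assoc\<close>)
      qed
      show "0 < oscillation e H t ?G1"
        by (rule positive[OF G1 gauge_levels_rapid[OF Hpos], of "1 / 4"]) (use t in auto)
    qed
    have ordinary: "0 < oscillation e H t ?G2 \<and> oscillation e H t ?G2 < \<infinity>" if t: "ordinary_coefficients \<omega> t"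
      for t
    proof
      obtain C where C: "C > 0" "local_bound e t p (\<lambda>j. C * sqrt (ln (3 + \<bar>real_of_int j\<bar>)))"
        using t ordinary_local_bound[of e t _ p] p unfolding ordinary_coefficients_def e_def by blast
      show "oscillation e H t ?G2 < \<infinity>"
      proof (rule finite[OF C(2) G2])
        show "\<forall>\<^sub>F h in at_right 0. C * sqrt (ln (3 + \<bar>real_of_int \<lfloor>log 2 (1 / h)\<rfloor>\<bar>)) \<le> (C * 2) * ?G2 h"
          using ordinary_profile by eventually_elim (use C(1) in \<open>simp add: mult.assoc\<close>)
      qed
      show "0 < oscillation e H t ?G2"
        by (rule positive[OF G2 gauge_levels_ordinary[OF Hpos], of "1 / 4"])
           (use t in \<open>auto simp: ordinary_coefficients_def e_def\<close>)
    qed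
    have slow: "0 < oscillation e H t ?G3 \<and> oscillation e H t ?G3 < \<infinity>" if t: "slow_coefficients p \<omega> t" for t
    proof
      obtain C where C: "C > 0" "local_bound e t p (\<lambda>j. if 0 \<le> j then C else C * sqrt (1 + \<bar>real_of_int j\<bar>))"
        using t slow_local_bound[OF gr p(1,2)] unfolding slow_coefficients_def e_def by blast
      show "oscillation e H t ?G3 < \<infinity>"
      proof (rule finite[OF C(2) G3])
        show "\<forall>\<^sub>F h in at_right 0. (if 0 \<le> \<lfloor>log 2 (1 / h)\<rfloor> then C else C
          * sqrt (1 + \<bar>real_of_int \<lfloor>log 2 (1 / h)\<rfloor>\<bar>)) \<le> C * ?G3 h"
          unfolding eventually_at_right_field by (intro exI[of _ 1]) (auto simp: dyadic_level(1))
      qed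
      \<comment> \<open>The lower bound along dyadic paths holds at every t simultaneously, hence
        also at a random slow point.\<close>
      show "0 < oscillation e H t ?G3"
        by (rule positive[OF G3 gauge_levels_slow, of "1 / 4"]) (use elim(2) in \<open>auto simp: e_def\<close>)
    qed
    show ?case
      unfolding Let_def L
    proof (intro allI impI conjI)
      fix I :: "real set" assume I: "open I \<and> is_interval I \<and> I \<noteq> {}"
      show "\<exists>t\<in>I. 0 < oscillation e H t ?G1 \<and> oscillation e H t ?G1 < \<infinity>"
        using rapid_point_exists[of "1 / 4" "\<lambda>j. sqrt (real j)" e I] elim(3) I rapid unfolding e_def by blast
      show "AE t in lborel. t \<in> I \<longrightarrow> 0 < oscillation e H t ?G2 \<and> oscillation e H t ?G2 < \<infinity>"
        using elim(4) by eventually_elim (use ordinary in blast)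
      \<comment> \<open>A closed octal interval inside I roots a tree, whose limit point is then in
        I.\<close>
      obtain x d where x: "x \<in> I" "d > 0" "ball x d \<subseteq> I" using I open_contains_ball by blast
      obtain n \<kappa> where n: "x \<le> real_of_int \<kappa> / 8 ^ n" "(real_of_int \<kappa> + 1) / 8 ^ n \<le> x + d / 2"
        by (rule dyadic_interval_inside[of x "x + d / 2" 8]) (use x in auto)
      obtain t where t: "real_of_int \<kappa> / 8 ^ n \<le> t" "t
        \<le> (real_of_int \<kappa> + 1) / 8 ^ n" "slow_coefficients p \<omega> t"
        using elim(5) by blast
      have "t \<in> ball x d" using t(1,2) n x(2) by (simp add: dist_real_def)
      then show "\<exists>t\<in>I. 0 < oscillation e H t ?G3 \<and> oscillation e H t ?G3 < \<infinity>" using x(3) slow[OF t(3)]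
        by blast
    qed
  qed
qed

end
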